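(* Let $K$ be a field and let $e,k\ge1$ be integers with $2k\le e-1$ and $e-k\ge4$. Let $S_k=\langle e,\ldots,e+k-1,e+2k,\ldots,2e-1\rangle$ and $R_k=K[X_i: i\in[0,e-1]\setminus[k,2k-1]]$. The Betti numbers $\beta_t$ of the semigroup ring $K[S_k]$ over $R_k$ are $$\beta_t=t\binom{e-k-1}{t+1}+(e-k-1-t)\binom{e-k-1}{t-1},\qquad 1\le t\le e-k-2,$$ and $\beta_{e-k-1}=1$.
   Context: $[a,b]$ is the set of integers $i$ with $a\le i\le b$. $K[S_k]=K[t^s:s\in S_k]$ is an $R_k$-module via $X_i\mapsto t^{e+i}$, and $R_k$ is graded by $\deg X_i=e+i$. $\beta_t$ is the rank of the $t$-th free module in the minimal graded $R_k$-free resolution of $K[S_k]$. *)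

theory Defs
  imports "HOL-Library.Poly_Mapping" "HOL-Computational_Algebra.Polynomial"
begin

section \<open>Numerical semigroups and their semigroup rings\<close>

inductive_set semigroup_gen :: "nat set \<Rightarrow> nat set" for A where
  zero: "0 \<in> semigroup_gen A"
| gen: "a \<in> A \<Longrightarrow> a \<in> semigroup_gen A"
| add: "x \<in> semigroup_gen A \<Longrightarrow> y \<in> semigroup_gen A \<Longrightarrow> x + y \<in> semigroup_gen A"

text \<open>\<open>K[S] = K[t\<^sup>s : s \<in> S]\<close>, the subalgebra of \<open>K[t]\<close> generated by the \<open>t\<^sup>s\<close>; the field
  \<open>K\<close> is the coefficient type.\<close>

inductive_set semigroup_ring :: "nat set \<Rightarrow> 'a::field poly set" for S where
  const: "[:c:] \<in> semigroup_ring S"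
| gen: "s \<in> S \<Longrightarrow> monom 1 s \<in> semigroup_ring S"
| add: "p \<in> semigroup_ring S \<Longrightarrow> q \<in> semigroup_ring S \<Longrightarrow> p + q \<in> semigroup_ring S"
| mult: "p \<in> semigroup_ring S \<Longrightarrow> q \<in> semigroup_ring S \<Longrightarrow> p * q \<in> semigroup_ring S"

definition semigroup_ring_piece :: "nat set \<Rightarrow> int \<Rightarrow> 'a::field poly set" where
  "semigroup_ring_piece S d =
     {p \<in> semigroup_ring S. \<forall>n. coeff p n \<noteq> 0 \<longrightarrow> int n = d}"


section \<open>Graded polynomial rings\<close>

text \<open>Polynomials in variables \<open>X\<^sub>i\<close> (\<open>i :: nat\<close>): finitely supported maps from exponent vectors to
  coefficients. Addition and multiplication are those of \<^theory>\<open>HOL-Library.Poly_Mapping\<close>.\<close>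

type_synonym 'a mpoly = "(nat \<Rightarrow>\<^sub>0 nat) \<Rightarrow>\<^sub>0 'a"

definition polynomial_ring :: "nat set \<Rightarrow> 'a::field mpoly set" where
  "polynomial_ring I = {p. \<forall>m \<in> Poly_Mapping.keys p. Poly_Mapping.keys m \<subseteq> I}"

definition irrelevant_ideal :: "nat set \<Rightarrow> 'a::field mpoly set" where
  "irrelevant_ideal I = {p \<in> polynomial_ring I. Poly_Mapping.lookup p 0 = 0}"

definition weighted_degree :: "(nat \<Rightarrow> nat) \<Rightarrow> (nat \<Rightarrow>\<^sub>0 nat) \<Rightarrow> nat" where
  "weighted_degree w m = (\<Sum>i \<in> Poly_Mapping.keys m. Poly_Mapping.lookup m i * w i)"

definition mpoly_subst :: "(nat \<Rightarrow> 'a::field poly) \<Rightarrow> 'a mpoly \<Rightarrow> 'a poly" where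
  "mpoly_subst \<phi> p = (\<Sum>m \<in> Poly_Mapping.keys p. smult (Poly_Mapping.lookup p m)
     (\<Prod>i \<in> Poly_Mapping.keys m. \<phi> i ^ Poly_Mapping.lookup m i))"


section \<open>Graded free modules\<close>

text \<open>A list \<open>[d\<^sub>0, \<dots>, d\<^sub>n\<^sub>-\<^sub>1]\<close> of shifts encodes the graded free module
  \<open>R(-d\<^sub>0) \<oplus> \<dots> \<oplus> R(-d\<^sub>n\<^sub>-\<^sub>1)\<close> over \<open>R = polynomial_ring I\<close>, where the \<open>j\<close>-th basis element has
  degree \<open>d\<^sub>j\<close>. Its rank is the length of the list. Vectors are finitely supported functions of the
  position \<open>j\<close>.\<close>

type_synonym 'a free_vec = "nat \<Rightarrow>\<^sub>0 'a mpoly"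

definition free_module :: "nat set \<Rightarrow> int list \<Rightarrow> 'a::field free_vec set" where
  "free_module I ds =
     {v. Poly_Mapping.keys v \<subseteq> {..<length ds} \<and>
       (\<forall>j. Poly_Mapping.lookup v j \<in> polynomial_ring I)}"

definition free_module_piece ::
  "nat set \<Rightarrow> (nat \<Rightarrow> nat) \<Rightarrow> int list \<Rightarrow> int \<Rightarrow> 'a::field free_vec set" where
  "free_module_piece I w ds d =
     {v \<in> free_module I ds. \<forall>j < length ds. \<forall>m \<in> Poly_Mapping.keys (Poly_Mapping.lookup v j).
        int (weighted_degree w m) + ds ! j = d}"

text \<open>The submodule \<open>\<mm> F\<close>, with \<open>\<mm>\<close> the irrelevant maximal ideal.\<close>

definition irrelevant_submodule :: "nat set \<Rightarrow> int list \<Rightarrow> 'a::field free_vec set" where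
  "irrelevant_submodule I ds =
     {v \<in> free_module I ds. \<forall>j. Poly_Mapping.lookup v j \<in> irrelevant_ideal I}"

definition free_scale :: "'a::field mpoly \<Rightarrow> 'a free_vec \<Rightarrow> 'a free_vec" where
  "free_scale r v = Poly_Mapping.map (\<lambda>p. r * p) v"


section \<open>Minimal graded free resolutions\<close>

definition module_hom_betw ::
  "'r set \<Rightarrow> ('r \<Rightarrow> 'm \<Rightarrow> 'm) \<Rightarrow> ('r \<Rightarrow> 'n \<Rightarrow> 'n)
     \<Rightarrow> 'm::ab_group_add set \<Rightarrow> 'n::ab_group_add set \<Rightarrow> ('m \<Rightarrow> 'n) \<Rightarrow> bool" where
  "module_hom_betw R scale1 scale2 M N f \<longleftrightarrow>
     f ` M \<subseteq> N \<and>
     (\<forall>u \<in> M. \<forall>v \<in> M. f (u + v) = f u + f v) \<and>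
     (\<forall>r \<in> R. \<forall>v \<in> M. f (scale1 r v) = scale2 r (f v))"

text \<open>The module \<open>M\<close> over \<open>R = polynomial_ring I\<close> (graded by \<open>deg X\<^sub>i = w i\<close>) has scalar
  multiplication \<open>scale\<close> and graded pieces \<open>piece d\<close>. The resolution is
  \<open>\<dots> \<rightarrow> F\<^sub>2 \<rightarrow> F\<^sub>1 \<rightarrow> F\<^sub>0 \<rightarrow> M \<rightarrow> 0\<close>, where \<open>F\<^sub>t\<close> is the graded free module with shifts \<open>sh t\<close>,
  the differential \<open>\<delta> t\<close> goes from \<open>F\<^sub>t\<^sub>+\<^sub>1\<close> to \<open>F\<^sub>t\<close>, and \<open>\<epsilon>\<close> is the augmentation. Maps are only
  constrained on these carriers.\<close>

definition graded_free_resolution ::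
  "nat set \<Rightarrow> (nat \<Rightarrow> nat) \<Rightarrow> ('a::field mpoly \<Rightarrow> 'm \<Rightarrow> 'm) \<Rightarrow> 'm::ab_group_add set
     \<Rightarrow> (int \<Rightarrow> 'm set) \<Rightarrow> (nat \<Rightarrow> int list) \<Rightarrow> (nat \<Rightarrow> 'a free_vec \<Rightarrow> 'a free_vec)
     \<Rightarrow> ('a free_vec \<Rightarrow> 'm) \<Rightarrow> bool" where
  "graded_free_resolution I w scale M piece sh \<delta> \<epsilon> \<longleftrightarrow>
     module_hom_betw (polynomial_ring I) free_scale scale (free_module I (sh 0)) M \<epsilon> \<and>
     (\<forall>d. \<epsilon> ` free_module_piece I w (sh 0) d \<subseteq> piece d) \<and>
     (\<forall>t. module_hom_betw (polynomial_ring I) free_scale free_scale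
            (free_module I (sh (Suc t))) (free_module I (sh t)) (\<delta> t)) \<and>
     (\<forall>t d. \<delta> t ` free_module_piece I w (sh (Suc t)) d \<subseteq> free_module_piece I w (sh t) d) \<and>
     \<epsilon> ` free_module I (sh 0) = M \<and>
     \<delta> 0 ` free_module I (sh 1) = {v \<in> free_module I (sh 0). \<epsilon> v = 0} \<and>
     (\<forall>t. \<delta> (Suc t) ` free_module I (sh (Suc (Suc t))) =
            {v \<in> free_module I (sh (Suc t)). \<delta> t v = 0})"

definition minimal_graded_free_resolution ::
  "nat set \<Rightarrow> (nat \<Rightarrow> nat) \<Rightarrow> ('a::field mpoly \<Rightarrow> 'm \<Rightarrow> 'm) \<Rightarrow> 'm::ab_group_add set
     \<Rightarrow> (int \<Rightarrow> 'm set) \<Rightarrow> (nat \<Rightarrow> int list) \<Rightarrow> (nat \<Rightarrow> 'a free_vec \<Rightarrow> 'a free_vec)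
     \<Rightarrow> ('a free_vec \<Rightarrow> 'm) \<Rightarrow> bool" where
  "minimal_graded_free_resolution I w scale M piece sh \<delta> \<epsilon> \<longleftrightarrow>
     graded_free_resolution I w scale M piece sh \<delta> \<epsilon> \<and>
     (\<forall>t. \<delta> t ` free_module I (sh (Suc t)) \<subseteq> irrelevant_submodule I (sh t))"

text \<open>\<open>b\<close> is the \<open>t\<close>-th Betti number of \<open>M\<close>: a minimal graded free resolution (by finitely
  generated free modules) exists, and in each of them the \<open>t\<close>-th free module has rank \<open>b\<close>.\<close>

definition has_betti_number ::
  "nat set \<Rightarrow> (nat \<Rightarrow> nat) \<Rightarrow> ('a::field mpoly \<Rightarrow> 'm \<Rightarrow> 'm) \<Rightarrow> 'm::ab_group_add set
     \<Rightarrow> (int \<Rightarrow> 'm set) \<Rightarrow> nat \<Rightarrow> nat \<Rightarrow> bool" where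
  "has_betti_number I w scale M piece t b \<longleftrightarrow>
     (\<exists>sh \<delta> \<epsilon>. minimal_graded_free_resolution I w scale M piece sh \<delta> \<epsilon>) \<and>
     (\<forall>sh \<delta> \<epsilon>. minimal_graded_free_resolution I w scale M piece sh \<delta> \<epsilon> \<longrightarrow> length (sh t) = b)"


section \<open>The semigroups \<open>S\<^sub>k\<close>\<close>

definition S_sg :: "nat \<Rightarrow> nat \<Rightarrow> nat set" where
  "S_sg e k = semigroup_gen ({e..e + k - 1} \<union> {e + 2 * k..2 * e - 1})"

text \<open>The index set of the variables of \<open>R\<^sub>k\<close>.\<close>

definition R_vars :: "nat \<Rightarrow> nat \<Rightarrow> nat set" where
  "R_vars e k = {0..e - 1} - {k..2 * k - 1}"

text \<open>The action of \<open>R\<^sub>k\<close> on \<open>K[S\<^sub>k]\<close> via \<open>X\<^sub>i \<mapsto> t\<^sup>e\<^sup>+\<^sup>i\<close>.\<close>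

definition R_act :: "nat \<Rightarrow> 'a::field mpoly \<Rightarrow> 'a poly \<Rightarrow> 'a poly" where
  "R_act e r f = mpoly_subst (\<lambda>i. monom 1 (e + i)) r * f"

text \<open>\<open>b\<close> is the \<open>t\<close>-th Betti number of \<open>K[S\<^sub>k]\<close> over \<open>R\<^sub>k\<close>, where \<open>deg X\<^sub>i = e + i\<close> and \<open>K\<close> is the
  type given as first argument.\<close>

definition has_betti_number_S :: "'a::field itself \<Rightarrow> nat \<Rightarrow> nat \<Rightarrow> nat \<Rightarrow> nat \<Rightarrow> bool" where
  "has_betti_number_S K e k t b \<longleftrightarrow>
     has_betti_number (R_vars e k) (\<lambda>i. e + i) (R_act e :: 'a mpoly \<Rightarrow> 'a poly \<Rightarrow> 'a poly)
       (semigroup_ring (S_sg e k)) (semigroup_ring_piece (S_sg e k)) t b"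

end

theory Submission
  imports Defs "HOL-Library.Function_Algebras"
begin

text \<open>
  Two facts combine.

  (1) Betti numbers are dimensions of Koszul homology. If \<open>F\<close> is a minimal graded free resolution of
  \<open>M\<close> over a polynomial ring \<open>R\<close>, with irrelevant ideal \<open>\<mm>\<close>, then the syzygy modules \<open>Z\<^sub>t\<close> satisfy
  \<open>H\<^sub>i(Z\<^sub>t) = H\<^sub>i\<^sub>+\<^sub>1(Z\<^sub>t\<^sub>-\<^sub>1)\<close> for Koszul homology, because the Koszul complex of a free module is acyclic
  in positive degrees (\<open>free_module_acyclic\<close>) and \<open>Z\<^sub>t\<close> lies in \<open>\<mm>F\<close> (\<open>dimension_shift\<close>). Hence
  \<open>F\<^sub>t/\<mm>F\<^sub>t = H\<^sub>t(M)\<close> for every minimal resolution (\<open>minimal_resolution_rank\<close>). In the other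
  direction, if all \<open>H\<^sub>t(M)\<close> are finite-dimensional, then \<open>Z\<^sub>t/\<mm>Z\<^sub>t\<close> is finite-dimensional at each
  stage, and graded Nakayama builds a minimal resolution one step after the other
  (\<open>minimal_cover_exists\<close>, \<open>minimal_resolution_exists\<close>).

  (2) The Koszul homology of \<open>K[S\<^sub>k]\<close> is linear algebra. The variable \<open>X\<^sub>0\<close> acts as the nonzerodivisor
  \<open>t\<^sup>e\<close>, so \<open>K[S\<^sub>k]\<close> may be replaced by \<open>A = K[S\<^sub>k]/(t\<^sup>e)\<close> over the remaining \<open>n = e-k-1\<close> variables
  (\<open>homology_reduction\<close>, \<open>apery_reduction\<close>). A basis of \<open>A\<close> is given by the Apery elements of \<open>S\<^sub>k\<close>:
  \<open>1\<close>, the \<open>n\<close> variables \<open>x\<^sub>i\<close>, the \<open>k-1\<close> products \<open>z\<^sub>r\<close> with \<open>k \<le> r \<le> 2k-2\<close>, and a socle element. Here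
  \<open>x\<^sub>i x\<^sub>j = z\<^sub>i\<^sub>+\<^sub>j\<close> if \<open>i, j < k \<le> i+j\<close>; every \<open>x\<^sub>i\<close> has exactly one basis vector that it multiplies to
  the socle element; all other products of an \<open>x\<^sub>i\<close> with a basis vector other than \<open>1\<close> vanish. The
  differential of the Koszul complex of \<open>A\<close> has in degree \<open>1 \<le> t \<le> n\<close> the rank
  \<open>(n choose t) + (n choose (t-1)) + (k-1) ((n-1) choose (t-1))\<close>: it is injective on the multiples
  of \<open>1\<close>, it reaches all multiples of the socle element, and in the products its equations satisfy the
  relations of a Hankel pattern, which leave those at the sets without the index \<open>k-1\<close>
  (\<open>pivot_equations_redundant\<close>, \<open>cycle_equations_independent\<close>). Subtracting two consecutive ranks from
  \<open>e (n choose t)\<close> gives \<open>n (n choose t) - (n choose (t+1)) - (n choose (t-1))\<close> for \<open>t < n\<close>, which is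
  the claimed number (\<open>betti_binomial_identity\<close>), and \<open>1\<close> for \<open>t = n\<close>.
\<close>

section \<open>Dimensions of quotients of vector spaces\<close>

definition linear_functional_on ::
  "('a::field \<Rightarrow> 'm::ab_group_add \<Rightarrow> 'm) \<Rightarrow> 'm set \<Rightarrow> ('m \<Rightarrow> 'a) \<Rightarrow> bool" where
  "linear_functional_on sc V f \<longleftrightarrow>
     (\<forall>u\<in>V. \<forall>v\<in>V. f (u + v) = f u + f v) \<and> (\<forall>c. \<forall>v\<in>V. f (sc c v) = c * f v)"

text \<open>\<open>dim V/W = n\<close>, witnessed by \<open>n\<close> functionals on \<open>V\<close> that are jointly onto \<open>K\<^sup>n\<close> and have
  common kernel \<open>W\<close>. The spaces themselves may be infinite-dimensional, and in the applications they
  often are.\<close>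

definition quotient_dim ::
  "('a::field \<Rightarrow> 'm::ab_group_add \<Rightarrow> 'm) \<Rightarrow> 'm set \<Rightarrow> 'm set \<Rightarrow> nat \<Rightarrow> bool" where
  "quotient_dim sc V W n \<longleftrightarrow>
     (\<exists>f. (\<forall>i<n. linear_functional_on sc V (f i)) \<and> (\<forall>a. \<exists>v\<in>V. \<forall>i<n. f i v = a i) \<and>
          W = {v \<in> V. \<forall>i<n. f i v = 0})"

lemma linear_functional_onD:
  assumes "linear_functional_on sc V f"
  shows "u \<in> V \<Longrightarrow> v \<in> V \<Longrightarrow> f (u + v) = f u + f v" "v \<in> V \<Longrightarrow> f (sc c v) = c * f v"
  using assms by (auto simp: linear_functional_on_def)

lemma linear_functional_on_subset:
  "linear_functional_on sc V f \<Longrightarrow> U \<subseteq> V \<Longrightarrow> linear_functional_on sc U f"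
  unfolding linear_functional_on_def by blast

lemma quotient_dimI:
  fixes f :: "'i \<Rightarrow> 'm::ab_group_add \<Rightarrow> 'a::field"
  assumes "finite A" "\<And>i. i \<in> A \<Longrightarrow> linear_functional_on sc V (f i)"
    "\<And>a. \<exists>v\<in>V. \<forall>i\<in>A. f i v = a i" "W = {v \<in> V. \<forall>i\<in>A. f i v = 0}"
  shows "quotient_dim sc V W (card A)"
proof -
  obtain h where h: "bij_betw h {..<card A} A"
    using ex_bij_betw_nat_finite[OF assms(1)] by (auto simp: atLeast0LessThan)
  define g where "g = inv_into {..<card A} h"
  have gh: "g (h i) = i" if "i < card A" for i
    using h that by (simp add: bij_betw_def g_def)
  have hA: "h i \<in> A" if "i < card A" for i
    using h that by (auto simp: bij_betw_def)
  have A: "\<exists>i<card A. j = h i" if "j \<in> A" for j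
    using h that by (auto simp: bij_betw_def)
  show ?thesis unfolding quotient_dim_def
  proof (intro exI[of _ "\<lambda>i. f (h i)"] conjI allI impI)
    show "\<exists>v\<in>V. \<forall>i<card A. f (h i) v = a i" for a
    proof -
      obtain v where "v \<in> V" "\<forall>j\<in>A. f j v = a (g j)" using assms(3)[of "\<lambda>j. a (g j)"] by blast
      then show ?thesis by (intro bexI[of _ v]) (auto simp: gh hA)
    qed
    show "W = {v \<in> V. \<forall>i<card A. f (h i) v = 0}"
      unfolding assms(4) using A hA by fast
  qed (simp add: assms(2) hA)
qed

lemma homogeneous_system_nontrivial_solution:
  fixes v :: "'i \<Rightarrow> nat \<Rightarrow> 'a::field"
  assumes "finite J" "card J > n"
  shows "\<exists>c. (\<exists>j\<in>J. c j \<noteq> 0) \<and> (\<forall>i<n. (\<Sum>j\<in>J. c j * v j i) = 0)"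
  using assms
proof (induction n arbitrary: J v)
  case 0
  then show ?case by (intro exI[of _ "\<lambda>_. 1"]) (auto simp: card_gt_0_iff)
next
  case (Suc n)
  show ?case
  proof (cases "\<forall>j\<in>J. v j n = 0")
    case True
    have "card J > n" using Suc.prems(2) by simp
    from Suc.IH[OF Suc.prems(1) this, of v] obtain c where c: "\<exists>j\<in>J. c j \<noteq> 0" "\<forall>i<n. (\<Sum>j\<in>J. c j * v j i) = 0" by blast
    then have "\<forall>i<Suc n. (\<Sum>j\<in>J. c j * v j i) = 0" using True by (auto simp: less_Suc_eq)
    with c(1) show ?thesis by blast
  next
    case False
    then obtain p where p: "p \<in> J" "v p n \<noteq> 0" by blast
    \<comment> \<open>Gaussian elimination of the coordinate \<open>n\<close> with \<open>v p\<close> as the pivot row.\<close>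
    define w where "w = (\<lambda>j i. v j i - v j n / v p n * v p i)"
    have "card (J - {p}) > n" using Suc.prems p by simp
    then obtain c where c: "\<exists>j\<in>J - {p}. c j \<noteq> 0" "\<forall>i<n. (\<Sum>j\<in>J - {p}. c j * w j i) = 0"
      using Suc.IH[of "J - {p}" w] Suc.prems by auto
    define q where "q = - (\<Sum>j\<in>J - {p}. c j * (v j n / v p n))"
    define c' where "c' = (\<lambda>j. if j = p then q else c j)"
    have "(\<Sum>j\<in>J. c' j * v j i) = (\<Sum>j\<in>J - {p}. c j * w j i)" for i
    proof -
      have "(\<Sum>j\<in>J. c' j * v j i) = q * v p i + (\<Sum>j\<in>J - {p}. c j * v j i)"
        using Suc.prems(1) p(1) by (simp add: sum.remove c'_def)
      also have "\<dots> = (\<Sum>j\<in>J - {p}. c j * w j i)"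
        by (simp add: q_def w_def algebra_simps sum_subtractf sum_distrib_left sum_negf)
      finally show ?thesis .
    qed
    moreover have "w j n = 0" for j using p by (simp add: w_def)
    ultimately have "\<forall>i<Suc n. (\<Sum>j\<in>J. c' j * v j i) = 0"
      using c(2) by (auto simp: less_Suc_eq)
    moreover have "\<exists>j\<in>J. c' j \<noteq> 0" using c(1) by (auto simp: c'_def)
    ultimately show ?thesis by blast
  qed
qed

context vector_space
begin


lemma lin_on_sum:
  assumes "subspace V" "linear_functional_on scale V f" "\<And>j. j \<in> J \<Longrightarrow> v j \<in> V"
  shows "f (\<Sum>j\<in>J. c j *s v j) = (\<Sum>j\<in>J. c j * f (v j))"
proof -
  have f0: "f 0 = 0"
    using linear_functional_onD(2)[OF assms(2) subspace_0[OF assms(1)], of 0] by simp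
  show ?thesis
    using assms(3)
  proof (induction J rule: infinite_finite_induct)
    case (insert j J)
    have "(\<Sum>j\<in>J. c j *s v j) \<in> V"
      using insert by (intro subspace_sum[OF assms(1)] subspace_scale[OF assms(1)]) auto
    then show ?case
      using insert by (simp add: linear_functional_onD[OF assms(2)] subspace_scale[OF assms(1)])
  qed (auto simp: f0)
qed

lemma lin_on_diff:
  assumes "subspace V" "linear_functional_on scale V f" "u \<in> V" "v \<in> V"
  shows "f (u - v) = f u - f v"
proof -
  have "f (u - v) = f (u + (-1) *s v)" by simp
  also have "\<dots> = f u - f v"
    using assms(3,4) subspace_scale[OF assms(1,4), of "-1"]
    by (subst linear_functional_onD(1)[OF assms(2)]; simp only: linear_functional_onD(2)[OF assms(2)]) auto
  finally show ?thesis .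
qed

lemma qdim_independent_card_le:
  assumes V: "subspace V" and q: "quotient_dim scale V W n" and J: "finite J" "\<And>j. j \<in> J \<Longrightarrow> v j \<in> V"
    and ind: "\<And>c. (\<Sum>j\<in>J. c j *s v j) \<in> W \<Longrightarrow> \<forall>j\<in>J. c j = 0"
  shows "card J \<le> n"
proof (rule ccontr)
  assume *: "\<not> card J \<le> n"
  obtain f where f: "\<forall>i<n. linear_functional_on scale V (f i)" "W = {v \<in> V. \<forall>i<n. f i v = 0}"
    using q unfolding quotient_dim_def by blast
  obtain c where c: "\<exists>j\<in>J. c j \<noteq> 0" "\<forall>i<n. (\<Sum>j\<in>J. c j * f i (v j)) = 0"
    using homogeneous_system_nontrivial_solution[OF J(1), of n "\<lambda>j i. f i (v j)"] * by auto
  have "(\<Sum>j\<in>J. c j *s v j) \<in> V"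
    using J by (intro subspace_sum[OF V] subspace_scale[OF V])
  then have "(\<Sum>j\<in>J. c j *s v j) \<in> W"
    using c(2) f J(2) by (simp add: lin_on_sum[OF V])
  with ind c(1) show False by blast
qed

lemma qdim_dual_vectors:
  assumes "subspace V" "\<forall>i<n. linear_functional_on scale V (f i)" "\<forall>a. \<exists>v\<in>V. \<forall>i<n. f i v = a i"
  obtains e where "\<And>j. e j \<in> V" "\<And>i j. i < n \<Longrightarrow> f i (e j) = (if i = j then 1 else 0)"
proof -
  have "\<exists>v\<in>V. \<forall>i<n. f i v = (if i = j then 1 else 0)" for j
    using assms(3)[rule_format, of "\<lambda>i. if i = j then 1 else 0"] .
  then show thesis using that by metis
qed

lemma qdim_le:
  assumes V: "subspace V" and "quotient_dim scale V W n" "quotient_dim scale V W m"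
  shows "n \<le> m"
proof -
  obtain f where f: "\<forall>i<n. linear_functional_on scale V (f i)" "\<forall>a. \<exists>v\<in>V. \<forall>i<n. f i v = a i"
    "W = {v \<in> V. \<forall>i<n. f i v = 0}"
    using assms(2) unfolding quotient_dim_def by blast
  obtain e where e: "\<And>j. e j \<in> V" "\<And>i j. i < n \<Longrightarrow> f i (e j) = (if i = j then 1 else 0)"
    using qdim_dual_vectors[OF V f(1,2)] by blast
  have "card {..<n} \<le> m"
  proof (rule qdim_independent_card_le[OF V assms(3), of _ e])
    fix c assume "(\<Sum>j<n. c j *s e j) \<in> W"
    then have "\<forall>i<n. (\<Sum>j<n. c j * f i (e j)) = 0"
      using f(1,3) e(1) by (auto simp: lin_on_sum[OF V])
    then show "\<forall>j\<in>{..<n}. c j = 0" by (auto simp: e(2) if_distrib cong: if_cong)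
  qed (auto simp: e)
  then show ?thesis by simp
qed

lemma qdim_unique: "subspace V \<Longrightarrow> quotient_dim scale V W n \<Longrightarrow> quotient_dim scale V W m \<Longrightarrow> n = m"
  using qdim_le by (meson antisym)

lemma qdim_self: "quotient_dim scale V V 0"
  if "V \<noteq> {}"
  using that by (auto simp: quotient_dim_def)

lemma qdim_add:
  assumes V: "subspace V" and U: "subspace U" and q: "quotient_dim scale V U a" "quotient_dim scale U W b"
  shows "quotient_dim scale V W (a + b)"
proof -
  obtain f where f: "\<forall>i<a. linear_functional_on scale V (f i)" "\<forall>y. \<exists>v\<in>V. \<forall>i<a. f i v = y i"
    "U = {v \<in> V. \<forall>i<a. f i v = 0}"
    using q(1) unfolding quotient_dim_def by blast
  obtain g where g: "\<forall>i<b. linear_functional_on scale U (g i)" "\<forall>y. \<exists>v\<in>U. \<forall>i<b. g i v = y i"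
    "W = {v \<in> U. \<forall>i<b. g i v = 0}"
    using q(2) unfolding quotient_dim_def by blast
  obtain e where e: "\<And>j. e j \<in> V" "\<And>i j. i < a \<Longrightarrow> f i (e j) = (if i = j then 1 else 0)"
    using qdim_dual_vectors[OF V f(1,2)] by blast
  \<comment> \<open>The \<open>e j\<close> span a complement of \<open>U\<close>; \<open>pr\<close> is the projection to \<open>U\<close> along it.\<close>
  define pr where "pr = (\<lambda>v. v - (\<Sum>j<a. f j v *s e j))"
  have sumV: "(\<Sum>j<a. y j *s e j) \<in> V" for y
    using e by (intro subspace_sum[OF V] subspace_scale[OF V])
  have f_sum: "f i (\<Sum>j<a. y j *s e j) = y i" if "i < a" for i y
  proof -
    have "f i (\<Sum>j<a. y j *s e j) = (\<Sum>j<a. y j * f i (e j))"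
      using that f(1) e(1) by (intro lin_on_sum[OF V]) auto
    also have "\<dots> = (\<Sum>j<a. if i = j then y j else 0)"
      using that by (intro sum.cong) (auto simp: e(2))
    finally show ?thesis using that by simp
  qed
  have pr: "pr v \<in> U" if "v \<in> V" for v
    using that f(1) sumV f_sum by (auto simp: f(3) pr_def lin_on_diff[OF V] subspace_diff[OF V])
  have pr_add: "pr (u + v) = pr u + pr v" if "u \<in> V" "v \<in> V" for u v
  proof -
    have "(\<Sum>j<a. f j (u + v) *s e j) = (\<Sum>j<a. f j u *s e j + f j v *s e j)"
      using that f(1) by (intro sum.cong)
        (auto simp: linear_functional_onD(1)[of _ V] scale_left_distrib)
    then show ?thesis by (simp add: pr_def sum.distrib)
  qed
  have pr_scale: "pr (c *s v) = c *s pr v" if "v \<in> V" for c v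
  proof -
    have "(\<Sum>j<a. f j (c *s v) *s e j) = (\<Sum>j<a. c *s (f j v *s e j))"
      using that f(1) by (intro sum.cong) (auto simp: linear_functional_onD(2)[of _ V])
    then show ?thesis by (simp add: pr_def scale_right_diff_distrib scale_sum_right)
  qed
  have pr_id: "pr v = v" if "v \<in> U" for v
    using that by (simp add: pr_def f(3))
  define h where "h = (\<lambda>i. if i < a then f i else (\<lambda>v. g (i - a) (pr v)))"
  have lin: "linear_functional_on scale V (h i)" if "i < a + b" for i
  proof (cases "i < a")
    case False
    then have "linear_functional_on scale U (g (i - a))" using g(1) that by auto
    then have "linear_functional_on scale V (\<lambda>v. g (i - a) (pr v))"
      unfolding linear_functional_on_def by (simp add: pr pr_add pr_scale)
    then show ?thesis using False by (simp add: h_def)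
  qed (simp add: h_def f(1))
  have onto: "\<exists>v\<in>V. \<forall>i<a + b. h i v = y i" for y
  proof -
    obtain u where u: "u \<in> U" "\<forall>i<b. g i u = y (a + i)"
      using g(2)[rule_format, of "\<lambda>i. y (a + i)"] by blast
    define v where "v = (\<Sum>j<a. y j *s e j) + u"
    have uV: "u \<in> V" using u f(3) by auto
    have "pr (\<Sum>j<a. y j *s e j) = 0" by (simp add: pr_def f_sum)
    then have "pr v = u" by (simp add: v_def pr_add sumV uV pr_id u)
    moreover have "f i v = y i" if "i < a" for i
    proof -
      have "f i v = f i (\<Sum>j<a. y j *s e j) + f i u"
        unfolding v_def using f(1) that by (intro linear_functional_onD(1)[of scale V] sumV uV) auto
      then show ?thesis using that u(1) f_sum f(3) by auto
    qed
    ultimately have "\<forall>i<a + b. h i v = y i"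
      using u(2) by (auto simp: h_def)
    moreover have "v \<in> V" by (simp add: v_def sumV uV subspace_add[OF V])
    ultimately show ?thesis by blast
  qed
  have ker: "W = {v \<in> V. \<forall>i<a + b. h i v = 0}"
  proof (intro equalityI subsetI)
    fix v assume v: "v \<in> W"
    then have "v \<in> U" by (simp add: g(3))
    with v show "v \<in> {v \<in> V. \<forall>i<a + b. h i v = 0}"
      by (auto simp: h_def pr_id f(3) g(3))
  next
    fix v assume v: "v \<in> {v \<in> V. \<forall>i<a + b. h i v = 0}"
    have "f i v = 0" if "i < a" for i using v that by (auto simp: h_def dest!: spec[of _ i])
    then have vU: "v \<in> U" using v by (simp add: f(3))
    have "g i v = 0" if "i < b" for i
      using v that by (auto simp: h_def pr_id[OF vU] dest!: spec[of _ "a + i"])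
    with vU show "v \<in> W" by (simp add: g(3))
  qed
  show ?thesis unfolding quotient_dim_def using lin onto ker by blast
qed

lemma qdim_hyperplane:
  assumes V: "subspace V" and f: "linear_functional_on scale V f" and u: "u \<in> V" "f u = 1"
  shows "quotient_dim scale V {v \<in> V. f v = 0} 1"
  unfolding quotient_dim_def
proof (intro exI[of _ "\<lambda>_. f"] conjI allI)
  show "\<exists>v\<in>V. \<forall>i<1. f v = a i" for a :: "nat \<Rightarrow> 'a"
    using u linear_functional_onD(2)[OF f u(1), of "a 0"] subspace_scale[OF V u(1), of "a 0"] by auto
qed (use f in auto)

text \<open>Induction on \<open>dim V/W\<close>: a hyperplane \<open>V'\<close> of \<open>V\<close> over \<open>W\<close> cuts \<open>U\<close> in \<open>U\<close> itself or in a
  hyperplane of \<open>U\<close>; in the second case \<open>V/U = V'/(U \<inter> V')\<close>.\<close>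

lemma qdim_intermediate:
  assumes "subspace V" "subspace U" "quotient_dim scale V W n" "W \<subseteq> U" "U \<subseteq> V"
  shows "\<exists>a b. quotient_dim scale V U a \<and> quotient_dim scale U W b"
  using assms
proof (induction n arbitrary: V U)
  case 0
  then have "W = V" by (auto simp: quotient_dim_def)
  then have "U = V" using 0 by auto
  then show ?case using 0 \<open>W = V\<close> subspace_0 qdim_self by blast
next
  case (Suc n)
  note V = Suc.prems(1) and U = Suc.prems(2)
  obtain f where f: "\<forall>i<Suc n. linear_functional_on scale V (f i)" "\<forall>y. \<exists>v\<in>V. \<forall>i<Suc n. f i v = y i"
    "W = {v \<in> V. \<forall>i<Suc n. f i v = 0}"
    using Suc.prems(3) unfolding quotient_dim_def by blast
  have fn: "linear_functional_on scale V (f n)" using f(1) by simp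
  define V1 where "V1 = {v \<in> V. f n v = 0}"
  define U1 where "U1 = U \<inter> V1"
  have fn0: "f n 0 = 0" using linear_functional_onD(2)[OF fn subspace_0[OF V], of 0] by simp
  have V1: "subspace V1"
    using V by (auto simp: subspace_def V1_def linear_functional_onD[OF fn] fn0)
  have U1: "subspace U1" unfolding U1_def by (rule subspace_inter[OF U V1])
  have "quotient_dim scale V1 W n"
    unfolding quotient_dim_def
  proof (intro exI[of _ f] conjI allI impI)
    show "linear_functional_on scale V1 (f i)" if "i < n" for i
      by (rule linear_functional_on_subset[of scale V "f i" V1]) (use f(1) that in \<open>auto simp: V1_def\<close>)
    show "\<exists>v\<in>V1. \<forall>i<n. f i v = y i" for y
    proof -
      obtain v where "v \<in> V" "\<forall>i<Suc n. f i v = (if i < n then y i else 0)"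
        using f(2)[rule_format, of "\<lambda>i. if i < n then y i else 0"] by blast
      then show ?thesis unfolding V1_def by (intro bexI[of _ v]) auto
    qed
    show "W = {v \<in> V1. \<forall>i<n. f i v = 0}" by (auto simp: f(3) V1_def less_Suc_eq)
  qed
  moreover have "W \<subseteq> U1" using Suc.prems(4) f(3) by (auto simp: U1_def V1_def)
  ultimately obtain a b where ab: "quotient_dim scale V1 U1 a" "quotient_dim scale U1 W b"
    using Suc.IH[OF V1 U1] by (auto simp: U1_def)
  obtain v1 where v1: "v1 \<in> V" "f n v1 = 1"
    using f(2)[rule_format, of "\<lambda>_. 1"] by auto
  show ?case
  proof (cases "U \<subseteq> V1")
    case True
    then have "U1 = U" by (auto simp: U1_def)
    moreover have "quotient_dim scale V V1 1"
      unfolding V1_def by (rule qdim_hyperplane[OF V fn v1])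
    ultimately show ?thesis using qdim_add[OF V V1 _ ab(1)] ab(2) by auto
  next
    case False
    then obtain u0 where u0: "u0 \<in> U" "f n u0 \<noteq> 0" using Suc.prems(5) by (auto simp: V1_def)
    define u where "u = inverse (f n u0) *s u0"
    have u: "u \<in> U" "f n u = 1"
      using u0 Suc.prems(5) by (auto simp: u_def subspace_scale[OF U] linear_functional_onD[OF fn] subsetD)
    have "quotient_dim scale U U1 1"
    proof -
      have "U1 = {v \<in> U. f n v = 0}" using Suc.prems(5) by (auto simp: U1_def V1_def)
      then show ?thesis
        using qdim_hyperplane[OF U linear_functional_on_subset[OF fn Suc.prems(5)] u] by simp
    qed
    then have "quotient_dim scale U W (1 + b)" using qdim_add[OF U U1 _ ab(2)] by blast
    moreover have "quotient_dim scale V U a"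
    proof -
      have uV: "u \<in> V" using u Suc.prems(5) by auto
      obtain g where g: "\<forall>i<a. linear_functional_on scale V1 (g i)" "\<forall>y. \<exists>v\<in>V1. \<forall>i<a. g i v = y i"
        "U1 = {v \<in> V1. \<forall>i<a. g i v = 0}"
        using ab(1) unfolding quotient_dim_def by blast
      define pr where "pr = (\<lambda>v. v - f n v *s u)"
      have prV: "pr v \<in> V" if "v \<in> V" for v
        using that uV by (simp add: pr_def subspace_diff[OF V] subspace_scale[OF V])
      have pr: "pr v \<in> V1" if "v \<in> V" for v
        using that uV u prV unfolding V1_def
        by (simp add: pr_def lin_on_diff[OF V fn] linear_functional_onD[OF fn] subspace_scale[OF V])
      have prU: "pr v \<in> U \<longleftrightarrow> v \<in> U" for v
      proof
        assume "pr v \<in> U"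
        then have "pr v + f n v *s u \<in> U" using u by (intro subspace_add[OF U] subspace_scale[OF U])
        then show "v \<in> U" by (simp add: pr_def)
      qed (simp add: pr_def u subspace_diff[OF U] subspace_scale[OF U])
      have pr_add: "pr (v + w) = pr v + pr w" if "v \<in> V" "w \<in> V" for v w
        using that by (simp add: pr_def linear_functional_onD[OF fn] scale_left_distrib)
      have pr_scale: "pr (c *s v) = c *s pr v" if "v \<in> V" for c v
        using that by (simp add: pr_def linear_functional_onD[OF fn] scale_right_diff_distrib)
      show ?thesis unfolding quotient_dim_def
      proof (intro exI[of _ "\<lambda>i v. g i (pr v)"] conjI allI impI)
        show "linear_functional_on scale V (\<lambda>v. g i (pr v))" if "i < a" for i
          using g(1) that unfolding linear_functional_on_def by (simp add: pr pr_add pr_scale)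
        show "\<exists>v\<in>V. \<forall>i<a. g i (pr v) = y i" for y
        proof -
          obtain v where v: "v \<in> V1" "\<forall>i<a. g i v = y i" using g(2) by blast
          then have "pr v = v" "v \<in> V" by (auto simp: pr_def V1_def)
          with v show ?thesis by (intro bexI[of _ v]) auto
        qed
        show "U = {v \<in> V. \<forall>i<a. g i (pr v) = 0}"
        proof (intro equalityI subsetI)
          fix v assume v: "v \<in> U"
          then have "v \<in> V" using Suc.prems(5) by auto
          then have "pr v \<in> U1" using v by (auto simp: U1_def prU pr)
          then show "v \<in> {v \<in> V. \<forall>i<a. g i (pr v) = 0}" using \<open>v \<in> V\<close> by (auto simp: g(3))
        next
          fix v assume "v \<in> {v \<in> V. \<forall>i<a. g i (pr v) = 0}"
          then have "pr v \<in> U1" using pr by (auto simp: g(3))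
          then show "v \<in> U" by (auto simp: U1_def prU)
        qed
      qed
    qed
    ultimately show ?thesis by blast
  qed
qed

text \<open>With cycles \<open>U1\<close> and boundaries \<open>U2\<close> in a space of chains \<open>V\<close>, this computes homology from the
  ranks of two consecutive differentials.\<close>

lemma qdim_subquotient:
  assumes "subspace V" "subspace U1" "subspace U2" "W \<subseteq> U2" "U2 \<subseteq> U1" "U1 \<subseteq> V"
    and "quotient_dim scale V W n" "quotient_dim scale V U1 r" "quotient_dim scale U2 W s"
  shows "r + s \<le> n \<and> quotient_dim scale U1 U2 (n - r - s)"
proof -
  have "W \<subseteq> U1" using assms by blast
  then obtain a b where a: "quotient_dim scale V U1 a" "quotient_dim scale U1 W b"
    using qdim_intermediate[OF assms(1,2,7)] assms(6) by blast
  obtain c d where c: "quotient_dim scale U1 U2 c" "quotient_dim scale U2 W d"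
    using qdim_intermediate[OF assms(2,3) a(2) assms(4,5)] by blast
  have "quotient_dim scale U1 W (c + s)" by (rule qdim_add[OF assms(2,3) c(1) assms(9)])
  then have "quotient_dim scale V W (r + (c + s))" by (rule qdim_add[OF assms(1,2,8)])
  then have "n = r + (c + s)" using qdim_unique[OF assms(1) assms(7)] by blast
  then show ?thesis using c(1) by simp
qed

end

text \<open>Quotient dimensions are carried along a linear correspondence \<open>L\<close> between \<open>V\<close> and \<open>V'\<close> that
  matches \<open>W\<close> with \<open>W'\<close>: such an \<open>L\<close> is the graph of an isomorphism \<open>V/W \<cong> V'/W'\<close>. Connecting
  homomorphisms are correspondences in a natural way, but functions only after choices.\<close>

lemma quotient_dim_transfer:
  fixes sc :: "'a::field \<Rightarrow> 'm::ab_group_add \<Rightarrow> 'm" and sc' :: "'a \<Rightarrow> 'n::ab_group_add \<Rightarrow> 'n"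
    and L :: "'m \<Rightarrow> 'n \<Rightarrow> bool"
  assumes "vector_space sc" "module.subspace sc V" "quotient_dim sc V W n"
    and L: "\<And>u v. L u v \<Longrightarrow> u \<in> V \<and> v \<in> V'"
    and L_add: "\<And>u v u' v'. L u v \<Longrightarrow> L u' v' \<Longrightarrow> L (u + u') (v + v')"
    and L_scale: "\<And>c u v. L u v \<Longrightarrow> L (sc c u) (sc' c v)"
    and sc': "vector_space sc'"
    and total: "\<And>u. u \<in> V \<Longrightarrow> \<exists>v. L u v" and onto: "\<And>v. v \<in> V' \<Longrightarrow> \<exists>u. L u v"
    and W: "\<And>u v. L u v \<Longrightarrow> u \<in> W \<longleftrightarrow> v \<in> W'" and sub: "0 \<in> W'" "W' \<subseteq> V'"
  shows "quotient_dim sc' V' W' n"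
proof -
  interpret vector_space sc by fact
  interpret v2: vector_space sc' by fact
  note V = assms(2)
  obtain f where f: "\<forall>i<n. linear_functional_on sc V (f i)" "\<forall>y. \<exists>v\<in>V. \<forall>i<n. f i v = y i"
    "W = {v \<in> V. \<forall>i<n. f i v = 0}"
    using assms(3) unfolding quotient_dim_def by blast
  define s where "s v = (SOME u. L u v)" for v
  have s: "L (s v) v" if "v \<in> V'" for v
    unfolding s_def by (rule someI_ex[OF onto[OF that]])
  have L_diff: "L (u - u') (v - v')" if "L u v" "L u' v'" for u u' v v'
    using L_add[OF that(1) L_scale[OF that(2), of "-1"]] by simp
  have eq: "f i u = f i (s v)" if "L u v" "i < n" for u v i
  proof -
    have "L (u - s v) 0" using L_diff[OF that(1) s[of v]] L[OF that(1)] by simp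
    then have "u - s v \<in> W" using W sub by blast
    then have "f i (u - s v) = 0" using f(3) that(2) by blast
    moreover have "u \<in> V" "s v \<in> V" using L that(1) s by blast+
    ultimately show ?thesis using lin_on_diff[OF V f(1)[rule_format, OF that(2)]] by simp
  qed
  show ?thesis unfolding quotient_dim_def
  proof (intro exI[of _ "\<lambda>i v. f i (s v)"] conjI allI impI)
    show "linear_functional_on sc' V' (\<lambda>v. f i (s v))" if i: "i < n" for i
    proof -
      have fi: "linear_functional_on sc V (f i)" using f(1) i by blast
      have sV: "s v \<in> V" if "v \<in> V'" for v using L s that by blast
      show ?thesis unfolding linear_functional_on_def
      proof (intro conjI ballI allI)
        show "f i (s (u + v)) = f i (s u) + f i (s v)" if "u \<in> V'" "v \<in> V'" for u v
          using eq[OF L_add[OF s s] i] that sV by (simp add: linear_functional_onD[OF fi])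
        show "f i (s (sc' c v)) = c * f i (s v)" if "v \<in> V'" for c v
          using eq[OF L_scale[OF s] i] that sV by (simp add: linear_functional_onD[OF fi])
      qed
    qed
    show "\<exists>v\<in>V'. \<forall>i<n. f i (s v) = y i" for y
    proof -
      obtain u where u: "u \<in> V" "\<forall>i<n. f i u = y i" using f(2) by blast
      obtain v where "L u v" using total u by blast
      then show ?thesis using eq u L by (metis)
    qed
    show "W' = {v \<in> V'. \<forall>i<n. f i (s v) = 0}"
    proof -
      have "v \<in> W' \<longleftrightarrow> (\<forall>i<n. f i (s v) = 0)" if "v \<in> V'" for v
        using W[OF s[OF that]] L[OF s[OF that]] f(3) by auto
      then show ?thesis using sub by blast
    qed
  qed
qed

section \<open>Koszul complexes\<close>

definition koszul_sign :: "nat \<Rightarrow> nat set \<Rightarrow> 'm::ab_group_add \<Rightarrow> 'm" where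
  "koszul_sign j J v = (if even (card {l \<in> J. l < j}) then v else - v)"

text \<open>A chain \<open>c\<close> stands for \<open>\<Sum>\<^sub>J c J \<otimes> e\<^sub>J\<close>, where \<open>e\<^sub>J\<close> is the wedge product of the \<open>e\<^sub>j\<close>,
  \<open>j \<in> J\<close>, in increasing order; \<open>x j\<close> is the action of the \<open>j\<close>-th variable on the coefficients.\<close>

definition koszul_diff ::
  "(nat \<Rightarrow> 'm \<Rightarrow> 'm) \<Rightarrow> nat set \<Rightarrow> (nat set \<Rightarrow> 'm::ab_group_add) \<Rightarrow> nat set \<Rightarrow> 'm" where
  "koszul_diff x I c J =
     (if J \<subseteq> I then \<Sum>j\<in>I - J. koszul_sign j J (x j (c (insert j J))) else 0)"

definition koszul_chains :: "nat set \<Rightarrow> 'm::ab_group_add set \<Rightarrow> nat \<Rightarrow> (nat set \<Rightarrow> 'm) set" where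
  "koszul_chains I M i = {c. \<forall>J. c J \<in> M \<and> (J \<subseteq> I \<and> card J = i \<or> c J = 0)}"

definition koszul_cycles ::
  "(nat \<Rightarrow> 'm \<Rightarrow> 'm) \<Rightarrow> nat set \<Rightarrow> 'm::ab_group_add set \<Rightarrow> nat \<Rightarrow> (nat set \<Rightarrow> 'm) set" where
  "koszul_cycles x I M i = {c \<in> koszul_chains I M i. koszul_diff x I c = 0}"

definition koszul_boundaries ::
  "(nat \<Rightarrow> 'm \<Rightarrow> 'm) \<Rightarrow> nat set \<Rightarrow> 'm::ab_group_add set \<Rightarrow> nat \<Rightarrow> (nat set \<Rightarrow> 'm) set" where
  "koszul_boundaries x I M i = koszul_diff x I ` koszul_chains I M (Suc i)"

definition koszul_homology_dim ::
  "('a::field \<Rightarrow> 'm \<Rightarrow> 'm) \<Rightarrow> (nat \<Rightarrow> 'm \<Rightarrow> 'm) \<Rightarrow> nat set \<Rightarrow> 'm::ab_group_add set \<Rightarrow> nat \<Rightarrow> nat \<Rightarrow> bool" where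
  "koszul_homology_dim sc x I M i n \<longleftrightarrow>
     quotient_dim (\<lambda>a c J. sc a (c J)) (koszul_cycles x I M i) (koszul_boundaries x I M i) n"

lemma sum_fun_apply: "(\<Sum>j\<in>A. f j) x = (\<Sum>j\<in>A. f j x)"
  for f :: "'i \<Rightarrow> 'b \<Rightarrow> 'c::comm_monoid_add"
  by (induction A rule: infinite_finite_induct) auto

text \<open>The terms at \<open>(j, l)\<close> and \<open>(l, j)\<close> cancel, and the diagonal is absent; so this is valid in
  characteristic \<open>2\<close> as well.\<close>

lemma sum_antisymmetric_eq_0:
  fixes h :: "'i \<Rightarrow> 'i \<Rightarrow> 'm::ab_group_add"
  assumes "finite P" "\<And>j l. j \<in> P \<Longrightarrow> l \<in> P \<Longrightarrow> j \<noteq> l \<Longrightarrow> h j l = - h l j"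
  shows "(\<Sum>j\<in>P. \<Sum>l\<in>P - {j}. h j l) = 0"
  using assms
proof (induction P rule: finite_induct)
  case (insert p P)
  have IH: "(\<Sum>j\<in>P. \<Sum>l\<in>P - {j}. h j l) = 0"
    by (rule insert.IH) (rule insert.prems; simp)
  have 1: "(\<Sum>l\<in>insert p P - {j}. h j l) = h j p + (\<Sum>l\<in>P - {j}. h j l)" if "j \<in> P" for j
  proof -
    have "insert p P - {j} = insert p (P - {j})" using insert.hyps that by auto
    then show ?thesis using insert.hyps by simp
  qed
  have 2: "h p l = - h l p" if "l \<in> P" for l
    using insert.prems[of p l] insert.hyps(2) that by blast
  have "(\<Sum>j\<in>insert p P. \<Sum>l\<in>insert p P - {j}. h j l) =
      (\<Sum>l\<in>P. h p l) + (\<Sum>j\<in>P. h j p + (\<Sum>l\<in>P - {j}. h j l))"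
    using insert.hyps by (simp add: 1)
  also have "\<dots> = 0"
    using IH by (simp add: 2 sum.distrib sum_negf)
  finally show ?case .
qed simp

lemma koszul_sign_0 [simp]: "koszul_sign j J 0 = 0"
  by (simp add: koszul_sign_def)

lemma koszul_sign_add: "koszul_sign j J (u + v) = koszul_sign j J u + koszul_sign j J v"
  by (simp add: koszul_sign_def)

lemma koszul_sign_minus: "koszul_sign j J (- v) = - koszul_sign j J v"
  by (simp add: koszul_sign_def)

lemma koszul_sign_sum: "koszul_sign j J (\<Sum>i\<in>A. f i) = (\<Sum>i\<in>A. koszul_sign j J (f i))"
  by (simp add: koszul_sign_def sum_negf)

lemma koszul_sign_sign [simp]: "koszul_sign j J (koszul_sign j J v) = v"
  by (simp add: koszul_sign_def)

lemma koszul_sign_commute: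
  "koszul_sign j J (koszul_sign l L v) = koszul_sign l L (koszul_sign j J v)"
  by (simp add: koszul_sign_def)

lemma koszul_sign_insert:
  assumes "finite J" "j \<notin> J"
  shows "koszul_sign l (insert j J) v = (if j < l then - koszul_sign l J v else koszul_sign l J v)"
proof -
  have "{i \<in> insert j J. i < l} = (if j < l then insert j {i \<in> J. i < l} else {i \<in> J. i < l})"
    by auto
  then show ?thesis using assms by (simp add: koszul_sign_def)
qed

text \<open>The relation \<open>e\<^sub>j \<and> e\<^sub>l = - e\<^sub>l \<and> e\<^sub>j\<close> in terms of signs.\<close>

lemma koszul_sign_swap:
  assumes "finite J" "j \<notin> J" "l \<notin> J" "j \<noteq> l"
  shows "koszul_sign j J (koszul_sign l (insert j J) v) =
     - koszul_sign l J (koszul_sign j (insert l J) v)"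
proof (cases "j < l")
  case True
  then show ?thesis
    using assms by (simp add: koszul_sign_insert koszul_sign_minus koszul_sign_commute)
next
  case False
  then have "l < j" using assms by simp
  with False show ?thesis
    using assms by (simp add: koszul_sign_insert koszul_sign_minus koszul_sign_commute)
qed

lemma koszul_sign_least:
  assumes "\<And>x. x \<in> J \<Longrightarrow> j \<le> x"
  shows "koszul_sign j J v = v"
proof -
  have e: "{x \<in> J. x < j} = {}" using assms by force
  show ?thesis unfolding koszul_sign_def e by simp
qed

lemma koszul_sign_empty [simp]: "koszul_sign j {} v = v"
  by (rule koszul_sign_least) simp

lemma koszul_diff_outside: "\<not> J \<subseteq> I \<Longrightarrow> koszul_diff x I c J = 0"
  by (simp add: koszul_diff_def)

lemma koszul_diff_cong:
  "(\<And>K. K \<subseteq> I \<Longrightarrow> b K = c K) \<Longrightarrow> koszul_diff x I b J = koszul_diff x I c J"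
  unfolding koszul_diff_def by (auto intro!: sum.cong)

lemma koszul_chainsI:
  "(\<And>J. c J \<in> M) \<Longrightarrow> (\<And>J. \<not> (J \<subseteq> I \<and> card J = i) \<Longrightarrow> c J = 0) \<Longrightarrow> c \<in> koszul_chains I M i"
  by (auto simp: koszul_chains_def)

lemma koszul_chainsD:
  "c \<in> koszul_chains I M i \<Longrightarrow> c J \<in> M"
  "c \<in> koszul_chains I M i \<Longrightarrow> \<not> (J \<subseteq> I \<and> card J = i) \<Longrightarrow> c J = 0"
  by (auto simp: koszul_chains_def)

text \<open>A module over a polynomial ring in the variables \<open>I\<close> is given as a vector space with commuting
  actions \<open>x i\<close> of the variables.\<close>

locale variable_action = vector_space sc
  for sc :: "'a::field \<Rightarrow> 'm::ab_group_add \<Rightarrow> 'm" +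
  fixes x :: "nat \<Rightarrow> 'm \<Rightarrow> 'm" and I :: "nat set"
  assumes finite_vars: "finite I"
    and act_add: "x i (u + v) = x i u + x i v"
    and act_scale: "x i (sc a v) = sc a (x i v)"
    and act_commute: "i \<in> I \<Longrightarrow> j \<in> I \<Longrightarrow> x i (x j v) = x j (x i v)"
begin

definition submodule :: "'m set \<Rightarrow> bool" where
  "submodule M \<longleftrightarrow> subspace M \<and> (\<forall>i\<in>I. \<forall>v\<in>M. x i v \<in> M)"

lemma act_0 [simp]: "x i 0 = 0"
  using act_add[of i 0 0] by simp

lemma act_minus: "x i (- v) = - x i v"
  using act_add[of i v "- v"] by (simp add: eq_neg_iff_add_eq_0 add.commute)

lemma act_sum: "x i (\<Sum>j\<in>A. f j) = (\<Sum>j\<in>A. x i (f j))"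
  by (induction A rule: infinite_finite_induct) (auto simp: act_add)

lemma act_sign: "x i (koszul_sign j J v) = koszul_sign j J (x i v)"
  by (simp add: koszul_sign_def act_minus)

lemma scale_sign: "sc a (koszul_sign j J v) = koszul_sign j J (sc a v)"
  by (simp add: koszul_sign_def)

lemma subspace_sign: "subspace M \<Longrightarrow> v \<in> M \<Longrightarrow> koszul_sign j J v \<in> M"
  by (simp add: koszul_sign_def subspace_neg)

lemma vector_space_chains: "vector_space (\<lambda>a (c :: nat set \<Rightarrow> 'm) J. sc a (c J))"
  by unfold_locales (auto simp: fun_eq_iff scale_right_distrib scale_left_distrib)

lemma diff_add: "koszul_diff x I (b + c) = koszul_diff x I b + koszul_diff x I c"
  by (auto simp: fun_eq_iff koszul_diff_def act_add koszul_sign_add sum.distrib)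

lemma diff_scale: "koszul_diff x I (\<lambda>J. sc a (c J)) = (\<lambda>J. sc a (koszul_diff x I c J))"
  by (auto simp: fun_eq_iff koszul_diff_def act_scale scale_sum_right scale_sign)

lemma diff_0: "koszul_diff x I 0 = 0"
  by (auto simp: fun_eq_iff koszul_diff_def)

lemma diff_minus: "koszul_diff x I (- c) = - koszul_diff x I c"
  by (auto simp: fun_eq_iff koszul_diff_def act_minus koszul_sign_minus sum_negf)

lemma diff_diff_fun: "koszul_diff x I (b - c) = koszul_diff x I b - koszul_diff x I c"
  using diff_add[of b "- c"] by (simp add: diff_minus)

lemma koszul_diff_diff: "koszul_diff x I (koszul_diff x I c) = 0"
proof (rule ext)
  fix J
  define h where "h = (\<lambda>j l. koszul_sign j J (koszul_sign l (insert j J) (x j (x l (c (insert l (insert j J)))))))"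
  show "koszul_diff x I (koszul_diff x I c) J = 0 J"
  proof (cases "J \<subseteq> I")
    case True
    then have "finite J" using finite_vars finite_subset by blast
    have "koszul_diff x I (koszul_diff x I c) J = (\<Sum>j\<in>I - J. \<Sum>l\<in>I - J - {j}. h j l)"
      unfolding koszul_diff_def using True
      by (auto simp: h_def koszul_sign_sum act_sum act_sign intro!: sum.cong)
    also have "\<dots> = 0"
    proof (rule sum_antisymmetric_eq_0)
      fix j l assume *: "j \<in> I - J" "l \<in> I - J" "j \<noteq> l"
      then have "h j l = - koszul_sign l J (koszul_sign j (insert l J) (x j (x l (c (insert l (insert j J))))))"
        using \<open>finite J\<close> unfolding h_def by (intro koszul_sign_swap) auto
      also have "\<dots> = - h l j"
        using * by (simp add: h_def act_commute[of j l] insert_commute)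
      finally show "h j l = - h l j" .
    qed (use finite_vars in auto)
    finally show ?thesis by simp
  qed (simp add: koszul_diff_def)
qed

lemma subspace_chains:
  assumes "subspace M"
  shows "module.subspace (\<lambda>a c J. sc a (c J)) (koszul_chains I M i)"
proof -
  interpret C: vector_space "\<lambda>a (c :: nat set \<Rightarrow> 'm) J. sc a (c J)" by (rule vector_space_chains)
  show ?thesis
  proof (rule C.subspaceI)
    show "0 \<in> koszul_chains I M i" by (simp add: koszul_chains_def subspace_0[OF assms])
    show "b + c \<in> koszul_chains I M i" if "b \<in> koszul_chains I M i" "c \<in> koszul_chains I M i" for b c
      using that koszul_chainsD(2)[OF that(1)] koszul_chainsD(2)[OF that(2)]
      by (intro koszul_chainsI) (auto simp: koszul_chains_def intro: subspace_add[OF assms])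
    show "(\<lambda>J. sc a (c J)) \<in> koszul_chains I M i" if "c \<in> koszul_chains I M i" for a c
      using that by (auto simp: koszul_chains_def intro: subspace_scale[OF assms])
  qed
qed

lemma subspace_cycles:
  assumes "subspace M"
  shows "module.subspace (\<lambda>a c J. sc a (c J)) (koszul_cycles x I M i)"
proof -
  interpret C: vector_space "\<lambda>a (c :: nat set \<Rightarrow> 'm) J. sc a (c J)" by (rule vector_space_chains)
  note ch = subspace_chains[OF assms, of i]
  show ?thesis
    by (rule C.subspaceI)
      (auto simp: koszul_cycles_def C.subspace_0[OF ch] C.subspace_add[OF ch] C.subspace_scale[OF ch]
        diff_0 diff_add diff_scale fun_eq_iff)
qed

lemma subspace_boundaries:
  assumes "subspace M"
  shows "module.subspace (\<lambda>a c J. sc a (c J)) (koszul_boundaries x I M i)"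
proof -
  interpret C: vector_space "\<lambda>a (c :: nat set \<Rightarrow> 'm) J. sc a (c J)" by (rule vector_space_chains)
  note ch = subspace_chains[OF assms, of "Suc i"]
  show ?thesis unfolding koszul_boundaries_def
  proof (rule C.subspaceI)
    show "0 \<in> koszul_diff x I ` koszul_chains I M (Suc i)"
      using C.subspace_0[OF ch] diff_0 by force
    show "b + c \<in> koszul_diff x I ` koszul_chains I M (Suc i)"
      if "b \<in> koszul_diff x I ` koszul_chains I M (Suc i)" "c \<in> koszul_diff x I ` koszul_chains I M (Suc i)" for b c
      using that C.subspace_add[OF ch] by (auto simp flip: diff_add)
    show "(\<lambda>J. sc a (c J)) \<in> koszul_diff x I ` koszul_chains I M (Suc i)"
      if "c \<in> koszul_diff x I ` koszul_chains I M (Suc i)" for a c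
      using that C.subspace_scale[OF ch] by (auto simp flip: diff_scale)
  qed
qed

lemma submodule_diff:
  assumes "submodule M" "\<And>J. c J \<in> M"
  shows "koszul_diff x I c J \<in> M"
  using assms unfolding koszul_diff_def submodule_def
  by (auto intro!: subspace_sum subspace_sign simp: subspace_0)

lemma diff_chains:
  assumes "submodule M" "c \<in> koszul_chains I M (Suc i)"
  shows "koszul_diff x I c \<in> koszul_chains I M i"
proof (rule koszul_chainsI)
  show "koszul_diff x I c J \<in> M" for J
    using submodule_diff[OF assms(1) koszul_chainsD(1)[OF assms(2)]] .
  show "koszul_diff x I c J = 0" if "\<not> (J \<subseteq> I \<and> card J = i)" for J
  proof (cases "J \<subseteq> I")
    case True
    then have "finite J" using finite_vars finite_subset by blast
    have "c (insert j J) = 0" if "j \<in> I - J" for j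
      using koszul_chainsD(2)[OF assms(2), of "insert j J"] \<open>finite J\<close> that \<open>\<not> (J \<subseteq> I \<and> card J = i)\<close> True
      by auto
    then show ?thesis by (simp add: koszul_diff_def)
  qed (simp add: koszul_diff_def)
qed

lemma boundaries_subset_cycles:
  "submodule M \<Longrightarrow> koszul_boundaries x I M i \<subseteq> koszul_cycles x I M i"
  unfolding koszul_boundaries_def koszul_cycles_def
  by (auto simp: diff_chains koszul_diff_diff)

lemma cycles_0: "koszul_cycles x I M 0 = koszul_chains I M 0"
proof -
  have "koszul_diff x I c = 0" if "c \<in> koszul_chains I M 0" for c
  proof (rule ext)
    fix J
    have "c (insert j J) = 0" if "J \<subseteq> I" for j
    proof -
      have "finite J" using that finite_vars finite_subset by blast
      then show ?thesis using koszul_chainsD(2)[OF \<open>c \<in> koszul_chains I M 0\<close>, of "insert j J"] by auto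
    qed
    then show "koszul_diff x I c J = 0 J" by (simp add: koszul_diff_def)
  qed
  then show ?thesis by (auto simp: koszul_cycles_def)
qed

end

text \<open>The connecting homomorphism of a short exact sequence \<open>0 \<rightarrow> Z \<rightarrow> F \<rightarrow> M \<rightarrow> 0\<close>, as a
  correspondence: \<open>c\<close> and \<open>c'\<close> correspond if some chain \<open>b\<close> of \<open>F\<close> lies over \<open>c\<close> and has boundary
  \<open>c'\<close>. Positive-degree acyclicity of \<open>F\<close> and, in degree \<open>0\<close>, the inclusion \<open>Z \<subseteq> \<mm>F\<close> make it
  bijective on homology.\<close>

locale acyclic_cover =
  F: variable_action scF xF I + M: variable_action scM xM I
  for scF :: "'a::field \<Rightarrow> 'n::ab_group_add \<Rightarrow> 'n" and xF
    and scM :: "'a \<Rightarrow> 'm::ab_group_add \<Rightarrow> 'm" and xM and I +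
  fixes F M Z f
  assumes F_sub: "F.submodule F"
    and f_add: "u \<in> F \<Longrightarrow> v \<in> F \<Longrightarrow> f (u + v) = f u + f v"
    and f_scale: "v \<in> F \<Longrightarrow> f (scF a v) = scM a (f v)"
    and f_act: "i \<in> I \<Longrightarrow> v \<in> F \<Longrightarrow> f (xF i v) = xM i (f v)"
    and f_onto: "f ` F = M"
    and Z_def: "Z = {v \<in> F. f v = 0}"
    and acyclic: "koszul_cycles xF I F (Suc i) \<subseteq> koszul_boundaries xF I F (Suc i)"
    and Z_minimal: "v \<in> Z \<Longrightarrow> \<exists>b \<in> koszul_chains I F 1. koszul_diff xF I b {} = v"
begin

lemma F_subspace: "F.subspace F"
  using F_sub by (simp add: F.submodule_def)

lemma f_0: "f 0 = 0"
  using f_scale[OF F.subspace_0[OF F_subspace], of 0] by simp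

lemma f_sign: "v \<in> F \<Longrightarrow> f (koszul_sign j J v) = koszul_sign j J (f v)"
  using f_scale[of v "-1"] by (simp add: koszul_sign_def)

lemma f_diff: "u \<in> F \<Longrightarrow> v \<in> F \<Longrightarrow> f (u - v) = f u - f v"
  using f_add[of u "scF (-1) v"] f_scale[of v "-1"] F.subspace_neg[OF F_subspace] by simp

lemma f_sum: "(\<And>j. j \<in> A \<Longrightarrow> g j \<in> F) \<Longrightarrow> f (\<Sum>j\<in>A. g j) = (\<Sum>j\<in>A. f (g j))"
proof (induction A rule: infinite_finite_induct)
  case (insert a A)
  then show ?case by (simp add: f_add F.subspace_sum[OF F_subspace])
qed (auto simp: f_0)

lemma f_koszul_diff:
  assumes "\<And>J. b J \<in> F"
  shows "koszul_diff xM I (\<lambda>J. f (b J)) J = f (koszul_diff xF I b J)"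
proof -
  have mem: "xF j (b J') \<in> F" if "j \<in> I" for j J' using F_sub assms that by (simp add: F.submodule_def)
  have "f (\<Sum>j\<in>I - J. koszul_sign j J (xF j (b (insert j J)))) =
     (\<Sum>j\<in>I - J. f (koszul_sign j J (xF j (b (insert j J)))))"
    by (rule f_sum) (auto intro!: F.subspace_sign[OF F_subspace] mem)
  also have "\<dots> = (\<Sum>j\<in>I - J. koszul_sign j J (xM j (f (b (insert j J)))))"
    by (intro sum.cong) (auto simp: f_sign mem f_act assms)
  finally show ?thesis by (simp add: koszul_diff_def f_0)
qed

lemma f_chains: "b \<in> koszul_chains I F i \<Longrightarrow> (\<lambda>J. f (b J)) \<in> koszul_chains I M i"
  using f_onto f_0 unfolding koszul_chains_def by fastforce

lemma lift_chain:
  assumes "c \<in> koszul_chains I M i"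
  obtains b where "b \<in> koszul_chains I F i" "c = (\<lambda>J. f (b J))"
proof -
  have "\<exists>v\<in>F. f v = c J \<and> (c J = 0 \<longrightarrow> v = 0)" for J
  proof (cases "c J = 0")
    case True
    then show ?thesis using f_0 F.subspace_0[OF F_subspace] by auto
  next
    case False
    then show ?thesis using f_onto koszul_chainsD(1)[OF assms, of J] by auto
  qed
  then obtain b where b: "\<And>J. b J \<in> F \<and> f (b J) = c J \<and> (c J = 0 \<longrightarrow> b J = 0)" by metis
  then have "b \<in> koszul_chains I F i" "c = (\<lambda>J. f (b J))"
    using assms by (auto simp: koszul_chains_def)
  then show thesis using that by blast
qed

lemma M_subspace: "M.subspace M"
proof (rule M.subspaceI)
  show "0 \<in> M" using f_0 F.subspace_0[OF F_subspace] f_onto by force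
  show "u + v \<in> M" if "u \<in> M" "v \<in> M" for u v
    using that F.subspace_add[OF F_subspace] unfolding f_onto[symmetric]
    by (auto simp flip: f_add)
  show "scM a v \<in> M" if "v \<in> M" for a v
    using that F.subspace_scale[OF F_subspace] unfolding f_onto[symmetric]
    by (auto simp flip: f_scale)
qed

lemma M_sub: "M.submodule M"
  using M_subspace F_sub unfolding M.submodule_def F.submodule_def f_onto[symmetric]
  by (auto simp flip: f_act)

lemma Z_sub: "F.submodule Z"
  unfolding F.submodule_def
proof (intro conjI F.subspaceI ballI)
  show "0 \<in> Z" using f_0 F.subspace_0[OF F_subspace] by (simp add: Z_def)
  show "u + v \<in> Z" if "u \<in> Z" "v \<in> Z" for u v
    using that F.subspace_add[OF F_subspace] by (simp add: Z_def f_add)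
  show "scF a v \<in> Z" if "v \<in> Z" for a v
    using that F.subspace_scale[OF F_subspace] by (simp add: Z_def f_scale)
  show "xF i v \<in> Z" if "v \<in> Z" "i \<in> I" for i v
    using that F_sub by (simp add: Z_def F.submodule_def f_act)
qed

lemma chains_Z: "c \<in> koszul_chains I Z i \<longleftrightarrow> c \<in> koszul_chains I F i \<and> (\<lambda>J. f (c J)) = 0"
  unfolding koszul_chains_def Z_def by (auto simp: fun_eq_iff)

lemma bounding_chain:
  assumes "c \<in> koszul_cycles xF I Z i"
  obtains b where "b \<in> koszul_chains I F (Suc i)" "koszul_diff xF I b = c"
proof (cases i)
  case 0
  have cZ: "c {} \<in> Z" and c: "c \<in> koszul_chains I F 0"
    using assms 0 chains_Z koszul_chainsD(1)[of c I Z 0] by (auto simp: koszul_cycles_def)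
  obtain b where b: "b \<in> koszul_chains I F 1" "koszul_diff xF I b {} = c {}"
    using Z_minimal[OF cZ] by blast
  have "koszul_diff xF I b \<in> koszul_chains I F 0" using F.diff_chains[OF F_sub] b by simp
  then have "koszul_diff xF I b J = c J" for J
  proof (cases "J = {}")
    case False
    then have "\<not> (J \<subseteq> I \<and> card J = 0)" using finite_subset[OF _ F.finite_vars] by auto
    then show ?thesis
      using koszul_chainsD(2)[OF c] koszul_chainsD(2)[OF \<open>koszul_diff xF I b \<in> _\<close>] by metis
  qed (simp add: b(2))
  then show thesis using that b(1) 0 by auto
next
  case (Suc k)
  then have "c \<in> koszul_cycles xF I F (Suc k)" using assms chains_Z by (auto simp: koszul_cycles_def)
  then show thesis using acyclic that Suc unfolding koszul_boundaries_def by blast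
qed

text \<open>The isomorphism between \<open>H\<^sub>i\<^sub>+\<^sub>1(M)\<close> and \<open>H\<^sub>i(Z)\<close>, used for the dimension only.\<close>

theorem dimension_shift:
  assumes "koszul_homology_dim scM xM I M (Suc i) n"
  shows "koszul_homology_dim scF xF I Z i n"
proof -
  define L where "L = (\<lambda>c c'. c \<in> koszul_cycles xM I M (Suc i) \<and> (\<exists>b \<in> koszul_chains I F (Suc i).
     c = (\<lambda>J. f (b J)) \<and> c' = koszul_diff xF I b))"
  interpret CF: vector_space "\<lambda>a (c :: nat set \<Rightarrow> 'n) J. scF a (c J)" by (rule F.vector_space_chains)
  interpret CM: vector_space "\<lambda>a (c :: nat set \<Rightarrow> 'm) J. scM a (c J)" by (rule M.vector_space_chains)
  note chF = F.subspace_chains[OF F_subspace]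
  note cyM = M.subspace_cycles[OF M_subspace, of "Suc i"]
  have bF: "b J \<in> F" if "b \<in> koszul_chains I F j" for b j J using that koszul_chainsD by blast
  have cycZ: "koszul_diff xF I b \<in> koszul_cycles xF I Z i"
    if b: "b \<in> koszul_chains I F (Suc i)" and c: "(\<lambda>J. f (b J)) \<in> koszul_cycles xM I M (Suc i)" for b
  proof -
    have "koszul_diff xM I (\<lambda>J. f (b J)) = 0" using c by (simp add: koszul_cycles_def)
    then have "(\<lambda>J. f (koszul_diff xF I b J)) = 0"
      using f_koszul_diff[of b, OF bF[OF b]] by (metis (no_types, lifting) ext)
    then show ?thesis
      using F.diff_chains[OF F_sub b] by (simp add: koszul_cycles_def chains_Z F.koszul_diff_diff)
  qed
  have bd: "c \<in> koszul_boundaries xM I M (Suc i) \<longleftrightarrow> c' \<in> koszul_boundaries xF I Z i"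
    if "L c c'" for c c'
  proof -
    from that obtain b where c: "c \<in> koszul_cycles xM I M (Suc i)"
      and b: "b \<in> koszul_chains I F (Suc i)" "c = (\<lambda>J. f (b J))" "c' = koszul_diff xF I b"
      unfolding L_def by blast
    show ?thesis
    proof
      assume "c \<in> koszul_boundaries xM I M (Suc i)"
      then obtain a where a: "a \<in> koszul_chains I M (Suc (Suc i))" "c = koszul_diff xM I a"
        unfolding koszul_boundaries_def by blast
      obtain a' where a': "a' \<in> koszul_chains I F (Suc (Suc i))" "a = (\<lambda>J. f (a' J))"
        using lift_chain[OF a(1)] by blast
      let ?d = "b - koszul_diff xF I a'"
      have d: "?d \<in> koszul_chains I F (Suc i)"
        using CF.subspace_diff[OF chF b(1) F.diff_chains[OF F_sub a'(1)]] .
      have "f (?d J) = 0" for J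
        using f_koszul_diff[of a' J] bF[OF a'(1)] bF[OF b(1)] bF[OF F.diff_chains[OF F_sub a'(1)]]
          a(2) a'(2) b(2) by (simp add: f_diff fun_eq_iff)
      then have "?d \<in> koszul_chains I Z (Suc i)" using d by (auto simp: chains_Z)
      moreover have "koszul_diff xF I ?d = c'"
        by (simp add: F.diff_diff_fun F.koszul_diff_diff b(3))
      ultimately show "c' \<in> koszul_boundaries xF I Z i" unfolding koszul_boundaries_def by blast
    next
      assume "c' \<in> koszul_boundaries xF I Z i"
      then obtain a where a: "a \<in> koszul_chains I Z (Suc i)" "c' = koszul_diff xF I a"
        unfolding koszul_boundaries_def by blast
      then have aF: "a \<in> koszul_chains I F (Suc i)" "\<And>J. f (a J) = 0"
        by (auto simp: chains_Z fun_eq_iff)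
      have "b - a \<in> koszul_cycles xF I F (Suc i)"
        using CF.subspace_diff[OF chF b(1) aF(1)] a(2) b(3)
        by (simp add: koszul_cycles_def F.diff_diff_fun)
      then obtain h where h: "h \<in> koszul_chains I F (Suc (Suc i))" "b - a = koszul_diff xF I h"
        using acyclic unfolding koszul_boundaries_def by blast
      have "c = koszul_diff xM I (\<lambda>J. f (h J))"
      proof (rule ext)
        fix J
        have "c J = f (b J - a J)" using bF[OF b(1)] bF[OF aF(1)] aF(2) b(2) by (simp add: f_diff)
        also have "\<dots> = f (koszul_diff xF I h J)" using h(2) by (metis minus_apply)
        finally show "c J = koszul_diff xM I (\<lambda>J. f (h J)) J" using f_koszul_diff bF[OF h(1)] by simp
      qed
      then show "c \<in> koszul_boundaries xM I M (Suc i)"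
        using f_chains[OF h(1)] unfolding koszul_boundaries_def by blast
    qed
  qed
  show ?thesis unfolding koszul_homology_dim_def
  proof (rule quotient_dim_transfer[where L = L, OF M.vector_space_chains cyM
        assms[unfolded koszul_homology_dim_def] _ _ _ F.vector_space_chains _ _ bd])
    show "c \<in> koszul_cycles xM I M (Suc i) \<and> c' \<in> koszul_cycles xF I Z i" if "L c c'" for c c'
      using that cycZ unfolding L_def by blast
    show "L (c + d) (c' + d')" if "L c c'" "L d d'" for c c' d d'
    proof -
      obtain b where b: "b \<in> koszul_chains I F (Suc i)" "c = (\<lambda>J. f (b J))" "c' = koszul_diff xF I b"
        using \<open>L c c'\<close> unfolding L_def by blast
      obtain e where e: "e \<in> koszul_chains I F (Suc i)" "d = (\<lambda>J. f (e J))" "d' = koszul_diff xF I e"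
        using \<open>L d d'\<close> unfolding L_def by blast
      have "c + d \<in> koszul_cycles xM I M (Suc i)"
        using that CM.subspace_add[OF cyM] unfolding L_def by blast
      moreover have "b + e \<in> koszul_chains I F (Suc i)" using CF.subspace_add[OF chF] b e by blast
      moreover have "c + d = (\<lambda>J. f ((b + e) J))"
        using bF[OF b(1)] bF[OF e(1)] by (auto simp: b e f_add)
      moreover have "c' + d' = koszul_diff xF I (b + e)" by (simp add: b(3) e(3) F.diff_add)
      ultimately show ?thesis unfolding L_def by blast
    qed
    show "L (\<lambda>J. scM a (c J)) (\<lambda>J. scF a (c' J))" if "L c c'" for a c c'
    proof -
      obtain b where b: "b \<in> koszul_chains I F (Suc i)" "c = (\<lambda>J. f (b J))" "c' = koszul_diff xF I b"
        using \<open>L c c'\<close> unfolding L_def by blast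
      have "(\<lambda>J. scM a (c J)) \<in> koszul_cycles xM I M (Suc i)"
        using that CM.subspace_scale[OF cyM] unfolding L_def by blast
      moreover have "(\<lambda>J. scF a (b J)) \<in> koszul_chains I F (Suc i)" using CF.subspace_scale[OF chF] b by blast
      moreover have "(\<lambda>J. scM a (c J)) = (\<lambda>J. f (scF a (b J)))"
        using bF[OF b(1)] by (simp add: b f_scale)
      ultimately show ?thesis unfolding L_def using b(3) F.diff_scale by metis
    qed
    show "\<exists>c'. L c c'" if "c \<in> koszul_cycles xM I M (Suc i)" for c
      using that lift_chain[of c "Suc i"] unfolding L_def koszul_cycles_def by blast
    show "\<exists>c. L c c'" if c': "c' \<in> koszul_cycles xF I Z i" for c'
    proof -
      obtain b where b: "b \<in> koszul_chains I F (Suc i)" "koszul_diff xF I b = c'"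
        using bounding_chain[OF c'] by blast
      have "\<And>J. f (c' J) = 0" using that by (auto simp: koszul_cycles_def chains_Z fun_eq_iff)
      then have "koszul_diff xM I (\<lambda>J. f (b J)) = 0"
        using f_koszul_diff[of b, OF bF[OF b(1)]] b(2) by (auto simp: fun_eq_iff)
      then have "L (\<lambda>J. f (b J)) c'"
        using b f_chains[OF b(1)] unfolding L_def koszul_cycles_def by blast
      then show ?thesis by blast
    qed
    show "0 \<in> koszul_boundaries xF I Z i"
      using CF.subspace_0[OF F.subspace_boundaries] Z_sub by (auto simp: F.submodule_def)
    show "koszul_boundaries xF I Z i \<subseteq> koszul_cycles xF I Z i"
      by (rule F.boundaries_subset_cycles[OF Z_sub])
  qed
qed

text \<open>\<open>F/\<mm>F\<close> and \<open>M/\<mm>M\<close> agree because the kernel \<open>Z\<close> of \<open>F \<rightarrow> M\<close> lies in \<open>\<mm>F\<close>.\<close>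

theorem homology_0_cover:
  assumes "koszul_homology_dim scF xF I F 0 n"
  shows "koszul_homology_dim scM xM I M 0 n"
proof -
  define L where "L = (\<lambda>b c. b \<in> koszul_chains I F 0 \<and> c = (\<lambda>J. f (b J)))"
  interpret CF: vector_space "\<lambda>a (c :: nat set \<Rightarrow> 'n) J. scF a (c J)" by (rule F.vector_space_chains)
  interpret CM: vector_space "\<lambda>a (c :: nat set \<Rightarrow> 'm) J. scM a (c J)" by (rule M.vector_space_chains)
  note chF = F.subspace_chains[OF F_subspace]
  have bF: "b J \<in> F" if "b \<in> koszul_chains I F j" for b j J using that koszul_chainsD by blast
  have bd: "b \<in> koszul_boundaries xF I F 0 \<longleftrightarrow> c \<in> koszul_boundaries xM I M 0" if "L b c" for b c
  proof
    from that have b: "b \<in> koszul_chains I F 0" and c: "c = (\<lambda>J. f (b J))" by (auto simp: L_def)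
    { assume "b \<in> koszul_boundaries xF I F 0"
      then obtain h where h: "h \<in> koszul_chains I F (Suc 0)" "b = koszul_diff xF I h"
        unfolding koszul_boundaries_def by blast
      then have "c = koszul_diff xM I (\<lambda>J. f (h J))" using f_koszul_diff[of h, OF bF[OF h(1)]] c by auto
      then show "c \<in> koszul_boundaries xM I M 0"
        using f_chains[OF h(1)] unfolding koszul_boundaries_def by blast }
    assume "c \<in> koszul_boundaries xM I M 0"
    then obtain a where a: "a \<in> koszul_chains I M (Suc 0)" "c = koszul_diff xM I a"
      unfolding koszul_boundaries_def by blast
    obtain h where h: "h \<in> koszul_chains I F (Suc 0)" "a = (\<lambda>J. f (h J))" using lift_chain[OF a(1)] by blast
    let ?d = "b - koszul_diff xF I h"
    note dh = F.diff_chains[OF F_sub h(1)]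
    have "f (?d J) = 0" for J
      using f_koszul_diff[of h J] bF[OF h(1)] bF[OF b] bF[OF dh] a(2) h(2) c
      by (simp add: f_diff fun_eq_iff)
    then have "?d \<in> koszul_cycles xF I Z 0"
      using CF.subspace_diff[OF chF b dh] by (auto simp: chains_Z F.cycles_0)
    then obtain g where g: "g \<in> koszul_chains I F (Suc 0)" "koszul_diff xF I g = ?d"
      using bounding_chain by blast
    have "b = koszul_diff xF I (g + h)" using g(2) by (simp add: F.diff_add)
    then show "b \<in> koszul_boundaries xF I F 0"
      using CF.subspace_add[OF chF g(1) h(1)] unfolding koszul_boundaries_def by blast
  qed
  show ?thesis unfolding koszul_homology_dim_def F.cycles_0 M.cycles_0
  proof (rule quotient_dim_transfer[where L = L, OF F.vector_space_chains chF
        assms[unfolded koszul_homology_dim_def F.cycles_0] _ _ _ M.vector_space_chains _ _ bd])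
    show "b \<in> koszul_chains I F 0 \<and> c \<in> koszul_chains I M 0" if "L b c" for b c
      using that f_chains by (auto simp: L_def)
    show "L (b + b') (c + c')" if "L b c" "L b' c'" for b c b' c'
      using that CF.subspace_add[OF chF] bF by (auto simp: L_def f_add fun_eq_iff)
    show "L (\<lambda>J. scF a (b J)) (\<lambda>J. scM a (c J))" if "L b c" for a b c
      using that CF.subspace_scale[OF chF] bF by (auto simp: L_def f_scale fun_eq_iff)
    show "\<exists>c. L b c" if "b \<in> koszul_chains I F 0" for b using that by (auto simp: L_def)
    show "\<exists>b. L b c" if "c \<in> koszul_chains I M 0" for c
      using lift_chain[OF that] unfolding L_def by blast
    show "0 \<in> koszul_boundaries xM I M 0"
      using CM.subspace_0[OF M.subspace_boundaries[OF M_subspace]] .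
    show "koszul_boundaries xM I M 0 \<subseteq> koszul_chains I M 0"
      using M.boundaries_subset_cycles[OF M_sub] by (simp flip: M.cycles_0)
  qed
qed

end

section \<open>Free modules over a polynomial ring\<close>

definition var :: "nat \<Rightarrow> 'a::field mpoly" where
  "var i = Poly_Mapping.single (Poly_Mapping.single i 1) 1"

abbreviation const :: "'a::field \<Rightarrow> 'a mpoly" where
  "const \<equiv> Poly_Mapping.single 0"

definition vec_coeff :: "'a::field free_vec \<Rightarrow> nat \<Rightarrow> (nat \<Rightarrow>\<^sub>0 nat) \<Rightarrow> 'a" where
  "vec_coeff v j m = Poly_Mapping.lookup (Poly_Mapping.lookup v j) m"

lemma vec_eqI: "(\<And>j m. vec_coeff u j m = vec_coeff v j m) \<Longrightarrow> u = v"
  unfolding vec_coeff_def by (intro poly_mapping_eqI)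

lemma vec_coeff_0 [simp]: "vec_coeff 0 j m = 0"
  and vec_coeff_add: "vec_coeff (u + v) j m = vec_coeff u j m + vec_coeff v j m"
  and vec_coeff_minus: "vec_coeff (- v) j m = - vec_coeff v j m"
  and vec_coeff_sum: "vec_coeff (\<Sum>i\<in>A. f i) j m = (\<Sum>i\<in>A. vec_coeff (f i) j m)"
  by (simp_all add: vec_coeff_def lookup_add lookup_sum)

lemma vec_coeff_sign: "vec_coeff (koszul_sign i J v) j m = koszul_sign i J (vec_coeff v j m)"
  by (simp add: koszul_sign_def vec_coeff_minus)

lemma lookup_free_scale: "Poly_Mapping.lookup (free_scale r v) j = r * Poly_Mapping.lookup v j"
  by (cases "Poly_Mapping.lookup v j = 0") (simp_all add: free_scale_def map.rep_eq)

lemma module_free_scale: "module (free_scale :: 'a::field mpoly \<Rightarrow> 'a free_vec \<Rightarrow> 'a free_vec)"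
  by unfold_locales
    (simp_all add: poly_mapping_eq_iff fun_eq_iff lookup_free_scale lookup_add algebra_simps)

lemma lookup_monomial_mult:
  fixes p :: "'a::field mpoly"
  assumes "m = q + r"
  shows "Poly_Mapping.lookup (Poly_Mapping.single q c * p) m = c * Poly_Mapping.lookup p r"
proof -
  have "m = q + s \<longleftrightarrow> s = r" for s using assms by auto
  then show ?thesis by (simp add: lookup_mult lookup_single when_mult)
qed

lemma lookup_monomial_mult_0:
  fixes p :: "'a::field mpoly"
  assumes "\<And>r. m \<noteq> q + r"
  shows "Poly_Mapping.lookup (Poly_Mapping.single q c * p) m = 0"
  using assms by (simp add: lookup_mult lookup_single when_mult)

lemma minus_single_add:
  fixes m :: "nat \<Rightarrow>\<^sub>0 nat"
  assumes "i \<in> Poly_Mapping.keys m"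
  shows "Poly_Mapping.single i 1 + (m - Poly_Mapping.single i 1) = m"
  using assms
  by (intro poly_mapping_eqI) (auto simp: lookup_add lookup_minus lookup_single when_def in_keys_iff)

lemma lookup_var_mult:
  "Poly_Mapping.lookup (var i * p) m =
     (if i \<in> Poly_Mapping.keys m then Poly_Mapping.lookup p (m - Poly_Mapping.single i 1) else 0)"
proof (cases "i \<in> Poly_Mapping.keys m")
  case True
  then show ?thesis
    using lookup_monomial_mult[OF minus_single_add[OF True, symmetric], of 1 p] by (simp add: var_def)
next
  case False
  then have "m \<noteq> Poly_Mapping.single i 1 + r" for r
    by (auto simp: in_keys_iff lookup_add)
  with False show ?thesis
    unfolding var_def by (simp add: lookup_monomial_mult_0)
qed

lemma vec_coeff_act: "vec_coeff (free_scale (var i) v) j m =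
    (if i \<in> Poly_Mapping.keys m then vec_coeff v j (m - Poly_Mapping.single i 1) else 0)"
  by (simp add: vec_coeff_def lookup_free_scale lookup_var_mult)

lemma vec_coeff_const: "vec_coeff (free_scale (const c) v) j m = c * vec_coeff v j m"
  using lookup_monomial_mult[of m 0 m c] by (simp add: vec_coeff_def lookup_free_scale)

lemma var_in_polynomial_ring: "i \<in> I \<Longrightarrow> var i \<in> polynomial_ring I"
  by (auto simp: var_def polynomial_ring_def)

lemma const_in_polynomial_ring: "const c \<in> polynomial_ring I"
  by (auto simp: polynomial_ring_def)

lemma free_module_iff: "v \<in> free_module I ds \<longleftrightarrow>
    (\<forall>j m. vec_coeff v j m \<noteq> 0 \<longrightarrow> j < length ds \<and> Poly_Mapping.keys m \<subseteq> I)"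
proof
  assume v: "v \<in> free_module I ds"
  show "\<forall>j m. vec_coeff v j m \<noteq> 0 \<longrightarrow> j < length ds \<and> Poly_Mapping.keys m \<subseteq> I"
  proof (intro allI impI)
    fix j m assume "vec_coeff v j m \<noteq> 0"
    then have m: "m \<in> Poly_Mapping.keys (Poly_Mapping.lookup v j)" by (simp add: vec_coeff_def in_keys_iff)
    then have "j \<in> Poly_Mapping.keys v" by (auto simp: in_keys_iff)
    with m v show "j < length ds \<and> Poly_Mapping.keys m \<subseteq> I"
      unfolding free_module_def polynomial_ring_def by blast
  qed
next
  assume *: "\<forall>j m. vec_coeff v j m \<noteq> 0 \<longrightarrow> j < length ds \<and> Poly_Mapping.keys m \<subseteq> I"
  have "j < length ds" if "Poly_Mapping.lookup v j \<noteq> 0" for j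
  proof -
    have "\<exists>m. Poly_Mapping.lookup (Poly_Mapping.lookup v j) m \<noteq> 0"
      using that poly_mapping_eqI[of "Poly_Mapping.lookup v j" 0] by auto
    then show ?thesis using * by (auto simp: vec_coeff_def)
  qed
  then have "Poly_Mapping.keys v \<subseteq> {..<length ds}" by (auto simp: in_keys_iff)
  moreover have "Poly_Mapping.lookup v j \<in> polynomial_ring I" for j
    using * unfolding polynomial_ring_def vec_coeff_def by (simp add: in_keys_iff)
  ultimately show "v \<in> free_module I ds" by (simp add: free_module_def)
qed

lemma irrelevant_submodule_iff: "v \<in> irrelevant_submodule I ds \<longleftrightarrow>
    v \<in> free_module I ds \<and> (\<forall>j. vec_coeff v j 0 = 0)"
  by (auto simp: irrelevant_submodule_def irrelevant_ideal_def vec_coeff_def free_module_def)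

text \<open>Any module over the ring of all polynomials restricts to one over the subring on finitely many
  variables.\<close>

lemma variable_action_module:
  fixes scale :: "'a::field mpoly \<Rightarrow> 'm::ab_group_add \<Rightarrow> 'm"
  assumes "module scale" "finite I"
  shows "variable_action (\<lambda>c. scale (const c)) (\<lambda>i. scale (var i)) I"
proof -
  interpret module scale by fact
  show ?thesis
  proof unfold_locales
    show "scale (const (a + b)) x = scale (const a) x + scale (const b) x" for a b x
      by (simp add: single_add scale_left_distrib)
    show "scale (const a) (scale (const b) x) = scale (const (a * b)) x" for a b x
      by (simp add: mult_single)
    show "scale (const 1) x = x" for x by simp
    show "scale (var i) (scale (const a) v) = scale (const a) (scale (var i) v)" for i a v
      by (simp add: mult.commute)
    show "scale (var i) (scale (var j) v) = scale (var j) (scale (var i) v)" for i j v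
      by (simp add: mult.commute)
  qed (simp_all add: scale_right_distrib assms)
qed

abbreviation homology_dim ::
  "('a::field mpoly \<Rightarrow> 'm \<Rightarrow> 'm) \<Rightarrow> nat set \<Rightarrow> 'm::ab_group_add set \<Rightarrow> nat \<Rightarrow> nat \<Rightarrow> bool" where
  "homology_dim scale \<equiv> koszul_homology_dim (\<lambda>c. scale (const c)) (\<lambda>i. scale (var i))"

abbreviation free_act :: "nat \<Rightarrow> 'a::field free_vec \<Rightarrow> 'a free_vec" where
  "free_act \<equiv> \<lambda>i. free_scale (var i)"

lemma submodule_free_module:
  assumes "finite I"
  shows "variable_action.submodule (\<lambda>c. free_scale (const c)) free_act I (free_module I ds)"
proof -
  interpret variable_action "\<lambda>c. free_scale (const c)" free_act I
    by (rule variable_action_module[OF module_free_scale assms])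
  show ?thesis unfolding submodule_def
  proof (intro conjI subspaceI ballI)
    show "u + v \<in> free_module I ds" if "u \<in> free_module I ds" "v \<in> free_module I ds" for u v
      using that unfolding free_module_iff vec_coeff_add by (metis add.right_neutral)
    show "free_act i v \<in> free_module I ds" if "i \<in> I" "v \<in> free_module I ds" for i v
      unfolding free_module_iff vec_coeff_act
    proof (intro allI impI)
      fix j m
      assume *: "(if i \<in> Poly_Mapping.keys m then vec_coeff v j (m - Poly_Mapping.single i 1) else 0) \<noteq> 0"
      then have i: "i \<in> Poly_Mapping.keys m" by (auto split: if_splits)
      have "Poly_Mapping.keys m \<subseteq> {i} \<union> Poly_Mapping.keys (m - Poly_Mapping.single i 1)"
        using keys_add[of "Poly_Mapping.single i 1" "m - Poly_Mapping.single i 1"]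
        by (simp only: minus_single_add[OF i]) auto
      then show "j < length ds \<and> Poly_Mapping.keys m \<subseteq> I"
        using * i that unfolding free_module_iff by auto
    qed
  qed (auto simp: free_module_iff vec_coeff_const)
qed

text \<open>Division by \<open>X\<^sub>l\<close> of those terms that \<open>X\<^sub>l\<close> divides with a quotient in the variables \<open>X\<^sub>i\<close>,
  \<open>i \<ge> l\<close>; the other terms are dropped.\<close>

definition div_min_var :: "nat \<Rightarrow> 'a::field mpoly \<Rightarrow> 'a mpoly" where
  "div_min_var l p = Poly_Mapping.mapp (\<lambda>m c. if Poly_Mapping.keys m \<subseteq> {l..} then c else 0)
     (Poly_Mapping.map_key (\<lambda>m. m + Poly_Mapping.single l 1) p)"

lemma lookup_div_min_var: "Poly_Mapping.lookup (div_min_var l p) m =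
   (if Poly_Mapping.keys m \<subseteq> {l..} then Poly_Mapping.lookup p (m + Poly_Mapping.single l 1) else 0)"
proof -
  have "inj (\<lambda>m :: nat \<Rightarrow>\<^sub>0 nat. m + Poly_Mapping.single l 1)" by (simp add: inj_on_def)
  then show ?thesis
    by (simp add: div_min_var_def lookup_mapp map_key.rep_eq when_def in_keys_iff)
qed

definition koszul_homotopy :: "nat set \<Rightarrow> (nat set \<Rightarrow> 'a::field free_vec) \<Rightarrow> nat set \<Rightarrow> 'a free_vec" where
  "koszul_homotopy I c J =
     (if J \<subseteq> I \<and> J \<noteq> {} then Poly_Mapping.map (div_min_var (Min J)) (c (J - {Min J})) else 0)"

lemma vec_coeff_homotopy:
  "vec_coeff (koszul_homotopy I c J) j m =
     (if J \<subseteq> I \<and> J \<noteq> {} \<and> Poly_Mapping.keys m \<subseteq> {Min J..}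
      then vec_coeff (c (J - {Min J})) j (m + Poly_Mapping.single (Min J) 1) else 0)"
proof -
  have [simp]: "div_min_var l (0 :: 'a mpoly) = 0" for l
    by (rule poly_mapping_eqI) (simp add: lookup_div_min_var)
  show ?thesis
    by (simp add: koszul_homotopy_def vec_coeff_def map.rep_eq lookup_div_min_var when_def)
qed

lemma vec_coeff_koszul_diff:
  "vec_coeff (koszul_diff free_act I c J) j m = (if J \<subseteq> I then \<Sum>i\<in>I - J.
     koszul_sign i J (if i \<in> Poly_Mapping.keys m
       then vec_coeff (c (insert i J)) j (m - Poly_Mapping.single i 1) else 0) else 0)"
  by (simp add: koszul_diff_def vec_coeff_sum vec_coeff_sign vec_coeff_act)

lemma homotopy_chains:
  assumes "finite I" "c \<in> koszul_chains I (free_module I ds) i"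
  shows "koszul_homotopy I c \<in> koszul_chains I (free_module I ds) (Suc i)"
proof (rule koszul_chainsI)
  have c: "c J \<in> free_module I ds" for J using assms(2) by (rule koszul_chainsD)
  show "koszul_homotopy I c J \<in> free_module I ds" for J
    unfolding free_module_iff vec_coeff_homotopy
  proof (intro allI impI)
    fix j m
    assume *: "(if J \<subseteq> I \<and> J \<noteq> {} \<and> Poly_Mapping.keys m \<subseteq> {Min J..}
      then vec_coeff (c (J - {Min J})) j (m + Poly_Mapping.single (Min J) 1) else 0) \<noteq> 0"
    have "Poly_Mapping.keys m \<subseteq> Poly_Mapping.keys (m + Poly_Mapping.single (Min J) 1)"
      by (auto simp: in_keys_iff lookup_add)
    with * c show "j < length ds \<and> Poly_Mapping.keys m \<subseteq> I"
      unfolding free_module_iff by (meson subset_trans)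
  qed
  show "koszul_homotopy I c J = 0" if "\<not> (J \<subseteq> I \<and> card J = Suc i)" for J
  proof (cases "J \<subseteq> I \<and> J \<noteq> {}")
    case True
    then have "finite J" using assms(1) finite_subset by blast
    then have "Suc (card (J - {Min J})) = card J" using True by (meson Min_in card_Suc_Diff1)
    then have "c (J - {Min J}) = 0" using koszul_chainsD(2)[OF assms(2)] that True by auto
    then show ?thesis by (simp add: koszul_homotopy_def poly_mapping_eq_iff fun_eq_iff map.rep_eq)
  qed (auto simp: koszul_homotopy_def)
qed

text \<open>In a fixed multidegree \<open>q \<noteq> 0\<close> the terms \<open>X\<^sup>m e\<^sub>J\<close> of the Koszul complex of a polynomial ring
  correspond to the subsets \<open>J\<close> of the support of \<open>q\<close>, that is, to the faces of a simplex. The smallest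
  vertex of the simplex is the smallest variable that occurs in \<open>m\<close> or \<open>J\<close>; the homotopy is the cone
  from this vertex, which moves that variable from \<open>m\<close> to \<open>J\<close>. In contrast to an Euler derivation it
  does not divide by degrees, which could vanish in \<open>K\<close>.\<close>

lemma koszul_diff_homotopy:
  fixes c :: "nat set \<Rightarrow> 'a::field free_vec"
  assumes fin: "finite I" and c: "c \<in> koszul_cycles free_act I (free_module I ds) i"
    and no_const: "i = 0 \<Longrightarrow> \<forall>j. vec_coeff (c {}) j 0 = 0"
  shows "koszul_diff free_act I (koszul_homotopy I c) = c"
proof (intro ext vec_eqI)
  fix J :: "nat set" and j and m :: "nat \<Rightarrow>\<^sub>0 nat"
  have ch: "c \<in> koszul_chains I (free_module I ds) i" and cyc: "koszul_diff free_act I c = 0"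
    using c by (auto simp: koszul_cycles_def)
  let ?h = "koszul_homotopy I c"
  let ?K = "J \<union> Poly_Mapping.keys m"
  show "vec_coeff (koszul_diff free_act I ?h J) j m = vec_coeff (c J) j m"
  proof (cases "J \<subseteq> I \<and> Poly_Mapping.keys m \<subseteq> I")
    case False
    have "vec_coeff (koszul_diff free_act I ?h J) j m = 0"
    proof -
      interpret variable_action "\<lambda>c. free_scale (const c)" free_act I
        by (rule variable_action_module[OF module_free_scale fin])
      have "koszul_diff free_act I ?h \<in> koszul_chains I (free_module I ds) i"
        by (rule diff_chains[OF submodule_free_module[OF fin] homotopy_chains[OF fin ch]])
      then show ?thesis
        using False koszul_chainsD[of _ I "free_module I ds" i J] free_module_iff vec_coeff_0 by metis
    qed
    moreover have "vec_coeff (c J) j m = 0"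
      using False koszul_chainsD[OF ch, of J] free_module_iff vec_coeff_0 by metis
    ultimately show ?thesis by simp
  next
    case True
    then have J: "J \<subseteq> I" "finite J" using fin finite_subset by auto
    let ?t = "\<lambda>i. koszul_sign i J (if i \<in> Poly_Mapping.keys m
       then vec_coeff (?h (insert i J)) j (m - Poly_Mapping.single i 1) else 0)"
    have lhs: "vec_coeff (koszul_diff free_act I ?h J) j m = (\<Sum>i\<in>I - J. ?t i)"
      using J by (simp add: vec_coeff_koszul_diff)
    show ?thesis
    proof (cases "?K = {}")
      case True
      then have "m = 0" "J = {}" by (auto simp: poly_mapping_eq_iff fun_eq_iff in_keys_iff)
      moreover have "vec_coeff (c {}) j 0 = 0"
      proof (cases i)
        case (Suc k)
        then show ?thesis using koszul_chainsD(2)[OF ch, of "{}"] by simp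
      qed (use no_const in auto)
      ultimately show ?thesis using lhs by simp
    next
      case False
      define l where "l = Min ?K"
      have fK: "finite ?K" using J by simp
      have l: "l \<in> ?K" unfolding l_def by (rule Min_in[OF fK False])
      have l_le: "\<And>i. i \<in> ?K \<Longrightarrow> l \<le> i" unfolding l_def by (rule Min_le[OF fK])
      have l_less: "l < i" if "i \<in> ?K" "i \<noteq> l" for i using l_le[OF that(1)] that(2) by simp
      show ?thesis
      proof (cases "l \<in> J")
        case False
        then have lm: "l \<in> Poly_Mapping.keys m" using l by auto
        \<comment> \<open>Only the face that adds the vertex \<open>l\<close> survives.\<close>
        have "?t i = 0" if i: "i \<in> I - J - {l}" for i
        proof (cases "i \<in> Poly_Mapping.keys m")
          case True
          have "l < Min (insert i J)"
            using J(2) False i True l_less by (subst Min_gr_iff) auto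
          moreover have "l \<in> Poly_Mapping.keys (m - Poly_Mapping.single i 1)"
            using lm i by (simp add: in_keys_iff lookup_minus lookup_single)
          ultimately show ?thesis by (auto simp: vec_coeff_homotopy)
        qed simp
        moreover have "?t l = vec_coeff (c J) j m"
        proof -
          have sgn: "koszul_sign l J v = v" for v :: 'a
            by (rule koszul_sign_least) (use l_le in blast)
          have min: "Min (insert l J) = l" using J l_le by (intro Min_eqI) auto
          have "Poly_Mapping.keys (m - Poly_Mapping.single l 1) \<subseteq> Poly_Mapping.keys m"
            by (auto simp: in_keys_iff lookup_minus)
          then have "Poly_Mapping.keys (m - Poly_Mapping.single l 1) \<subseteq> {l..}" using l_le by auto
          moreover have "insert l J \<subseteq> I" "insert l J - {l} = J" using J lm True False by auto
          moreover have "m - Poly_Mapping.single l 1 + Poly_Mapping.single l 1 = m"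
            using minus_single_add[OF lm] by (simp add: add.commute)
          ultimately show ?thesis by (simp only: sgn vec_coeff_homotopy min lm if_True simp_thms) simp
        qed
        moreover have "l \<in> I - J" using lm True False by auto
        ultimately show ?thesis using lhs fin by (simp add: sum.remove)
      next
        case lJ: True
        \<comment> \<open>The cycle condition at \<open>J - {l}\<close> expresses the coefficient of \<open>c J\<close> by the remaining terms.\<close>
        define J' where "J' = J - {l}"
        have J': "J = insert l J'" "l \<notin> J'" "finite J'" "J' \<subseteq> I" using lJ J by (auto simp: J'_def)
        let ?s = "\<lambda>i. koszul_sign i J' (if i \<in> Poly_Mapping.keys (m + Poly_Mapping.single l 1)
          then vec_coeff (c (insert i J')) j (m + Poly_Mapping.single l 1 - Poly_Mapping.single i 1) else 0)"
        have t: "?t i = - ?s i" if i: "i \<in> I - J" for i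
        proof (cases "i \<in> Poly_Mapping.keys m")
          case True
          have li: "l < i" using l_less[of i] True i lJ by blast
          have "Poly_Mapping.keys (m - Poly_Mapping.single i 1) \<subseteq> Poly_Mapping.keys m"
            by (auto simp: in_keys_iff lookup_minus)
          then have k: "Poly_Mapping.keys (m - Poly_Mapping.single i 1) \<subseteq> {l..}" using l_le by auto
          have min: "Min (insert i J) = l"
            using J lJ True l_le by (intro Min_eqI) auto
          have e: "insert i J - {l} = insert i J'" using i lJ by (auto simp: J'_def)
          have m: "m - Poly_Mapping.single i 1 + Poly_Mapping.single l 1
              = m + Poly_Mapping.single l 1 - Poly_Mapping.single i 1"
            using True li
            by (intro poly_mapping_eqI) (auto simp: lookup_add lookup_minus lookup_single when_def in_keys_iff)
          have km: "i \<in> Poly_Mapping.keys (m + Poly_Mapping.single l 1)"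
            using True by (simp add: in_keys_iff lookup_add)
          have "koszul_sign i J v = - koszul_sign i J' v" for v :: 'a
            using koszul_sign_insert[OF J'(3,2), of i v] li J'(1) by simp
          then show ?thesis
            using True k i J by (simp add: vec_coeff_homotopy min e m km del: One_nat_def)
        next
          case False
          then have "i \<notin> Poly_Mapping.keys (m + Poly_Mapping.single l 1)"
            using i lJ by (auto simp: in_keys_iff lookup_add lookup_single when_def)
          with False show ?thesis by simp
        qed
        have s_l: "?s l = vec_coeff (c J) j m"
        proof -
          have "koszul_sign l J' v = v" for v :: 'a
            by (rule koszul_sign_least) (use l_le J'(1) in blast)
          moreover have "l \<in> Poly_Mapping.keys (m + Poly_Mapping.single l 1)"
            by (simp add: in_keys_iff lookup_add)
          ultimately show ?thesis using J'(1) by simp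
        qed
        have "0 = vec_coeff (koszul_diff free_act I c J') j (m + Poly_Mapping.single l 1)"
          by (simp add: cyc)
        also have "\<dots> = (\<Sum>i\<in>I - J'. ?s i)" using J'(4) by (simp only: vec_coeff_koszul_diff if_True)
        also have "I - J' = insert l (I - J)" using J J' by auto
        also have "(\<Sum>i\<in>insert l (I - J). ?s i) = ?s l + (\<Sum>i\<in>I - J. ?s i)"
          using fin lJ by simp
        also have "\<dots> = vec_coeff (c J) j m - (\<Sum>i\<in>I - J. ?t i)"
          unfolding s_l by (simp only: sum.cong[OF refl t] sum_negf) simp
        finally show ?thesis using lhs by simp
      qed
    qed
  qed
qed

lemma free_module_acyclic:
  assumes "finite I"
  shows "koszul_cycles free_act I (free_module I ds) (Suc i)
    \<subseteq> koszul_boundaries free_act I (free_module I ds) (Suc i)"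
proof
  fix c :: "nat set \<Rightarrow> 'a free_vec"
  assume c: "c \<in> koszul_cycles free_act I (free_module I ds) (Suc i)"
  then have "koszul_homotopy I c \<in> koszul_chains I (free_module I ds) (Suc (Suc i))"
    by (intro homotopy_chains[OF assms]) (simp add: koszul_cycles_def)
  moreover have "koszul_diff free_act I (koszul_homotopy I c) = c"
    by (rule koszul_diff_homotopy[OF assms c]) simp
  ultimately show "c \<in> koszul_boundaries free_act I (free_module I ds) (Suc i)"
    unfolding koszul_boundaries_def by (metis image_eqI)
qed

lemma irrelevant_submodule_boundary:
  fixes v :: "'a::field free_vec"
  assumes "finite I" "v \<in> irrelevant_submodule I ds"
  shows "\<exists>b \<in> koszul_chains I (free_module I ds) 1. koszul_diff free_act I b {} = v"
proof -
  interpret variable_action "\<lambda>c. free_scale (const c)" free_act I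
    by (rule variable_action_module[OF module_free_scale assms(1)])
  define c where "c = (\<lambda>J :: nat set. if J = {} then v else 0)"
  have "c \<in> koszul_chains I (free_module I ds) 0"
    using assms(2) by (intro koszul_chainsI) (auto simp: c_def irrelevant_submodule_iff free_module_iff)
  then have c: "c \<in> koszul_cycles free_act I (free_module I ds) 0" by (simp add: cycles_0)
  have "koszul_homotopy I c \<in> koszul_chains I (free_module I ds) (Suc 0)"
    using c by (intro homotopy_chains[OF assms(1)]) (simp add: koszul_cycles_def)
  moreover have "koszul_diff free_act I (koszul_homotopy I c) = c"
    by (rule koszul_diff_homotopy[OF assms(1) c])
      (use assms(2) in \<open>auto simp: c_def irrelevant_submodule_iff\<close>)
  ultimately show ?thesis by (intro bexI[of _ "koszul_homotopy I c"]) (auto simp: c_def)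
qed

lemma free_module_homology_0:
  assumes "finite I"
  shows "homology_dim free_scale I (free_module I ds :: 'a::field free_vec set) 0 (length ds)"
proof -
  interpret variable_action "\<lambda>c. free_scale (const c)" free_act I
    by (rule variable_action_module[OF module_free_scale assms(1)])
  let ?F = "free_module I ds :: 'a free_vec set"
  have "quotient_dim (\<lambda>a c J. free_scale (const a) (c J)) (koszul_chains I ?F 0)
    (koszul_boundaries free_act I ?F 0) (card {..<length ds})"
  proof (rule quotient_dimI[where f = "\<lambda>j c. vec_coeff (c {}) j 0"])
    show "linear_functional_on (\<lambda>a c J. free_scale (const a) (c J)) (koszul_chains I ?F 0)
        (\<lambda>c. vec_coeff (c {}) j 0)" for j
      by (simp add: linear_functional_on_def vec_coeff_add vec_coeff_const)
    show "\<exists>c\<in>koszul_chains I ?F 0. \<forall>j\<in>{..<length ds}. vec_coeff (c {}) j 0 = a j" for a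
    proof -
      define v where "v = (\<Sum>j<length ds. Poly_Mapping.single j (const (a j)))"
      have v: "vec_coeff v j m = (if j < length ds \<and> m = 0 then a j else 0)" for j m
      proof -
        have "vec_coeff (Poly_Mapping.single i (const b)) j m = (if i = j then if m = 0 then b else 0 else 0)"
          for i and b :: 'a
          by (auto simp: vec_coeff_def lookup_single when_def)
        then show ?thesis by (simp add: v_def vec_coeff_sum)
      qed
      have "(\<lambda>J. if J = {} then v else 0) \<in> koszul_chains I ?F 0"
        by (intro koszul_chainsI) (auto simp: free_module_iff v)
      then show ?thesis by (intro bexI) (auto simp: v)
    qed
    show "koszul_boundaries free_act I ?F 0 =
        {c \<in> koszul_chains I ?F 0. \<forall>j\<in>{..<length ds}. vec_coeff (c {}) j 0 = 0}"
    proof (intro equalityI subsetI)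
      fix c assume c: "c \<in> koszul_boundaries free_act I ?F 0"
      then obtain b where "c = koszul_diff free_act I b" unfolding koszul_boundaries_def by blast
      then have "vec_coeff (c {}) j 0 = 0" for j by (simp add: vec_coeff_koszul_diff)
      moreover have "c \<in> koszul_chains I ?F 0"
        using c boundaries_subset_cycles[OF submodule_free_module[OF assms]] by (auto simp flip: cycles_0)
      ultimately show "c \<in> {c \<in> koszul_chains I ?F 0. \<forall>j\<in>{..<length ds}. vec_coeff (c {}) j 0 = 0}"
        by blast
    next
      fix c assume "c \<in> {c \<in> koszul_chains I ?F 0. \<forall>j\<in>{..<length ds}. vec_coeff (c {}) j 0 = 0}"
      then have c: "c \<in> koszul_chains I ?F 0" and c0: "\<And>j. j < length ds \<Longrightarrow> vec_coeff (c {}) j 0 = 0"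
        by auto
      have "vec_coeff (c {}) j 0 = 0" for j
        using c0 koszul_chainsD(1)[OF c, of "{}"] unfolding free_module_iff by blast
      then have "koszul_diff free_act I (koszul_homotopy I c) = c"
        using c by (intro koszul_diff_homotopy[OF assms, of c ds 0]) (auto simp: cycles_0)
      then show "c \<in> koszul_boundaries free_act I ?F 0"
        using homotopy_chains[OF assms c] unfolding koszul_boundaries_def by (metis image_eqI)
    qed
  qed simp
  then show ?thesis by (simp add: koszul_homology_dim_def cycles_0)
qed

section \<open>Betti numbers as dimensions of Koszul homology\<close>

lemma acyclic_coverI:
  fixes scale :: "'a::field mpoly \<Rightarrow> 'm::ab_group_add \<Rightarrow> 'm"
  assumes "module scale" "finite I"
    and hom: "module_hom_betw (polynomial_ring I) free_scale scale (free_module I ds) N f"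
    and onto: "f ` free_module I ds = M"
    and min: "{v \<in> free_module I ds. f v = 0} \<subseteq> irrelevant_submodule I ds"
  shows "acyclic_cover (\<lambda>c. free_scale (const c)) free_act (\<lambda>c. scale (const c)) (\<lambda>i. scale (var i)) I
     (free_module I ds) M {v \<in> free_module I ds. f v = 0} f"
proof -
  interpret F: variable_action "\<lambda>c. free_scale (const c)" free_act I
    by (rule variable_action_module[OF module_free_scale assms(2)])
  interpret M: variable_action "\<lambda>c. scale (const c)" "\<lambda>i. scale (var i)" I
    by (rule variable_action_module[OF assms(1,2)])
  show ?thesis
  proof unfold_locales
    show "F.submodule (free_module I ds)" by (rule submodule_free_module[OF assms(2)])
    show "f (free_scale (const a) v) = scale (const a) (f v)" if "v \<in> free_module I ds" for a v
      using hom that const_in_polynomial_ring unfolding module_hom_betw_def by blast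
    show "f (free_act i v) = scale (var i) (f v)" if "i \<in> I" "v \<in> free_module I ds" for i v
      using hom that var_in_polynomial_ring unfolding module_hom_betw_def by blast
    show "\<exists>b\<in>koszul_chains I (free_module I ds) 1. koszul_diff free_act I b {} = v"
      if "v \<in> {v \<in> free_module I ds. f v = 0}" for v
      using irrelevant_submodule_boundary[OF assms(2)] min that by blast
  qed (use hom onto free_module_acyclic[OF assms(2)] in \<open>auto simp: module_hom_betw_def\<close>)
qed

text \<open>Dimension shifting along the syzygy modules of a minimal resolution identifies \<open>F\<^sub>t/\<mm>F\<^sub>t\<close> with
  the \<open>t\<close>-th Koszul homology of \<open>M\<close>; the Koszul complex plays the part of a computation of
  \<open>Tor(K, M)\<close> that does not mention the resolution.\<close>

theorem minimal_resolution_rank: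
  fixes scale :: "'a::field mpoly \<Rightarrow> 'm::ab_group_add \<Rightarrow> 'm"
  assumes "module scale" "finite I"
    and res: "minimal_graded_free_resolution I w scale M piece sh \<delta> \<epsilon>"
    and dim: "homology_dim scale I M t n"
  shows "length (sh t) = n"
proof -
  define F where "F t = (free_module I (sh t) :: 'a free_vec set)" for t
  define Z where "Z t = (case t of 0 \<Rightarrow> {v \<in> F 0. \<epsilon> v = 0} | Suc s \<Rightarrow> {v \<in> F (Suc s). \<delta> s v = 0})" for t
  have gr: "graded_free_resolution I w scale M piece sh \<delta> \<epsilon>"
    and min: "\<And>t. \<delta> t ` F (Suc t) \<subseteq> irrelevant_submodule I (sh t)"
    using res unfolding minimal_graded_free_resolution_def F_def by auto
  have im: "\<delta> t ` F (Suc t) = Z t" for t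
    using gr unfolding graded_free_resolution_def Z_def F_def by (cases t) auto
  have Z_min: "Z t \<subseteq> irrelevant_submodule I (sh t)" for t using im min by metis
  have hom0: "module_hom_betw (polynomial_ring I) free_scale scale (free_module I (sh 0)) M \<epsilon>"
    and onto0: "\<epsilon> ` free_module I (sh 0) = M"
    and hom: "\<And>t. module_hom_betw (polynomial_ring I) free_scale free_scale
            (free_module I (sh (Suc t))) (free_module I (sh t)) (\<delta> t)"
    using gr unfolding graded_free_resolution_def by auto
  interpret M: variable_action "\<lambda>c. scale (const c)" "\<lambda>i. scale (var i)" I
    by (rule variable_action_module[OF assms(1,2)])
  interpret R: variable_action "\<lambda>c. free_scale (const c)" "free_act :: nat \<Rightarrow> 'a free_vec \<Rightarrow> _" I
    by (rule variable_action_module[OF module_free_scale assms(2)])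
  interpret E: acyclic_cover "\<lambda>c. free_scale (const c)" free_act "\<lambda>c. scale (const c)" "\<lambda>i. scale (var i)" I
    "F 0" M "Z 0" \<epsilon>
    using acyclic_coverI[OF assms(1,2) hom0 onto0] Z_min[of 0] by (simp add: F_def Z_def)
  have D: "acyclic_cover (\<lambda>c. free_scale (const c)) free_act (\<lambda>c. free_scale (const c)) free_act I
    (F (Suc t)) (Z t) (Z (Suc t)) (\<delta> t)" for t
    using acyclic_coverI[OF module_free_scale assms(2) hom] Z_min[of "Suc t"] im by (simp add: F_def Z_def)
  have shift: "homology_dim free_scale I (Z s) i n" if "homology_dim scale I M (Suc s + i) n" for s i
    using that
  proof (induction s arbitrary: i)
    case 0
    then show ?case by (intro E.dimension_shift) simp
  next
    case (Suc s)
    then have "homology_dim free_scale I (Z s) (Suc i) n" by simp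
    then show ?case by (rule acyclic_cover.dimension_shift[OF D])
  qed
  show ?thesis
  proof (cases t)
    case 0
    interpret CM: vector_space "\<lambda>a (c :: nat set \<Rightarrow> 'm) J. scale (const a) (c J)"
      by (rule M.vector_space_chains)
    have "homology_dim scale I M 0 (length (sh 0))"
      using E.homology_0_cover free_module_homology_0[OF assms(2)] unfolding F_def by blast
    then show ?thesis
      using dim 0 CM.qdim_unique[OF M.subspace_cycles[OF E.M_subspace]]
      unfolding koszul_homology_dim_def by blast
  next
    case (Suc s)
    interpret CF: vector_space "\<lambda>a (c :: nat set \<Rightarrow> 'a free_vec) J. free_scale (const a) (c J)"
      by (rule R.vector_space_chains)
    have "homology_dim free_scale I (Z s) 0 (length (sh (Suc s)))"
      using acyclic_cover.homology_0_cover[OF D] free_module_homology_0[OF assms(2)] unfolding F_def by blast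
    moreover have "homology_dim free_scale I (Z s) 0 n" using shift[of s 0] dim Suc by simp
    ultimately show ?thesis
      using Suc CF.qdim_unique[OF R.subspace_cycles[OF acyclic_cover.M_subspace[OF D]]]
      unfolding koszul_homology_dim_def by blast
  qed
qed

section \<open>Existence of minimal graded resolutions\<close>

text \<open>Gradings are given by the projections to the homogeneous components.\<close>

locale graded_module = module scale
  for scale :: "'a::field mpoly \<Rightarrow> 'm::ab_group_add \<Rightarrow> 'm" +
  fixes w :: "nat \<Rightarrow> nat" and proj :: "int \<Rightarrow> 'm \<Rightarrow> 'm"
  assumes proj_add: "proj d (u + v) = proj d u + proj d v"
    and proj_monomial: "proj d (scale (Poly_Mapping.single m c) v) =
      scale (Poly_Mapping.single m c) (proj (d - int (weighted_degree w m)) v)"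
    and proj_proj: "proj d (proj d' v) = (if d = d' then proj d v else 0)"
    and finite_proj: "finite {d. proj d v \<noteq> 0}"
    and sum_proj: "(\<Sum>d | proj d v \<noteq> 0. proj d v) = v"

definition graded_submodule ::
  "('a::field mpoly \<Rightarrow> 'm::ab_group_add \<Rightarrow> 'm) \<Rightarrow> (int \<Rightarrow> 'm \<Rightarrow> 'm) \<Rightarrow> nat set \<Rightarrow> 'm set \<Rightarrow> bool" where
  "graded_submodule scale proj I Z \<longleftrightarrow>
     0 \<in> Z \<and> (\<forall>u\<in>Z. \<forall>v\<in>Z. u + v \<in> Z) \<and> (\<forall>r\<in>polynomial_ring I. \<forall>v\<in>Z. scale r v \<in> Z) \<and>
     (\<forall>d. \<forall>v\<in>Z. proj d v \<in> Z) \<and> (\<exists>d0. \<forall>v\<in>Z. \<forall>d<d0. proj d v = 0)"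

definition vec_proj :: "(nat \<Rightarrow> nat) \<Rightarrow> int list \<Rightarrow> int \<Rightarrow> 'a::field free_vec \<Rightarrow> 'a free_vec" where
  "vec_proj w ds d v = Poly_Mapping.mapp (\<lambda>j. Poly_Mapping.mapp (\<lambda>m c.
     if int (weighted_degree w m) + (if j < length ds then ds ! j else 0) = d then c else 0)) v"

lemma vec_coeff_proj: "vec_coeff (vec_proj w ds d v) j m =
    (if int (weighted_degree w m) + (if j < length ds then ds ! j else 0) = d then vec_coeff v j m else 0)"
  by (auto simp: vec_coeff_def vec_proj_def lookup_mapp when_def in_keys_iff)

lemma weighted_degree_superset:
  assumes "finite K" "Poly_Mapping.keys m \<subseteq> K"
  shows "weighted_degree w m = (\<Sum>i\<in>K. Poly_Mapping.lookup m i * w i)"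
  unfolding weighted_degree_def using assms
  by (intro sum.mono_neutral_left) (auto simp: in_keys_iff)

lemma weighted_degree_add: "weighted_degree w (m + q) = weighted_degree w m + weighted_degree w q"
proof -
  let ?K = "Poly_Mapping.keys m \<union> Poly_Mapping.keys q"
  have "weighted_degree w (m + q) = (\<Sum>i\<in>?K. Poly_Mapping.lookup (m + q) i * w i)"
    by (intro weighted_degree_superset keys_add) auto
  also have "\<dots> = weighted_degree w m + weighted_degree w q"
    by (simp add: weighted_degree_superset[of ?K] lookup_add algebra_simps sum.distrib)
  finally show ?thesis .
qed

lemma weighted_degree_0 [simp]: "weighted_degree w 0 = 0"
  by (simp add: weighted_degree_def)

lemma weighted_degree_var [simp]: "weighted_degree w (Poly_Mapping.single i 1) = w i"
  by (simp add: weighted_degree_def)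

lemma vec_coeff_monomial_mult:
  "vec_coeff (free_scale (Poly_Mapping.single q c) v) j (q + r) = c * vec_coeff v j r"
  by (simp add: vec_coeff_def lookup_free_scale lookup_monomial_mult)

lemma vec_coeff_monomial_mult_0:
  "(\<And>r. m \<noteq> q + r) \<Longrightarrow> vec_coeff (free_scale (Poly_Mapping.single q c) v) j m = 0"
  by (simp add: vec_coeff_def lookup_free_scale lookup_monomial_mult_0)

lemma graded_module_free: "graded_module (free_scale :: 'a::field mpoly \<Rightarrow> _) w (vec_proj w ds)"
proof -
  interpret module "free_scale :: 'a mpoly \<Rightarrow> _" by (rule module_free_scale)
  have fin: "finite {d. vec_proj w ds d v \<noteq> 0}" for v :: "'a free_vec"
  proof (rule finite_subset)
    let ?T = "SIGMA j:Poly_Mapping.keys v. Poly_Mapping.keys (Poly_Mapping.lookup v j)"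
    show "{d. vec_proj w ds d v \<noteq> 0} \<subseteq>
        (\<lambda>(j, m). int (weighted_degree w m) + (if j < length ds then ds ! j else 0)) ` ?T"
    proof
      fix d assume "d \<in> {d. vec_proj w ds d v \<noteq> 0}"
      then obtain j m where jm: "vec_coeff (vec_proj w ds d v) j m \<noteq> 0"
        using vec_eqI[of "vec_proj w ds d v" 0] by auto
      then have d: "int (weighted_degree w m) + (if j < length ds then ds ! j else 0) = d"
        and "vec_coeff v j m \<noteq> 0"
        unfolding vec_coeff_proj by (auto split: if_splits)
      then have "m \<in> Poly_Mapping.keys (Poly_Mapping.lookup v j)" by (simp add: vec_coeff_def in_keys_iff)
      moreover from this have "j \<in> Poly_Mapping.keys v" by (auto simp: in_keys_iff)
      ultimately have "(j, m) \<in> ?T" by simp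
      with d show "d \<in> (\<lambda>(j, m). int (weighted_degree w m) + (if j < length ds then ds ! j else 0)) ` ?T"
        by (intro image_eqI[of _ _ "(j, m)"]) simp_all
    qed
  qed simp
  show ?thesis
  proof unfold_locales
    show "vec_proj w ds d (free_scale (Poly_Mapping.single q c) v) =
      free_scale (Poly_Mapping.single q c) (vec_proj w ds (d - int (weighted_degree w q)) v)" for d q c and v :: "'a free_vec"
    proof (rule vec_eqI)
      fix j m
      show "vec_coeff (vec_proj w ds d (free_scale (Poly_Mapping.single q c) v)) j m =
        vec_coeff (free_scale (Poly_Mapping.single q c) (vec_proj w ds (d - int (weighted_degree w q)) v)) j m"
      proof (cases "\<exists>r. m = q + r")
        case True
        then obtain r where "m = q + r" by blast
        then show ?thesis
          by (simp add: vec_coeff_proj vec_coeff_monomial_mult weighted_degree_add algebra_simps)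
      qed (simp add: vec_coeff_proj vec_coeff_monomial_mult_0)
    qed
    show "(\<Sum>d | vec_proj w ds d v \<noteq> 0. vec_proj w ds d v) = v" for v :: "'a free_vec"
    proof (rule vec_eqI)
      fix j m
      let ?d = "int (weighted_degree w m) + (if j < length ds then ds ! j else 0)"
      have "vec_coeff (\<Sum>d | vec_proj w ds d v \<noteq> 0. vec_proj w ds d v) j m =
          (\<Sum>d | vec_proj w ds d v \<noteq> 0. if ?d = d then vec_coeff v j m else 0)"
        by (simp add: vec_coeff_sum vec_coeff_proj)
      also have "\<dots> = (if vec_proj w ds ?d v \<noteq> 0 then vec_coeff v j m else 0)"
        using fin by (subst sum.delta') auto
      also have "\<dots> = vec_coeff v j m"
        using vec_coeff_proj[of w ds ?d v j m] by auto
      finally show "vec_coeff (\<Sum>d | vec_proj w ds d v \<noteq> 0. vec_proj w ds d v) j m = vec_coeff v j m" .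
    qed
  qed (auto simp: fin vec_coeff_proj vec_coeff_add intro!: vec_eqI)
qed

lemma free_module_piece_eq:
  "free_module_piece I w ds d = {v \<in> free_module I ds. vec_proj w ds d v = v}"
proof -
  have "(\<forall>j<length ds. \<forall>m\<in>Poly_Mapping.keys (Poly_Mapping.lookup v j). int (weighted_degree w m) + ds ! j = d)
     \<longleftrightarrow> vec_proj w ds d v = v" if v: "v \<in> free_module I ds" for v :: "'a free_vec"
  proof
    assume *: "\<forall>j<length ds. \<forall>m\<in>Poly_Mapping.keys (Poly_Mapping.lookup v j). int (weighted_degree w m) + ds ! j = d"
    show "vec_proj w ds d v = v"
    proof (rule vec_eqI)
      fix j m
      show "vec_coeff (vec_proj w ds d v) j m = vec_coeff v j m"
      proof (cases "vec_coeff v j m = 0")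
        case False
        then have "j < length ds" "m \<in> Poly_Mapping.keys (Poly_Mapping.lookup v j)"
          using v by (auto simp: free_module_iff in_keys_iff vec_coeff_def)
        then show ?thesis using * by (simp add: vec_coeff_proj)
      qed (simp add: vec_coeff_proj)
    qed
  next
    assume "vec_proj w ds d v = v"
    then have *: "vec_coeff (vec_proj w ds d v) j m = vec_coeff v j m" for j m by simp
    show "\<forall>j<length ds. \<forall>m\<in>Poly_Mapping.keys (Poly_Mapping.lookup v j). int (weighted_degree w m) + ds ! j = d"
    proof (intro allI impI ballI)
      fix j m assume j: "j < length ds" "m \<in> Poly_Mapping.keys (Poly_Mapping.lookup v j)"
      then have "vec_coeff v j m \<noteq> 0" by (simp add: vec_coeff_def in_keys_iff)
      then show "int (weighted_degree w m) + ds ! j = d"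
        using *[of j m] j(1) by (auto simp: vec_coeff_proj split: if_splits)
    qed
  qed
  then show ?thesis unfolding free_module_piece_def by blast
qed

lemma poly_eq_sum_monomials:
  assumes "finite K" "Poly_Mapping.keys p \<subseteq> K"
  shows "p = (\<Sum>m\<in>K. Poly_Mapping.single m (Poly_Mapping.lookup p m))"
proof (rule poly_mapping_eqI)
  fix q
  have "Poly_Mapping.lookup (\<Sum>m\<in>K. Poly_Mapping.single m (Poly_Mapping.lookup p m)) q =
      (\<Sum>m\<in>K. if m = q then Poly_Mapping.lookup p m else 0)"
    by (simp add: lookup_sum lookup_single when_def)
  also have "\<dots> = Poly_Mapping.lookup p q"
    using assms by (auto simp: in_keys_iff)
  finally show "Poly_Mapping.lookup p q =
      Poly_Mapping.lookup (\<Sum>m\<in>K. Poly_Mapping.single m (Poly_Mapping.lookup p m)) q" by simp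
qed

lemma mult_in_polynomial_ring:
  assumes "p \<in> polynomial_ring I" "q \<in> polynomial_ring I"
  shows "p * q \<in> polynomial_ring I"
  unfolding polynomial_ring_def
proof (intro CollectI ballI)
  fix m assume "m \<in> Poly_Mapping.keys (p * q)"
  then obtain a b where "m = a + b" "a \<in> Poly_Mapping.keys p" "b \<in> Poly_Mapping.keys q"
    using keys_mult by blast
  then show "Poly_Mapping.keys m \<subseteq> I"
    using assms keys_add[of a b] unfolding polynomial_ring_def by blast
qed

lemma free_module_scale:
  "r \<in> polynomial_ring I \<Longrightarrow> v \<in> free_module I ds \<Longrightarrow> free_scale r v \<in> free_module I ds"
  unfolding free_module_def
  by (auto simp: lookup_free_scale mult_in_polynomial_ring in_keys_iff subset_iff)

lemma free_module_add:
  "u \<in> free_module I ds \<Longrightarrow> v \<in> free_module I ds \<Longrightarrow> u + v \<in> free_module I ds"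
  unfolding free_module_iff vec_coeff_add by (metis add.right_neutral)

text \<open>A step of a minimal graded resolution; the last clause says that \<open>f\<close> is homogeneous of
  degree \<open>0\<close>.\<close>

definition minimal_cover ::
  "nat set \<Rightarrow> (nat \<Rightarrow> nat) \<Rightarrow> ('a::field mpoly \<Rightarrow> 'm::ab_group_add \<Rightarrow> 'm) \<Rightarrow> (int \<Rightarrow> 'm \<Rightarrow> 'm) \<Rightarrow> 'm set
     \<Rightarrow> int list \<Rightarrow> ('a free_vec \<Rightarrow> 'm) \<Rightarrow> bool" where
  "minimal_cover I w scale proj Z ds f \<longleftrightarrow>
     module_hom_betw (polynomial_ring I) free_scale scale (free_module I ds) Z f \<and>
     f ` free_module I ds = Z \<and>
     {v \<in> free_module I ds. f v = 0} \<subseteq> irrelevant_submodule I ds \<and>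
     (\<forall>d. \<forall>v\<in>free_module I ds. f (vec_proj w ds d v) = proj d (f v))"

context graded_module
begin

lemma proj_0 [simp]: "proj d 0 = 0"
  using proj_add[of d 0 0] by simp

lemma proj_sum: "proj d (\<Sum>i\<in>A. f i) = (\<Sum>i\<in>A. proj d (f i))"
  by (induction A rule: infinite_finite_induct) (auto simp: proj_add)

lemma scale_eq_sum_monomials:
  assumes "finite K" "Poly_Mapping.keys p \<subseteq> K"
  shows "scale p v = (\<Sum>m\<in>K. scale (Poly_Mapping.single m (Poly_Mapping.lookup p m)) v)"
  by (subst poly_eq_sum_monomials[OF assms]) (simp add: scale_sum_left)

text \<open>Graded Nakayama: a maximal family of homogeneous elements that is linearly independent modulo
  \<open>\<mm>Z\<close> generates \<open>Z\<close>, by induction on degrees, and the resulting cover of \<open>Z\<close> by a free module is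
  minimal. Finiteness of \<open>Z/\<mm>Z\<close>, and not a Noetherian argument, bounds the family.\<close>

lemma minimal_cover_exists:
  assumes fin: "finite I" and w: "\<And>i. i \<in> I \<Longrightarrow> w i > 0"
    and Z: "graded_submodule scale proj I Z"
    and dim: "homology_dim scale I Z 0 b"
  shows "\<exists>ds f. minimal_cover I w scale proj Z ds f"
proof -
  let ?x = "\<lambda>i. scale (var i)"
  interpret V: variable_action "\<lambda>c. scale (const c)" ?x I
    by (rule variable_action_module[OF module_axioms fin])
  interpret C: vector_space "\<lambda>a (c :: nat set \<Rightarrow> 'm) J. scale (const a) (c J)"
    by (rule V.vector_space_chains)
  have Z0: "0 \<in> Z" and Z_add: "\<And>u v. u \<in> Z \<Longrightarrow> v \<in> Z \<Longrightarrow> u + v \<in> Z"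
    and Z_scale: "\<And>r v. r \<in> polynomial_ring I \<Longrightarrow> v \<in> Z \<Longrightarrow> scale r v \<in> Z"
    and Z_proj: "\<And>d v. v \<in> Z \<Longrightarrow> proj d v \<in> Z"
    using Z unfolding graded_submodule_def by auto
  obtain d0 where d0: "\<And>v d. v \<in> Z \<Longrightarrow> d < d0 \<Longrightarrow> proj d v = 0"
    using Z unfolding graded_submodule_def by blast
  have Z_subspace: "V.subspace Z"
    by (rule V.subspaceI) (auto simp: Z0 Z_add Z_scale const_in_polynomial_ring)
  have Z_var: "?x i v \<in> Z" if "i \<in> I" "v \<in> Z" for i v
    using that by (simp add: Z_scale var_in_polynomial_ring)
  have Z_sub: "V.submodule Z" using Z_subspace Z_var by (simp add: V.submodule_def)

  \<comment> \<open>\<open>mZ\<close> is \<open>\<mm>Z\<close>; in the Koszul complex it consists of the boundaries of degree \<open>0\<close>, and \<open>emb\<close>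
    identifies \<open>Z\<close> with the chains of degree \<open>0\<close>.\<close>
  define mZ where "mZ = {v. \<exists>z. (\<forall>i\<in>I. z i \<in> Z) \<and> v = (\<Sum>i\<in>I. ?x i (z i))}"
  define emb where "emb = (\<lambda>(v :: 'm) (J :: nat set). if J = {} then v else 0)"
  have mZ_emb: "v \<in> mZ" if bd: "emb v \<in> koszul_boundaries ?x I Z 0" for v
  proof -
    obtain c where c: "c \<in> koszul_chains I Z (Suc 0)" "emb v = koszul_diff ?x I c"
      using bd unfolding koszul_boundaries_def by blast
    have "v = koszul_diff ?x I c {}" using c(2) by (metis emb_def)
    also have "\<dots> = (\<Sum>i\<in>I. ?x i (c {i}))"
      by (simp add: koszul_diff_def koszul_sign_empty)
    finally show ?thesis
      unfolding mZ_def by (intro CollectI exI[of _ "\<lambda>i. c {i}"]) (simp add: koszul_chainsD(1)[OF c(1)])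
  qed
  have emb_mZ: "emb v \<in> koszul_boundaries ?x I Z 0" if v: "v \<in> mZ" for v
  proof -
    obtain z where z: "\<forall>i\<in>I. z i \<in> Z" "v = (\<Sum>i\<in>I. ?x i (z i))"
      using v unfolding mZ_def by blast
    define c where "c = (\<lambda>J. if J \<subseteq> I \<and> card J = 1 then z (the_elem J) else 0)"
    have c: "c \<in> koszul_chains I Z (Suc 0)"
    proof (rule koszul_chainsI)
      show "c J \<in> Z" for J
        using z(1) Z0 unfolding c_def by (auto simp: card_1_singleton_iff)
    qed (auto simp: c_def)
    have "koszul_diff ?x I c {} = v"
      by (simp add: koszul_diff_def koszul_sign_empty c_def z(2))
    moreover have "koszul_diff ?x I c J = 0" if "J \<noteq> {}" for J
    proof -
      have "\<not> (J \<subseteq> I \<and> card J = 0)" using that finite_subset[of J I] fin by auto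
      then show ?thesis using koszul_chainsD(2)[OF V.diff_chains[OF Z_sub c]] by blast
    qed
    ultimately have "koszul_diff ?x I c = emb v" by (auto simp: emb_def)
    then show ?thesis using c unfolding koszul_boundaries_def by (metis image_eqI)
  qed
  have mZ_0: "0 \<in> mZ" using Z0 unfolding mZ_def by (auto intro!: exI[of _ "\<lambda>_. 0"])
  have mZ_add: "u + v \<in> mZ" if uv: "u \<in> mZ" "v \<in> mZ" for u v
  proof -
    obtain y z where "\<forall>i\<in>I. y i \<in> Z" "u = (\<Sum>i\<in>I. ?x i (y i))" "\<forall>i\<in>I. z i \<in> Z" "v = (\<Sum>i\<in>I. ?x i (z i))"
      using uv unfolding mZ_def by blast
    then have "\<forall>i\<in>I. y i + z i \<in> Z" "u + v = (\<Sum>i\<in>I. ?x i (y i + z i))"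
      using Z_add by (auto simp: scale_right_distrib sum.distrib)
    then show ?thesis unfolding mZ_def by (intro CollectI exI[of _ "\<lambda>i. y i + z i"] conjI)
  qed
  have mZ_scale: "scale (const a) v \<in> mZ" if v: "v \<in> mZ" for a v
  proof -
    obtain z where z: "\<forall>i\<in>I. z i \<in> Z" "v = (\<Sum>i\<in>I. ?x i (z i))"
      using v unfolding mZ_def by blast
    then have "\<forall>i\<in>I. scale (const a) (z i) \<in> Z" "scale (const a) v = (\<Sum>i\<in>I. ?x i (scale (const a) (z i)))"
      using V.subspace_scale[OF Z_subspace] by (auto simp: V.scale_sum_right V.act_scale simp del: scale_scale)
    then show ?thesis unfolding mZ_def by (intro CollectI exI[of _ "\<lambda>i. scale (const a) (z i)"] conjI)
  qed
  have mZ_sum: "(\<Sum>j\<in>A. v j) \<in> mZ" if "\<And>j. j \<in> A \<Longrightarrow> v j \<in> mZ" for A and v :: "'i \<Rightarrow> 'm"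
    using that by (induction A rule: infinite_finite_induct) (auto simp: mZ_0 mZ_add)
  have mZ_var: "?x i v \<in> mZ" if i: "i \<in> I" and v: "v \<in> Z" for i v
  proof -
    have "(\<Sum>l\<in>I. ?x l (if l = i then v else 0)) = (\<Sum>l\<in>I. if l = i then ?x i v else 0)"
      by (rule sum.cong) auto
    then have "?x i v = (\<Sum>l\<in>I. ?x l (if l = i then v else 0))" using i fin by simp
    then show ?thesis
      using v Z0 unfolding mZ_def by (intro CollectI exI[of _ "\<lambda>l. if l = i then v else 0"]) simp
  qed

  \<comment> \<open>Homogeneous families that are linearly independent modulo \<open>\<mm>Z\<close> have at most \<open>b\<close> members; \<open>g\<close> is
    one with as many members as possible.\<close>
  define P where "P N \<longleftrightarrow> (\<exists>g ds. (\<forall>j<N. g j \<in> Z \<and> proj (ds j) (g j) = g j) \<and>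
      (\<forall>c. (\<Sum>j<N. scale (const (c j)) (g j)) \<in> mZ \<longrightarrow> (\<forall>j<N. c j = 0)))" for N :: nat
  have P_le: "N \<le> b" if PN: "P N" for N
  proof -
    obtain g ds where g: "\<And>j. j < N \<Longrightarrow> g j \<in> Z"
      and ind: "\<And>c. (\<Sum>j<N. scale (const (c j)) (g j)) \<in> mZ \<Longrightarrow> \<forall>j<N. c j = 0"
      using PN unfolding P_def by blast
    have "card {..<N} \<le> b"
    proof (rule C.qdim_independent_card_le[where v = "\<lambda>j. emb (g j)"])
      show "C.subspace (koszul_cycles ?x I Z 0)" by (rule V.subspace_cycles[OF Z_subspace])
      show "quotient_dim (\<lambda>a c J. scale (const a) (c J)) (koszul_cycles ?x I Z 0) (koszul_boundaries ?x I Z 0) b"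
        using dim by (simp add: koszul_homology_dim_def)
      show "emb (g j) \<in> koszul_cycles ?x I Z 0" if "j \<in> {..<N}" for j
        using g that Z0 unfolding V.cycles_0 by (intro koszul_chainsI) (auto simp: emb_def)
      fix c assume *: "(\<Sum>j<N. (\<lambda>J. scale (const (c j)) (emb (g j) J))) \<in> koszul_boundaries ?x I Z 0"
      have "(\<Sum>j<N. (\<lambda>J. scale (const (c j)) (emb (g j) J))) = emb (\<Sum>j<N. scale (const (c j)) (g j))"
        by (rule ext) (simp add: emb_def sum_fun_apply)
      then show "\<forall>j\<in>{..<N}. c j = 0" using * mZ_emb ind by auto
    qed simp
    then show ?thesis by simp
  qed
  have "P 0" by (simp add: P_def)
  moreover have "\<not> P (Suc b)" using P_le by fastforce
  ultimately obtain N where N: "P N" "\<not> P (Suc N)"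
    using inc_induct[of 0 "Suc b" "\<lambda>n. \<not> P n"] by (metis le0)
  obtain g ds where gZ: "\<And>j. j < N \<Longrightarrow> g j \<in> Z" and g_deg: "\<And>j. j < N \<Longrightarrow> proj (ds j) (g j) = g j"
    and ind: "\<And>c. (\<Sum>j<N. scale (const (c j)) (g j)) \<in> mZ \<Longrightarrow> \<forall>j<N. c j = 0"
    using N(1) unfolding P_def by blast

  have span: "\<exists>c. z - (\<Sum>j<N. scale (const (c j)) (g j)) \<in> mZ" if z: "z \<in> Z" "proj d z = z" for z d
  proof (rule ccontr)
    assume no: "\<nexists>c. z - (\<Sum>j<N. scale (const (c j)) (g j)) \<in> mZ"
    have "P (Suc N)" unfolding P_def
    proof (intro exI[of _ "g(N := z)"] exI[of _ "ds(N := d)"] conjI allI impI)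
      fix c j
      assume c: "(\<Sum>j<Suc N. scale (const (c j)) ((g(N := z)) j)) \<in> mZ" and j: "j < Suc N"
      have eq: "(\<Sum>j<Suc N. scale (const (c j)) ((g(N := z)) j)) =
          (\<Sum>j<N. scale (const (c j)) (g j)) + scale (const (c N)) z"
        by simp
      have cN: "c N = 0"
      proof (rule ccontr)
        assume "c N \<noteq> 0"
        define a where "a = inverse (c N)"
        have "z - (\<Sum>j<N. scale (const (- (a * c j))) (g j)) =
            scale (const a) ((\<Sum>j<N. scale (const (c j)) (g j)) + scale (const (c N)) z)"
          using \<open>c N \<noteq> 0\<close>
          by (simp add: scale_right_distrib V.scale_sum_right a_def single_uminus sum_negf mult_single)
        also have "\<dots> \<in> mZ" using mZ_scale c unfolding eq by blast
        finally have "\<exists>c. z - (\<Sum>j<N. scale (const (c j)) (g j)) \<in> mZ"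
          by (rule exI[of _ "\<lambda>j. - (a * c j)"])
        with no show False by contradiction
      qed
      then have "(\<Sum>j<N. scale (const (c j)) (g j)) \<in> mZ" using c unfolding eq by simp
      then have "\<forall>j<N. c j = 0" by (rule ind)
      then show "c j = 0" using cN j by (auto simp: less_Suc_eq)
    qed (use z gZ g_deg in \<open>auto simp: less_Suc_eq\<close>)
    then show False using N(2) by blast
  qed

  define dl where "dl = map ds [0..<N]"
  have len: "length dl = N" by (simp add: dl_def)
  let ?F = "free_module I dl"
  define f where "f v = (\<Sum>j<N. scale (Poly_Mapping.lookup v j) (g j))" for v :: "'a free_vec"
  have f_add: "f (u + v) = f u + f v" for u v
    by (simp add: f_def lookup_add scale_left_distrib sum.distrib)
  have f_scale: "f (free_scale r v) = scale r (f v)" for r v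
    by (simp add: f_def lookup_free_scale scale_sum_right)
  have f_gen: "f (Poly_Mapping.single j 1) = g j" if "j < N" for j
  proof -
    have "f (Poly_Mapping.single j 1) = (\<Sum>l<N. if l = j then g j else 0)"
      unfolding f_def by (rule sum.cong) (auto simp: lookup_single when_def)
    then show ?thesis using that by simp
  qed
  have f_0: "f 0 = 0" by (simp add: f_def)
  have gen_F: "Poly_Mapping.single j 1 \<in> ?F" if "j < N" for j
    using that by (auto simp: free_module_iff len vec_coeff_def lookup_single when_def lookup_one)
  have F_ring: "Poly_Mapping.lookup v j \<in> polynomial_ring I" if "v \<in> ?F" for v j
    using that by (simp add: free_module_def)
  have f_Z: "f v \<in> Z" if "v \<in> ?F" for v
    unfolding f_def
    by (intro V.subspace_sum[OF Z_subspace] Z_scale F_ring[OF that]) (simp add: gZ)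
  have f_proj: "f (vec_proj w dl d v) = proj d (f v)" for d v
  proof -
    have "scale (Poly_Mapping.lookup (vec_proj w dl d v) j) (g j) = proj d (scale (Poly_Mapping.lookup v j) (g j))"
      if j: "j < N" for j
    proof -
      let ?p = "Poly_Mapping.lookup v j" and ?q = "Poly_Mapping.lookup (vec_proj w dl d v) j"
      have q: "Poly_Mapping.lookup ?q m = (if int (weighted_degree w m) + ds j = d then Poly_Mapping.lookup ?p m else 0)" for m
        using vec_coeff_proj[of w dl d v j m] j by (simp add: vec_coeff_def len) (simp add: dl_def)
      have "Poly_Mapping.keys ?q \<subseteq> Poly_Mapping.keys ?p" by (auto simp: in_keys_iff q split: if_splits)
      then have "scale ?q (g j) = (\<Sum>m\<in>Poly_Mapping.keys ?p. scale (Poly_Mapping.single m (Poly_Mapping.lookup ?q m)) (g j))"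
        by (intro scale_eq_sum_monomials) auto
      also have "\<dots> = (\<Sum>m\<in>Poly_Mapping.keys ?p. proj d (scale (Poly_Mapping.single m (Poly_Mapping.lookup ?p m)) (g j)))"
      proof (rule sum.cong)
        fix m
        have "proj (d - int (weighted_degree w m)) (g j) = (if int (weighted_degree w m) + ds j = d then g j else 0)"
          using g_deg[OF j] proj_proj[of "d - int (weighted_degree w m)" "ds j" "g j"] by auto
        then show "scale (Poly_Mapping.single m (Poly_Mapping.lookup ?q m)) (g j) =
            proj d (scale (Poly_Mapping.single m (Poly_Mapping.lookup ?p m)) (g j))"
          by (simp add: proj_monomial q)
      qed simp
      also have "\<dots> = proj d (scale ?p (g j))"
        by (subst scale_eq_sum_monomials[of "Poly_Mapping.keys ?p" ?p "g j"]) (simp_all add: proj_sum)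
      finally show ?thesis .
    qed
    then show ?thesis unfolding f_def by (simp add: proj_sum)
  qed

  have im_add: "u + v \<in> f ` ?F" if "u \<in> f ` ?F" "v \<in> f ` ?F" for u v
    using that by (auto simp flip: f_add intro!: imageI free_module_add)
  have im_scale: "scale r v \<in> f ` ?F" if "r \<in> polynomial_ring I" "v \<in> f ` ?F" for r v
    using that by (auto simp flip: f_scale intro!: imageI free_module_scale)
  have im_0: "0 \<in> f ` ?F"
    using f_0 V.module_axioms by (intro image_eqI[of _ _ 0]) (auto simp: free_module_iff)
  have im_sum: "(\<Sum>i\<in>A. v i) \<in> f ` ?F" if "\<And>i. i \<in> A \<Longrightarrow> v i \<in> f ` ?F" for A and v :: "'i \<Rightarrow> 'm"
    using that by (induction A rule: infinite_finite_induct) (auto simp: im_0 im_add)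
  \<comment> \<open>Graded Nakayama: the coefficients \<open>y i\<close> of a homogeneous element of \<open>\<mm>Z\<close> can be taken of smaller
    degree, since the variables have positive degree.\<close>
  have gen: "z \<in> f ` ?F" if "z \<in> Z" "proj d z = z" "d < d0 + int n" for n d z
    using that
  proof (induction n arbitrary: d z)
    case 0
    then have "z = 0" using d0 by fastforce
    then show ?case using im_0 by simp
  next
    case (Suc n)
    obtain c where "z - (\<Sum>j<N. scale (const (c j)) (g j)) \<in> mZ" using span Suc.prems by blast
    then obtain y where y: "\<forall>i\<in>I. y i \<in> Z"
      "z - (\<Sum>j<N. scale (const (c j)) (g j)) = (\<Sum>i\<in>I. ?x i (y i))" unfolding mZ_def by blast
    have "z = proj d ((\<Sum>j<N. scale (const (c j)) (g j)) + (\<Sum>i\<in>I. ?x i (y i)))"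
      using Suc.prems(2) by (simp flip: y(2))
    also have "\<dots> = (\<Sum>j<N. scale (const (c j)) (proj d (g j))) + (\<Sum>i\<in>I. ?x i (proj (d - int (w i)) (y i)))"
      unfolding var_def by (simp add: proj_add proj_sum proj_monomial del: One_nat_def)
    also have "\<dots> \<in> f ` ?F"
    proof (intro im_add im_sum im_scale)
      fix j assume "j \<in> {..<N}"
      then have j: "j < N" by simp
      have "proj d (g j) = (if d = ds j then g j else 0)"
        using proj_proj[of d "ds j" "g j"] g_deg[OF j] by (cases "d = ds j") simp_all
      then show "proj d (g j) \<in> f ` ?F" using im_0 f_gen[OF j] gen_F[OF j] by (metis image_eqI)
    next
      fix i assume i: "i \<in> I"
      show "proj (d - int (w i)) (y i) \<in> f ` ?F"
      proof (rule Suc.IH)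
        show "d - int (w i) < d0 + int n" using Suc.prems(3) w[OF i] by simp
      qed (use Z_proj y(1) i proj_proj in auto)
    qed (auto simp: const_in_polynomial_ring var_in_polynomial_ring)
    finally show ?case .
  qed
  have "f ` ?F = Z"
  proof (intro equalityI subsetI)
    fix z assume z: "z \<in> Z"
    have "proj d z \<in> f ` ?F" for d
      using gen[of "proj d z" d "nat (d - d0 + 1)"] Z_proj[OF z] proj_proj by auto
    then show "z \<in> f ` ?F" by (subst sum_proj[symmetric]) (auto intro: im_sum)
  qed (use f_Z in auto)
  moreover have "v \<in> irrelevant_submodule I dl" if v: "v \<in> ?F" "f v = 0" for v
  proof -
    \<comment> \<open>Modulo \<open>\<mm>Z\<close>, a relation between the generators involves only the constant terms of its
      coefficients.\<close>
    have split: "scale (Poly_Mapping.lookup v j) (g j) - scale (const (vec_coeff v j 0)) (g j) \<in> mZ"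
      if j: "j < N" for j
    proof -
      let ?p = "Poly_Mapping.lookup v j"
      let ?K = "insert 0 (Poly_Mapping.keys ?p)"
      have "scale ?p (g j) = (\<Sum>m\<in>?K. scale (Poly_Mapping.single m (Poly_Mapping.lookup ?p m)) (g j))"
        by (rule scale_eq_sum_monomials) auto
      also have "\<dots> = scale (const (vec_coeff v j 0)) (g j) +
          (\<Sum>m\<in>Poly_Mapping.keys ?p - {0}. scale (Poly_Mapping.single m (Poly_Mapping.lookup ?p m)) (g j))"
        by (subst sum.insert_remove) (auto simp: vec_coeff_def)
      finally have "scale ?p (g j) - scale (const (vec_coeff v j 0)) (g j) =
          (\<Sum>m\<in>Poly_Mapping.keys ?p - {0}. scale (Poly_Mapping.single m (Poly_Mapping.lookup ?p m)) (g j))"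
        by simp
      also have "\<dots> \<in> mZ"
      proof (rule mZ_sum)
        fix m assume m: "m \<in> Poly_Mapping.keys ?p - {0}"
        then have mI: "Poly_Mapping.keys m \<subseteq> I" using F_ring[OF v(1)] by (auto simp: polynomial_ring_def)
        have "Poly_Mapping.keys m \<noteq> {}" using m by simp
        then obtain i where i: "i \<in> Poly_Mapping.keys m" by blast
        let ?m = "m - Poly_Mapping.single i 1"
        have "Poly_Mapping.single m (Poly_Mapping.lookup ?p m) = var i * Poly_Mapping.single ?m (Poly_Mapping.lookup ?p m)"
          unfolding var_def mult_single minus_single_add[OF i] by simp
        moreover have "Poly_Mapping.single ?m (Poly_Mapping.lookup ?p m) \<in> polynomial_ring I"
          using mI by (auto simp: polynomial_ring_def in_keys_iff lookup_minus subset_iff)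
        ultimately show "scale (Poly_Mapping.single m (Poly_Mapping.lookup ?p m)) (g j) \<in> mZ"
          using mZ_var[of i "scale (Poly_Mapping.single ?m (Poly_Mapping.lookup ?p m)) (g j)"] i mI gZ[OF j]
          by (auto simp: Z_scale)
      qed
      finally show ?thesis .
    qed
    have "(\<Sum>j<N. scale (Poly_Mapping.lookup v j) (g j) - scale (const (vec_coeff v j 0)) (g j)) \<in> mZ"
      by (rule mZ_sum) (use split in simp)
    then have "- (\<Sum>j<N. scale (const (vec_coeff v j 0)) (g j)) \<in> mZ"
      using v(2) by (simp add: sum_subtractf f_def)
    then have "(\<Sum>j<N. scale (const (vec_coeff v j 0)) (g j)) \<in> mZ"
      using mZ_scale[of _ "-1"] by (fastforce simp: single_uminus)
    then have "\<forall>j<N. vec_coeff v j 0 = 0" by (rule ind)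
    then have "vec_coeff v j 0 = 0" for j using v(1) unfolding free_module_iff len by blast
    then show ?thesis using v(1) by (simp add: irrelevant_submodule_iff)
  qed
  ultimately have "minimal_cover I w scale proj Z dl f"
    unfolding minimal_cover_def module_hom_betw_def using f_add f_scale f_proj by auto
  then show ?thesis by blast
qed

end

lemma minimal_cover_kernel_graded:
  fixes scale :: "'a::field mpoly \<Rightarrow> 'm::ab_group_add \<Rightarrow> 'm"
  assumes "graded_module scale w proj" and cov: "minimal_cover I w scale proj Z ds f"
  shows "graded_submodule free_scale (vec_proj w ds) I {v \<in> free_module I ds. f v = 0}"
proof -
  interpret graded_module scale w proj by fact
  have hom: "\<And>u v. u \<in> free_module I ds \<Longrightarrow> v \<in> free_module I ds \<Longrightarrow> f (u + v) = f u + f v"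
    "\<And>r v. r \<in> polynomial_ring I \<Longrightarrow> v \<in> free_module I ds \<Longrightarrow> f (free_scale r v) = scale r (f v)"
    and pr: "\<And>d v. v \<in> free_module I ds \<Longrightarrow> f (vec_proj w ds d v) = proj d (f v)"
    using cov unfolding minimal_cover_def module_hom_betw_def by blast+
  have zero: "0 \<in> free_module I ds" by (simp add: free_module_iff)
  have "f 0 = 0" using hom(1)[OF zero zero] by simp
  moreover have "vec_proj w ds d v \<in> free_module I ds" if "v \<in> free_module I ds" for d v
    using that unfolding free_module_iff vec_coeff_proj by auto
  moreover have "\<exists>d0. \<forall>v\<in>free_module I ds. \<forall>d<d0. vec_proj w ds d v = 0"
  proof (intro exI ballI allI impI)
    fix v d assume v: "v \<in> free_module I ds" and d: "d < Min (insert 0 (set ds))"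
    show "vec_proj w ds d v = 0"
    proof (rule vec_eqI)
      fix j m
      have "d < ds ! j" if "j < length ds"
        using d Min_le[of "insert 0 (set ds)" "ds ! j"] that by simp
      then show "vec_coeff (vec_proj w ds d v) j m = vec_coeff 0 j m"
        using v unfolding free_module_iff vec_coeff_proj
        by (cases "vec_coeff v j m = 0"; cases "j < length ds") auto
    qed
  qed
  then have "\<exists>d0. \<forall>v\<in>{v \<in> free_module I ds. f v = 0}. \<forall>d<d0. vec_proj w ds d v = 0" by blast
  ultimately show ?thesis
    unfolding graded_submodule_def
    by (intro conjI) (auto simp: zero hom pr free_module_add free_module_scale)
qed

text \<open>Every kernel is again a graded module, it lies in \<open>\<mm>F\<close>, and dimension shifting makes its Koszul
  homology finite-dimensional. So it has a minimal cover in turn, and the resolution is obtained by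
  dependent choice.\<close>

theorem minimal_resolution_exists:
  fixes scale :: "'a::field mpoly \<Rightarrow> 'm::ab_group_add \<Rightarrow> 'm"
  assumes gr: "graded_module scale w proj" and fin: "finite I" and w: "\<And>i. i \<in> I \<Longrightarrow> w i > 0"
    and M: "graded_submodule scale proj I M"
    and piece: "\<And>d. piece d = {v \<in> M. proj d v = v}"
    and dim: "\<And>i. \<exists>b. homology_dim scale I M i b"
  shows "\<exists>sh \<delta> \<epsilon>. minimal_graded_free_resolution I w scale M piece sh \<delta> \<epsilon>"
proof -
  interpret graded_module scale w proj by fact
  obtain ds0 \<epsilon> where \<epsilon>: "minimal_cover I w scale proj M ds0 \<epsilon>"
    using minimal_cover_exists[OF fin w M] dim[of 0] by blast
  define ker where "ker = (\<lambda>ds (f :: 'a free_vec \<Rightarrow> 'a free_vec). {v \<in> free_module I ds. f v = 0})"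
  define Z0 where "Z0 = {v \<in> free_module I ds0. \<epsilon> v = 0}"
  define P where "P t s \<longleftrightarrow> (case s of (ds, f :: 'a free_vec \<Rightarrow> 'a free_vec, Z) \<Rightarrow>
      (t = 0 \<longrightarrow> ds = ds0 \<and> Z = Z0) \<and> graded_submodule free_scale (vec_proj w ds) I Z \<and>
      Z \<subseteq> irrelevant_submodule I ds \<and> (\<forall>i. \<exists>b. homology_dim free_scale I Z i b))" for t :: nat and s
  define Q where "Q s s' \<longleftrightarrow> (case s of (ds, _, Z) \<Rightarrow> case s' of (ds', f', Z') \<Rightarrow>
      minimal_cover I w free_scale (vec_proj w ds) Z ds' f' \<and> Z' = ker ds' f')"
    for s s' :: "int list \<times> ('a free_vec \<Rightarrow> 'a free_vec) \<times> 'a free_vec set"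
  have "\<exists>s. \<forall>t. P t (s t) \<and> Q (s t) (s (Suc t))"
  proof (rule dependent_nat_choice)
    have "\<exists>b. homology_dim free_scale I Z0 i b" for i
    proof -
      have "acyclic_cover (\<lambda>c. free_scale (const c)) free_act (\<lambda>c. scale (const c)) (\<lambda>i. scale (var i)) I
          (free_module I ds0) M Z0 \<epsilon>"
        unfolding Z0_def using \<epsilon>
        by (intro acyclic_coverI[OF module_axioms fin]) (auto simp: minimal_cover_def)
      then show ?thesis using acyclic_cover.dimension_shift dim[of "Suc i"] by blast
    qed
    then show "\<exists>s. P 0 s"
      using minimal_cover_kernel_graded[OF gr \<epsilon>] \<epsilon>
      unfolding P_def Z0_def minimal_cover_def by auto
  next
    fix s t assume Ps: "P t s"
    obtain ds f Z where s: "s = (ds, f, Z)" by (cases s) auto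
    interpret G: graded_module free_scale w "vec_proj w ds" by (rule graded_module_free)
    have Z: "graded_submodule free_scale (vec_proj w ds) I Z" "\<And>i. \<exists>b. homology_dim free_scale I Z i b"
      using Ps unfolding P_def s by auto
    obtain ds' f' where f': "minimal_cover I w free_scale (vec_proj w ds) Z ds' f'"
      using G.minimal_cover_exists[OF fin w Z(1)] Z(2)[of 0] by blast
    have "\<exists>b. homology_dim free_scale I (ker ds' f') i b" for i
    proof -
      have "acyclic_cover (\<lambda>c. free_scale (const c)) free_act (\<lambda>c. free_scale (const c)) free_act I
          (free_module I ds') Z (ker ds' f') f'"
        unfolding ker_def using f'
        by (intro acyclic_coverI[OF module_free_scale fin]) (auto simp: minimal_cover_def)
      then show ?thesis using acyclic_cover.dimension_shift Z(2)[of "Suc i"] by blast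
    qed
    then have "P (Suc t) (ds', f', ker ds' f')"
      using minimal_cover_kernel_graded[OF graded_module_free f'] f'
      unfolding P_def ker_def minimal_cover_def by auto
    moreover have "Q s (ds', f', ker ds' f')" using f' by (simp add: Q_def s)
    ultimately show "\<exists>s'. P (Suc t) s' \<and> Q s s'" by blast
  qed
  then obtain s where s: "\<And>t. P t (s t)" "\<And>t. Q (s t) (s (Suc t))" by blast
  define sh where "sh t = fst (s t)" for t
  define \<delta> where "\<delta> t = fst (snd (s (Suc t)))" for t
  define Z where "Z t = snd (snd (s t))" for t
  have sh0: "sh 0 = ds0" "Z 0 = Z0" 
    using s(1)[of 0] by (auto simp: P_def case_prod_unfold sh_def Z_def)
  have cov: "minimal_cover I w free_scale (vec_proj w (sh t)) (Z t) (sh (Suc t)) (\<delta> t)"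
    and Z_Suc: "Z (Suc t) = {v \<in> free_module I (sh (Suc t)). \<delta> t v = 0}" for t
    using s(2)[of t] by (auto simp: Q_def ker_def \<delta>_def case_prod_unfold sh_def Z_def)
  have Z_irr: "Z t \<subseteq> irrelevant_submodule I (sh t)" for t
    using s(1)[of t] by (auto simp: P_def case_prod_unfold sh_def Z_def)
  then have Z_free: "Z t \<subseteq> free_module I (sh t)" for t
    by (auto simp: irrelevant_submodule_def)
  have im: "\<delta> t ` free_module I (sh (Suc t)) = Z t" for t
    using cov[of t] by (simp add: minimal_cover_def)
  have hom: "module_hom_betw (polynomial_ring I) free_scale free_scale
      (free_module I (sh (Suc t))) (free_module I (sh t)) (\<delta> t)" for t
    using cov[of t] Z_free[of t] unfolding minimal_cover_def module_hom_betw_def by auto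
  have deg: "\<delta> t ` free_module_piece I w (sh (Suc t)) d \<subseteq> free_module_piece I w (sh t) d" for t d
    using cov[of t] im[of t] Z_free[of t] unfolding minimal_cover_def free_module_piece_eq
    by (auto; metis)
  have "graded_free_resolution I w scale M piece sh \<delta> \<epsilon>"
    unfolding graded_free_resolution_def
  proof (intro conjI allI)
    show "\<epsilon> ` free_module_piece I w (sh 0) d \<subseteq> piece d" for d
      using \<epsilon> unfolding sh0 minimal_cover_def free_module_piece_eq piece by (auto; metis)
    show "\<delta> 0 ` free_module I (sh 1) = {v \<in> free_module I (sh 0). \<epsilon> v = 0}"
      using im[of 0] sh0 by (simp add: Z0_def)
    show "\<delta> (Suc t) ` free_module I (sh (Suc (Suc t))) = {v \<in> free_module I (sh (Suc t)). \<delta> t v = 0}" for t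
      using im[of "Suc t"] Z_Suc by simp
  qed (use \<epsilon> hom deg in \<open>auto simp: sh0 minimal_cover_def\<close>)
  then have "minimal_graded_free_resolution I w scale M piece sh \<delta> \<epsilon>"
    unfolding minimal_graded_free_resolution_def using im Z_irr by simp
  then show ?thesis by blast
qed

corollary has_betti_numberI:
  fixes scale :: "'a::field mpoly \<Rightarrow> 'm::ab_group_add \<Rightarrow> 'm"
  assumes "graded_module scale w proj" "finite I" "\<And>i. i \<in> I \<Longrightarrow> w i > 0"
    "graded_submodule scale proj I M" "\<And>d. piece d = {v \<in> M. proj d v = v}"
    and dim: "\<And>i. homology_dim scale I M i (\<beta> i)"
  shows "has_betti_number I w scale M piece t (\<beta> t)"
  unfolding has_betti_number_def
proof (intro conjI allI impI)
  show "\<exists>sh \<delta> \<epsilon>. minimal_graded_free_resolution I w scale M piece sh \<delta> \<epsilon>"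
    using minimal_resolution_exists[OF assms(1-5)] dim by blast
  show "length (sh t) = \<beta> t" if "minimal_graded_free_resolution I w scale M piece sh \<delta> \<epsilon>" for sh \<delta> \<epsilon>
    using minimal_resolution_rank[OF graded_module.axioms(1)[OF assms(1)] assms(2) that dim] .
qed

section \<open>Reduction modulo a nonzerodivisor\<close>

text \<open>The complex for \<open>insert p I\<close> is the mapping cone of multiplication by \<open>X\<^sub>p\<close> on the complex for
  \<open>I\<close>; \<open>p\<close> is the smallest variable, so it enters with fixed signs.\<close>

lemma koszul_diff_cone:
  assumes "finite I" "\<And>i. i \<in> I \<Longrightarrow> p < i" "J \<subseteq> I"
  shows "koszul_diff x (insert p I) c J = x p (c (insert p J)) + koszul_diff x I c J"
    and "koszul_diff x (insert p I) c (insert p J) = - koszul_diff x I (\<lambda>K. c (insert p K)) J"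
proof -
  have fin: "finite J" "p \<notin> I" "p \<notin> J" using assms finite_subset by auto
  have "insert p I - J = insert p (I - J)" using fin by auto
  moreover have "koszul_sign p J v = v" for v :: 'a
    using assms(2,3) by (intro koszul_sign_least) force
  ultimately show "koszul_diff x (insert p I) c J = x p (c (insert p J)) + koszul_diff x I c J"
    using assms fin by (auto simp: koszul_diff_def)
  have "insert p I - insert p J = I - J" using fin by auto
  moreover have "koszul_sign j (insert p J) (x j (c (insert j (insert p J)))) =
      - koszul_sign j J (x j (c (insert p (insert j J))))" if "j \<in> I - J" for j
    using that assms(2)[of j] fin by (simp add: koszul_sign_insert insert_commute)
  moreover have "insert p J \<subseteq> insert p I" using assms(3) by blast
  ultimately show "koszul_diff x (insert p I) c (insert p J) = - koszul_diff x I (\<lambda>K. c (insert p K)) J"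
    using assms(3) by (simp add: koszul_diff_def sum_negf)
qed

text \<open>If \<open>X\<^sub>p\<close> is injective on \<open>M\<close>, then \<open>M\<close> has the same Koszul homology with respect to
  \<open>insert p I\<close> as \<open>A = M/X\<^sub>pM\<close> has with respect to \<open>I\<close>.\<close>

locale nonzerodivisor_reduction =
  M: variable_action sc x I + A: variable_action scA xA I
  for sc :: "'a::field \<Rightarrow> 'm::ab_group_add \<Rightarrow> 'm" and x
    and scA :: "'a \<Rightarrow> 'n::ab_group_add \<Rightarrow> 'n" and xA and I +
  fixes M A \<pi> p
  assumes p_less: "i \<in> I \<Longrightarrow> p < i"
    and p_commute: "i \<in> I \<Longrightarrow> x p (x i v) = x i (x p v)"
    and M_sub: "M.submodule M"
    and M_p: "v \<in> M \<Longrightarrow> x p v \<in> M"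
    and \<pi>_add: "u \<in> M \<Longrightarrow> v \<in> M \<Longrightarrow> \<pi> (u + v) = \<pi> u + \<pi> v"
    and \<pi>_scale: "v \<in> M \<Longrightarrow> \<pi> (sc a v) = scA a (\<pi> v)"
    and \<pi>_act: "i \<in> I \<Longrightarrow> v \<in> M \<Longrightarrow> \<pi> (x i v) = xA i (\<pi> v)"
    and \<pi>_onto: "\<pi> ` M = A"
    and \<pi>_ker: "v \<in> M \<Longrightarrow> \<pi> v = 0 \<longleftrightarrow> (\<exists>u\<in>M. v = x p u)"
    and p_inj: "v \<in> M \<Longrightarrow> x p v = 0 \<Longrightarrow> v = 0"
begin

lemma M_subspace: "M.subspace M"
  using M_sub by (simp add: M.submodule_def)

lemma M_0: "0 \<in> M"
  by (rule M.subspace_0[OF M_subspace])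

lemma \<pi>_0: "\<pi> 0 = 0"
  using \<pi>_scale[OF M_0, of 0] by simp

lemma \<pi>_p: "v \<in> M \<Longrightarrow> \<pi> (x p v) = 0"
  using \<pi>_ker[OF M_p] by blast

lemma \<pi>_diff: "u \<in> M \<Longrightarrow> v \<in> M \<Longrightarrow> \<pi> (u - v) = \<pi> u - \<pi> v"
  using \<pi>_add[of u "sc (-1) v"] \<pi>_scale[of v "-1"] M.subspace_neg[OF M_subspace] by simp

lemma \<pi>_sign: "v \<in> M \<Longrightarrow> \<pi> (koszul_sign j J v) = koszul_sign j J (\<pi> v)"
  using \<pi>_scale[of v "-1"] by (simp add: koszul_sign_def)

lemma \<pi>_sum: "(\<And>j. j \<in> B \<Longrightarrow> g j \<in> M) \<Longrightarrow> \<pi> (\<Sum>j\<in>B. g j) = (\<Sum>j\<in>B. \<pi> (g j))"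
proof (induction B rule: infinite_finite_induct)
  case (insert a B)
  then show ?case by (simp add: \<pi>_add M.subspace_sum[OF M_subspace])
qed (auto simp: \<pi>_0)

lemma \<pi>_koszul_diff:
  assumes "\<And>J. b J \<in> M"
  shows "\<pi> (koszul_diff x I b J) = koszul_diff xA I (\<lambda>J. \<pi> (b J)) J"
proof -
  have mem: "x j (b J') \<in> M" if "j \<in> I" for j J' using M_sub assms that by (simp add: M.submodule_def)
  have "\<pi> (\<Sum>j\<in>I - J. koszul_sign j J (x j (b (insert j J)))) =
     (\<Sum>j\<in>I - J. \<pi> (koszul_sign j J (x j (b (insert j J)))))"
    by (rule \<pi>_sum) (auto intro!: M.subspace_sign[OF M_subspace] mem)
  also have "\<dots> = (\<Sum>j\<in>I - J. koszul_sign j J (xA j (\<pi> (b (insert j J)))))"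
    by (intro sum.cong) (auto simp: \<pi>_sign mem \<pi>_act assms)
  finally show ?thesis by (simp add: koszul_diff_def \<pi>_0)
qed

lemma x_p_koszul_diff:
  "x p (koszul_diff x I u J) = koszul_diff x I (\<lambda>J. x p (u J)) J"
  unfolding koszul_diff_def by (auto simp: M.act_sum M.act_sign p_commute intro!: sum.cong)

lemma A_subspace: "A.subspace A"
proof (rule A.subspaceI)
  show "0 \<in> A" using \<pi>_0 M_0 \<pi>_onto by force
  show "u + v \<in> A" if "u \<in> A" "v \<in> A" for u v
    using that M.subspace_add[OF M_subspace] unfolding \<pi>_onto[symmetric] by (auto simp flip: \<pi>_add)
  show "scA a v \<in> A" if "v \<in> A" for a v
    using that M.subspace_scale[OF M_subspace] unfolding \<pi>_onto[symmetric] by (auto simp flip: \<pi>_scale)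
qed

lemma variable_action_insert: "variable_action sc x (insert p I)"
  by unfold_locales (use M.finite_vars p_commute M.act_add M.act_scale M.act_commute in auto)

lemma lift_chain:
  assumes "a \<in> koszul_chains I A i"
  obtains c where "c \<in> koszul_chains I M i" "\<And>J. \<pi> (c J) = a J"
proof -
  have "\<exists>v\<in>M. \<pi> v = a J \<and> (a J = 0 \<longrightarrow> v = 0)" for J
  proof (cases "a J = 0")
    case True
    then show ?thesis using \<pi>_0 M_0 by auto
  next
    case False
    then show ?thesis using \<pi>_onto koszul_chainsD(1)[OF assms, of J] by auto
  qed
  then obtain c where c: "\<And>J. c J \<in> M \<and> \<pi> (c J) = a J \<and> (a J = 0 \<longrightarrow> c J = 0)" by metis
  then have "c \<in> koszul_chains I M i" using koszul_chainsD(2)[OF assms] by (intro koszul_chainsI) auto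
  then show thesis using that c by blast
qed

definition cone_chain :: "(nat set \<Rightarrow> 'm) \<Rightarrow> (nat set \<Rightarrow> 'm) \<Rightarrow> nat set \<Rightarrow> 'm" where
  "cone_chain c u J = (if p \<in> J then u (J - {p}) else c J)"

lemma p_notin: "J \<subseteq> I \<Longrightarrow> p \<notin> J"
  using p_less by auto

lemma cone_chain_simps:
  "J \<subseteq> I \<Longrightarrow> cone_chain c u J = c J" "J \<subseteq> I \<Longrightarrow> cone_chain c u (insert p J) = u J"
  using p_notin by (auto simp: cone_chain_def)

lemma cone_chain_chains:
  assumes "c \<in> koszul_chains I M i" "\<And>J. u J \<in> M" "\<And>J. u J \<noteq> 0 \<Longrightarrow> J \<subseteq> I \<and> Suc (card J) = i"
  shows "cone_chain c u \<in> koszul_chains (insert p I) M i"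
proof (rule koszul_chainsI)
  show "cone_chain c u J \<in> M" for J
    using koszul_chainsD(1)[OF assms(1)] assms(2) by (simp add: cone_chain_def)
  fix J assume J: "\<not> (J \<subseteq> insert p I \<and> card J = i)"
  show "cone_chain c u J = 0"
  proof (cases "p \<in> J")
    case True
    show ?thesis
    proof (rule ccontr)
      assume "cone_chain c u J \<noteq> 0"
      then have *: "J - {p} \<subseteq> I" "Suc (card (J - {p})) = i"
        using assms(3)[of "J - {p}"] True by (simp_all add: cone_chain_def)
      then have "finite J" using M.finite_vars finite_subset by fastforce
      then have "card J = i" using * True by (metis card_Suc_Diff1)
      then show False using J * by auto
    qed
  next
    case False
    then show ?thesis using J koszul_chainsD(2)[OF assms(1)] by (auto simp: cone_chain_def)
  qed
qed

lemma koszul_diff_cone_chain: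
  assumes "J \<subseteq> I"
  shows "koszul_diff x (insert p I) (cone_chain c u) J = x p (u J) + koszul_diff x I c J"
    and "koszul_diff x (insert p I) (cone_chain c u) (insert p J) = - koszul_diff x I u J"
  using koszul_diff_cone[OF M.finite_vars p_less assms, of x "cone_chain c u"]
    koszul_diff_cong[of I "cone_chain c u" c] koszul_diff_cong[of I "\<lambda>K. cone_chain c u (insert p K)" u]
  by (simp_all add: cone_chain_simps assms)

lemma subset_insert_cases:
  assumes "J \<subseteq> insert p I"
  obtains "J \<subseteq> I" | K where "K \<subseteq> I" "J = insert p K"
proof (cases "p \<in> J")
  case True
  then show thesis using that(2)[of "J - {p}"] assms by auto
next
  case False
  then show thesis using that(1) assms by auto
qed

lemma diff_nonzero_card:
  assumes "c \<in> koszul_chains I M i" "koszul_diff x I c J \<noteq> 0"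
  shows "J \<subseteq> I \<and> Suc (card J) = i"
proof -
  have J: "J \<subseteq> I" using assms(2) koszul_diff_outside by blast
  then have "finite J" using M.finite_vars finite_subset by blast
  have "\<exists>j\<in>I - J. c (insert j J) \<noteq> 0"
  proof (rule ccontr)
    assume "\<not> (\<exists>j\<in>I - J. c (insert j J) \<noteq> 0)"
    then have "koszul_diff x I c J = 0" by (simp add: koszul_diff_def)
    then show False using assms(2) by simp
  qed
  then obtain j where "j \<in> I - J" "c (insert j J) \<noteq> 0" by blast
  then have "card (insert j J) = i" using koszul_chainsD(2)[OF assms(1)] by blast
  then show ?thesis using J \<open>finite J\<close> \<open>j \<in> I - J\<close> by simp
qed

theorem homology_reduction:
  assumes "koszul_homology_dim scA xA I A i n"
  shows "koszul_homology_dim sc x (insert p I) M i n"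
proof -
  interpret P: variable_action sc x "insert p I" by (rule variable_action_insert)
  interpret CM: vector_space "\<lambda>a (c :: nat set \<Rightarrow> 'm) J. sc a (c J)" by (rule M.vector_space_chains)
  interpret CA: vector_space "\<lambda>a (c :: nat set \<Rightarrow> 'n) J. scA a (c J)" by (rule A.vector_space_chains)
  have P_sub: "P.submodule M" using M_sub M_p by (auto simp: M.submodule_def P.submodule_def)
  define res where "res c J = (if J \<subseteq> I then \<pi> (c J) else 0)" for c :: "nat set \<Rightarrow> 'm" and J
  define L where "L a c \<longleftrightarrow> c \<in> koszul_cycles x (insert p I) M i \<and> a = res c" for a c
  have diffM: "koszul_diff x I c J \<in> M" if "\<And>J. c J \<in> M" for c J
    by (rule M.submodule_diff[OF M_sub that])
  have res_chain: "res c \<in> koszul_chains I A j" if c: "c \<in> koszul_chains (insert p I) M j" for c j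
  proof (rule koszul_chainsI)
    show "res c J \<in> A" for J
      using koszul_chainsD(1)[OF c] \<pi>_onto A.subspace_0[OF A_subspace] by (auto simp: res_def)
    show "res c J = 0" if "\<not> (J \<subseteq> I \<and> card J = j)" for J
      using koszul_chainsD(2)[OF c, of J] that \<pi>_0 by (auto simp: res_def)
  qed
  have res_diff: "koszul_diff xA I (res c) J = \<pi> (koszul_diff x (insert p I) c J)"
    if c: "\<And>J. c J \<in> M" and J: "J \<subseteq> I" for c J
  proof -
    have "koszul_diff xA I (res c) J = koszul_diff xA I (\<lambda>J. \<pi> (c J)) J"
      by (rule koszul_diff_cong) (simp add: res_def)
    also have "\<dots> = \<pi> (koszul_diff x I c J)" by (rule \<pi>_koszul_diff[symmetric]) (rule c)
    also have "\<dots> = \<pi> (x p (c (insert p J)) + koszul_diff x I c J)"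
      by (simp add: \<pi>_add M_p c diffM \<pi>_p)
    finally show ?thesis using koszul_diff_cone(1)[OF M.finite_vars p_less J, of x c] by simp
  qed
  have cyc: "res c \<in> koszul_cycles xA I A i" if c: "c \<in> koszul_cycles x (insert p I) M i" for c
  proof -
    have ch: "c \<in> koszul_chains (insert p I) M i" and d: "koszul_diff x (insert p I) c = 0"
      using c by (auto simp: koszul_cycles_def)
    have "koszul_diff xA I (res c) J = 0" for J
      using res_diff[OF koszul_chainsD(1)[OF ch], of J] d \<pi>_0
      by (cases "J \<subseteq> I") (auto simp: koszul_diff_outside)
    then show ?thesis using res_chain[OF ch] by (auto simp: koszul_cycles_def)
  qed
  have cycle_eq: "x p (c (insert p J)) = - koszul_diff x I c J"
    if "c \<in> koszul_cycles x (insert p I) M i" "J \<subseteq> I" for c J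
    using koszul_diff_cone(1)[OF M.finite_vars p_less that(2), of x c] that(1)
    by (simp add: koszul_cycles_def eq_neg_iff_add_eq_0)
  have onto: "\<exists>c. L a c" if a: "a \<in> koszul_cycles xA I A i" for a
  proof -
    have ach: "a \<in> koszul_chains I A i" and da: "koszul_diff xA I a = 0"
      using a by (auto simp: koszul_cycles_def)
    obtain c where c: "c \<in> koszul_chains I M i" "\<And>J. \<pi> (c J) = a J" using lift_chain[OF ach] by blast
    have cM: "c J \<in> M" for J by (rule koszul_chainsD(1)[OF c(1)])
    have "\<pi> (koszul_diff x I c J) = 0" for J
      using \<pi>_koszul_diff[of c J, OF cM] da by (simp add: c(2))
    then have "\<exists>u\<in>M. koszul_diff x I c J = x p u" for J
      using \<pi>_ker[OF diffM[of c, OF cM]] by blast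
    then obtain u where u: "\<And>J. u J \<in> M" "\<And>J. koszul_diff x I c J = x p (u J)" by metis
    \<comment> \<open>The boundary of the lift \<open>c\<close> is divisible by \<open>X\<^sub>p\<close>; the quotient, with the opposite sign, is the
      component on the sets with \<open>p\<close>.\<close>
    define u' where "u' J = - u J" for J
    have u': "u' J \<in> M" for J using u(1) M.subspace_neg[OF M_subspace] by (simp add: u'_def)
    have u'_card: "J \<subseteq> I \<and> Suc (card J) = i" if "u' J \<noteq> 0" for J
      using diff_nonzero_card[OF c(1), of J] u p_inj[OF u(1), of J] that by (auto simp: u'_def)
    let ?c = "cone_chain c u'"
    have ch: "?c \<in> koszul_chains (insert p I) M i" by (rule cone_chain_chains[OF c(1) u' u'_card])
    have d1: "koszul_diff x (insert p I) ?c J = 0" if "J \<subseteq> I" for J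
      using koszul_diff_cone_chain(1)[OF that] u(2) by (simp add: u'_def M.act_minus)
    have d2: "koszul_diff x I u' J = 0" for J
    proof (rule p_inj[OF diffM[OF u']])
      have "x p (koszul_diff x I u' J) = koszul_diff x I (\<lambda>J. x p (u' J)) J"
        by (rule x_p_koszul_diff)
      also have "(\<lambda>J. x p (u' J)) = - koszul_diff x I c"
        by (auto simp: u'_def u(2) M.act_minus fun_eq_iff)
      also have "koszul_diff x I (- koszul_diff x I c) J = 0"
        unfolding M.diff_minus M.koszul_diff_diff by simp
      finally show "x p (koszul_diff x I u' J) = 0" .
    qed
    have "koszul_diff x (insert p I) ?c J = 0" for J
    proof (cases "J \<subseteq> insert p I")
      case True
      then show ?thesis
        by (rule subset_insert_cases) (use d1 d2 koszul_diff_cone_chain(2) in auto)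
    qed (rule koszul_diff_outside)
    then have "?c \<in> koszul_cycles x (insert p I) M i" using ch by (auto simp: koszul_cycles_def)
    moreover have "res ?c = a"
      using koszul_chainsD(2)[OF ach] by (auto simp: res_def cone_chain_simps c(2) fun_eq_iff)
    ultimately show ?thesis unfolding L_def by blast
  qed
  have bd: "a \<in> koszul_boundaries xA I A i \<longleftrightarrow> c \<in> koszul_boundaries x (insert p I) M i"
    if L: "L a c" for a c
  proof
    have c: "c \<in> koszul_cycles x (insert p I) M i" and a: "a = res c" using L by (auto simp: L_def)
    have ch: "c \<in> koszul_chains (insert p I) M i" using c by (simp add: koszul_cycles_def)
    have cM: "c J \<in> M" for J by (rule koszul_chainsD(1)[OF ch])
    { assume "c \<in> koszul_boundaries x (insert p I) M i"
      then obtain b where b: "b \<in> koszul_chains (insert p I) M (Suc i)" "c = koszul_diff x (insert p I) b"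
        unfolding koszul_boundaries_def by blast
      have "res c J = koszul_diff xA I (res b) J" for J
        using res_diff[OF koszul_chainsD(1)[OF b(1)], of J] b(2)
        by (cases "J \<subseteq> I") (auto simp: res_def koszul_diff_outside)
      then have "a = koszul_diff xA I (res b)" unfolding a by (rule ext)
      then show "a \<in> koszul_boundaries xA I A i"
        using res_chain[OF b(1)] unfolding koszul_boundaries_def by (metis image_eqI) }
    assume "a \<in> koszul_boundaries xA I A i"
    then obtain \<alpha> where \<alpha>: "\<alpha> \<in> koszul_chains I A (Suc i)" "a = koszul_diff xA I \<alpha>"
      unfolding koszul_boundaries_def by blast
    obtain b where b: "b \<in> koszul_chains I M (Suc i)" "\<And>J. \<pi> (b J) = \<alpha> J" using lift_chain[OF \<alpha>(1)] by blast
    have bM: "b J \<in> M" for J by (rule koszul_chainsD(1)[OF b(1)])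
    define c' where "c' J = (if J \<subseteq> I then c J else 0)" for J
    define d where "d J = c' J - koszul_diff x I b J" for J
    have dM: "d J \<in> M" for J
      unfolding d_def using cM M_0
      by (intro M.subspace_diff[OF M_subspace] diffM[OF bM]) (simp add: c'_def)
    have "\<pi> (d J) = 0" for J
    proof (cases "J \<subseteq> I")
      case True
      have "\<pi> (koszul_diff x I b J) = a J"
        using \<pi>_koszul_diff[of b J, OF bM] by (simp add: b(2) \<alpha>(2))
      then show ?thesis using True by (simp add: d_def c'_def \<pi>_diff[OF cM diffM[OF bM]] a res_def)
    qed (simp add: d_def c'_def koszul_diff_outside \<pi>_0)
    then have "\<exists>v\<in>M. d J = x p v" for J using \<pi>_ker[OF dM] by blast
    then obtain v where v: "\<And>J. v J \<in> M" "\<And>J. d J = x p (v J)" by metis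
    have v_card: "J \<subseteq> I \<and> Suc (card J) = Suc i" if "v J \<noteq> 0" for J
    proof -
      have "d J \<noteq> 0" using that v p_inj by metis
      then show ?thesis
        using diff_nonzero_card[OF b(1), of J] koszul_chainsD(2)[OF ch, of J]
        by (cases "koszul_diff x I b J = 0") (auto simp: d_def c'_def split: if_splits)
    qed
    let ?b = "cone_chain b v"
    have ch_b: "?b \<in> koszul_chains (insert p I) M (Suc i)" by (rule cone_chain_chains[OF b(1) v(1) v_card])
    have e1: "koszul_diff x (insert p I) ?b J = c J" if "J \<subseteq> I" for J
      using koszul_diff_cone_chain(1)[OF that, of b v] that by (simp flip: v(2)) (simp add: d_def c'_def)
    have e2: "koszul_diff x (insert p I) ?b (insert p J) = c (insert p J)" if J: "J \<subseteq> I" for J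
    proof -
      have "x p (koszul_diff x I v J) = koszul_diff x I d J"
        unfolding v(2) by (rule x_p_koszul_diff)
      also have "d = c' - koszul_diff x I b" by (auto simp: d_def fun_eq_iff)
      also have "koszul_diff x I (c' - koszul_diff x I b) J = koszul_diff x I c' J"
        by (simp add: M.diff_diff_fun M.koszul_diff_diff)
      also have "\<dots> = koszul_diff x I c J" by (rule koszul_diff_cong) (simp add: c'_def)
      also have "\<dots> = - x p (c (insert p J))" using cycle_eq[OF c J] by simp
      finally have "x p (koszul_diff x I v J + c (insert p J)) = 0" by (simp add: M.act_add)
      then have "koszul_diff x I v J + c (insert p J) = 0"
        by (rule p_inj[OF M.subspace_add[OF M_subspace diffM[OF v(1)] cM]])
      then show ?thesis
        using koszul_diff_cone_chain(2)[OF J, of b v] by (simp add: add_eq_0_iff)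
    qed
    have "koszul_diff x (insert p I) ?b J = c J" for J
    proof (cases "J \<subseteq> insert p I")
      case True
      then show ?thesis by (rule subset_insert_cases) (use e1 e2 in auto)
    next
      case False
      then show ?thesis using koszul_chainsD(2)[OF ch, of J] by (simp add: koszul_diff_outside)
    qed
    then have "koszul_diff x (insert p I) ?b = c" by (rule ext)
    then show "c \<in> koszul_boundaries x (insert p I) M i"
      using ch_b unfolding koszul_boundaries_def by (metis image_eqI)
  qed
  have res_add: "res (b + c) = res b + res c" if "\<And>J. b J \<in> M" "\<And>J. c J \<in> M" for b c
    using that by (auto simp: res_def \<pi>_add fun_eq_iff)
  have res_scale: "res (\<lambda>J. sc r (c J)) = (\<lambda>J. scA r (res c J))" if "\<And>J. c J \<in> M" for r c
    using that by (auto simp: res_def \<pi>_scale fun_eq_iff)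
  have cyM: "c J \<in> M" if "c \<in> koszul_cycles x (insert p I) M i" for c J
    using that by (auto simp: koszul_cycles_def dest: koszul_chainsD)
  note P_cyc = P.subspace_cycles[OF M_subspace, of i]
  show ?thesis unfolding koszul_homology_dim_def
  proof (rule quotient_dim_transfer[where L = L, OF A.vector_space_chains A.subspace_cycles[OF A_subspace]
        assms[unfolded koszul_homology_dim_def] _ _ _ M.vector_space_chains _ _ bd])
    show "a \<in> koszul_cycles xA I A i \<and> c \<in> koszul_cycles x (insert p I) M i" if "L a c" for a c
      using that cyc unfolding L_def by blast
    show "L (a + a') (c + c')" if "L a c" "L a' c'" for a a' c c'
    proof -
      have c: "c \<in> koszul_cycles x (insert p I) M i" "c' \<in> koszul_cycles x (insert p I) M i"
        and a: "a = res c" "a' = res c'" using that by (auto simp: L_def)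
      show ?thesis
        unfolding L_def a using CM.subspace_add[OF P_cyc c] res_add[OF cyM[OF c(1)] cyM[OF c(2)]] by simp
    qed
    show "L (\<lambda>J. scA r (a J)) (\<lambda>J. sc r (c J))" if "L a c" for r a c
    proof -
      have c: "c \<in> koszul_cycles x (insert p I) M i" and a: "a = res c" using that by (auto simp: L_def)
      show ?thesis
        unfolding L_def a using CM.subspace_scale[OF P_cyc c] res_scale[OF cyM[OF c]] by simp
    qed
    show "\<exists>c. L a c" if "a \<in> koszul_cycles xA I A i" for a by (rule onto[OF that])
    show "\<exists>a. L a c" if "c \<in> koszul_cycles x (insert p I) M i" for c using that unfolding L_def by blast
    show "0 \<in> koszul_boundaries x (insert p I) M i"
      by (rule CM.subspace_0[OF P.subspace_boundaries[OF M_subspace]])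
    show "koszul_boundaries x (insert p I) M i \<subseteq> koszul_cycles x (insert p I) M i"
      by (rule P.boundaries_subset_cycles[OF P_sub])
  qed
qed

end

section \<open>The semigroup ring as a graded module\<close>

text \<open>Sums of two of the small generators \<open>e, \<dots>, e+k-1\<close> stop at \<open>2e+2k-2\<close>, and \<open>2e+2k-1\<close> is the
  Frobenius number.\<close>

lemma S_sg_eq:
  assumes "1 \<le> k" "2 * k < e"
  shows "S_sg e k = {s. s = 0 \<or> (e \<le> s \<and> \<not> (e + k \<le> s \<and> s < e + 2 * k) \<and> s \<noteq> 2 * e + 2 * k - 1)}"
    (is "_ = ?S")
proof (intro equalityI subsetI)
  fix s assume "s \<in> S_sg e k"
  then show "s \<in> ?S"
    unfolding S_sg_def
  proof (induction rule: semigroup_gen.induct)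
    case (add x y)
    show ?case
    proof (cases "x = 0 \<or> y = 0")
      case False
      then have xy: "e \<le> x" "e \<le> y" "x < e + k \<or> e + 2 * k \<le> x" "y < e + k \<or> e + 2 * k \<le> y"
        using add.IH by auto
      have "x + y + 1 \<noteq> 2 * e + 2 * k"
      proof
        assume "x + y + 1 = 2 * e + 2 * k"
        with xy show False by (elim disjE; linarith)
      qed
      then have "x + y \<noteq> 2 * e + 2 * k - 1" using assms(1) by linarith
      then show ?thesis using xy assms(2) by simp
    qed (use add.IH in auto)
  qed (use assms in auto)
next
  let ?G = "{e..e + k - 1} \<union> {e + 2 * k..2 * e - 1}"
  fix s assume "s \<in> ?S"
  then show "s \<in> S_sg e k"
    unfolding S_sg_def
  proof (induction s rule: less_induct)
    case (less s)
    note gen = semigroup_gen.gen[of _ ?G] and add = semigroup_gen.add[of _ ?G]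
    consider "s = 0" | "s \<in> ?G" | "2 * e \<le> s" "s \<le> 2 * e + 2 * k - 2" | "2 * e + 2 * k \<le> s"
      using less.prems assms by fastforce
    then show ?case
    proof cases
      case 3
      have "\<exists>i<k. s - (e + i) \<in> {e..e + k - 1}"
        using 3 assms by (cases "s \<le> 2 * e + k - 1") (auto intro: exI[of _ 0] exI[of _ "k - 1"])
      then obtain i where "i < k" "s - (e + i) \<in> {e..e + k - 1}" by blast
      then have "e + i \<in> ?G" "s - (e + i) \<in> ?G" "s = (e + i) + (s - (e + i))" using assms by auto
      then show ?thesis using gen add by metis
    next
      case 4
      show ?thesis
      proof (cases "s = 3 * e + 2 * k - 1")
        case True
        have "e + 2 * k \<in> ?G" "2 * e - 1 \<in> ?G" "s = (e + 2 * k) + (2 * e - 1)"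
          using True assms by auto
        then show ?thesis using gen add by metis
      next
        case False
        have "s - e \<in> semigroup_gen ?G"
          using 4 False assms by (intro less.IH) auto
        moreover have "e \<in> ?G" "s = (s - e) + e" using 4 assms by auto
        ultimately show ?thesis using gen add by metis
      qed
    qed (auto intro: semigroup_gen.intros)
  qed
qed

lemma semigroup_ring_eq:
  assumes "0 \<in> S" and add: "\<And>s t. s \<in> S \<Longrightarrow> t \<in> S \<Longrightarrow> s + t \<in> S"
  shows "(semigroup_ring S :: 'a::field poly set) = {p. \<forall>n. coeff p n \<noteq> 0 \<longrightarrow> n \<in> S}"
proof (intro equalityI subsetI)
  fix p :: "'a poly" assume "p \<in> semigroup_ring S"
  then show "p \<in> {p. \<forall>n. coeff p n \<noteq> 0 \<longrightarrow> n \<in> S}"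
  proof (induction rule: semigroup_ring.induct)
    case (const c)
    then show ?case using assms(1) by (auto simp: coeff_pCons split: nat.splits)
  next
    case (gen s)
    then show ?case by (auto simp: coeff_monom split: if_splits)
  next
    case (add p q)
    then show ?case by (auto simp: coeff_add) (metis add.right_neutral)
  next
    case (mult p q)
    show ?case
    proof (intro CollectI allI impI)
      fix n assume "coeff (p * q) n \<noteq> 0"
      then have "\<exists>i\<le>n. coeff p i * coeff q (n - i) \<noteq> 0"
        unfolding coeff_mult by (metis (no_types, lifting) atMost_iff sum.neutral)
      then obtain i where "i \<le> n" "i \<in> S" "n - i \<in> S" using mult.IH by auto
      then show "n \<in> S" using assms(2)[of i "n - i"] by simp
    qed
  qed
next
  fix p :: "'a poly" assume "p \<in> {p. \<forall>n. coeff p n \<noteq> 0 \<longrightarrow> n \<in> S}"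
  then have p: "\<And>n. coeff p n \<noteq> 0 \<Longrightarrow> n \<in> S" by blast
  have "monom (coeff p n) n \<in> semigroup_ring S" for n
  proof (cases "coeff p n = 0")
    case True
    then show ?thesis using semigroup_ring.const[of 0 S] by simp
  next
    case False
    then have "[:coeff p n:] * monom 1 n \<in> semigroup_ring S"
      using p[OF False] by (intro semigroup_ring.mult semigroup_ring.const semigroup_ring.gen)
    then show ?thesis by (simp add: smult_monom)
  qed
  then have "(\<Sum>n\<le>d. monom (coeff p n) n) \<in> semigroup_ring S" for d
    by (induction d) (auto intro: semigroup_ring.add)
  then show "p \<in> semigroup_ring S" by (metis poly_as_sum_of_monoms)
qed

abbreviation eval_monoms :: "nat \<Rightarrow> 'a::field mpoly \<Rightarrow> 'a poly" where
  "eval_monoms e \<equiv> mpoly_subst (\<lambda>i. monom 1 (e + i))"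

lemma prod_monom: "(\<Prod>i\<in>A. monom (1 :: 'a::comm_semiring_1) (f i)) = monom 1 (\<Sum>i\<in>A. f i)"
  by (induction A rule: infinite_finite_induct) (auto simp: mult_monom one_poly_eq_simps)

lemma eval_monoms_eq:
  assumes "finite K" "Poly_Mapping.keys p \<subseteq> K"
  shows "eval_monoms e p = (\<Sum>m\<in>K. monom (Poly_Mapping.lookup p m) (weighted_degree (\<lambda>i. e + i) m))"
proof -
  have "eval_monoms e p =
      (\<Sum>m\<in>Poly_Mapping.keys p. monom (Poly_Mapping.lookup p m) (weighted_degree (\<lambda>i. e + i) m))"
    unfolding mpoly_subst_def
    by (rule sum.cong)
      (simp_all add: weighted_degree_def monom_power prod_monom smult_monom mult.commute)
  also have "\<dots> = (\<Sum>m\<in>K. monom (Poly_Mapping.lookup p m) (weighted_degree (\<lambda>i. e + i) m))"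
    using assms by (intro sum.mono_neutral_left) (auto simp: in_keys_iff)
  finally show ?thesis .
qed

lemma eval_monoms_add: "eval_monoms e (p + q) = eval_monoms e p + eval_monoms e q"
proof -
  let ?K = "Poly_Mapping.keys p \<union> Poly_Mapping.keys q"
  have "Poly_Mapping.keys (p + q) \<subseteq> ?K" by (rule keys_add)
  then show ?thesis
    by (simp add: eval_monoms_eq[of ?K] lookup_add add_monom flip: sum.distrib)
qed

lemma eval_monoms_single:
  "eval_monoms e (Poly_Mapping.single m c) = monom c (weighted_degree (\<lambda>i. e + i) m)"
  by (simp add: eval_monoms_eq[of "{m}"])

lemma eval_monoms_0: "eval_monoms e 0 = 0"
  by (simp add: mpoly_subst_def)

lemma eval_monoms_sum: "eval_monoms e (\<Sum>i\<in>A. f i) = (\<Sum>i\<in>A. eval_monoms e (f i))"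
  by (induction A rule: infinite_finite_induct) (auto simp: eval_monoms_add eval_monoms_0)

lemma eval_monoms_mult: "eval_monoms e (p * q) = eval_monoms e p * eval_monoms e q"
proof -
  let ?P = "Poly_Mapping.keys p" and ?Q = "Poly_Mapping.keys q"
  have p: "p = (\<Sum>m\<in>?P. Poly_Mapping.single m (Poly_Mapping.lookup p m))"
    and q: "q = (\<Sum>m\<in>?Q. Poly_Mapping.single m (Poly_Mapping.lookup q m))"
    by (auto intro: poly_eq_sum_monomials)
  have "p * q = (\<Sum>m\<in>?P. \<Sum>n\<in>?Q. Poly_Mapping.single (m + n) (Poly_Mapping.lookup p m * Poly_Mapping.lookup q n))"
    by (subst p, subst q) (simp only: sum_product mult_single)
  then have "eval_monoms e (p * q) = (\<Sum>m\<in>?P. \<Sum>n\<in>?Q.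
      monom (Poly_Mapping.lookup p m * Poly_Mapping.lookup q n) (weighted_degree (\<lambda>i. e + i) (m + n)))"
    by (simp only: eval_monoms_sum eval_monoms_single)
  also have "\<dots> = eval_monoms e p * eval_monoms e q"
    by (simp add: eval_monoms_eq[of ?P p] eval_monoms_eq[of ?Q q] sum_product mult_monom weighted_degree_add)
  finally show ?thesis .
qed

lemma R_act_monomial:
  "R_act e (Poly_Mapping.single m c) f = monom c (weighted_degree (\<lambda>i. e + i) m) * f"
  by (simp add: R_act_def eval_monoms_single)

lemma R_act_var: "R_act e (var i) f = monom 1 (e + i) * f"
  by (simp add: var_def R_act_monomial del: One_nat_def)

lemma R_act_const: "R_act e (const c) f = smult c f"
  by (simp add: R_act_monomial monom_0)

lemma module_R_act: "module (R_act e :: 'a::field mpoly \<Rightarrow> _)"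
proof unfold_locales
  show "R_act e 1 x = x" for x :: "'a poly"
    using R_act_const[of e 1 x] by simp
qed (simp_all add: R_act_def eval_monoms_add eval_monoms_mult ring_distribs mult.assoc)

definition poly_proj :: "int \<Rightarrow> 'a::field poly \<Rightarrow> 'a poly" where
  "poly_proj d f = (if d < 0 then 0 else monom (coeff f (nat d)) (nat d))"

lemma coeff_poly_proj: "coeff (poly_proj d f) n = (if int n = d then coeff f n else 0)"
  by (auto simp: poly_proj_def coeff_monom)

lemma graded_module_R_act: "graded_module (R_act e :: 'a::field mpoly \<Rightarrow> _) (\<lambda>i. e + i) poly_proj"
proof -
  interpret module "R_act e :: 'a mpoly \<Rightarrow> _" by (rule module_R_act)
  have fin: "finite {d. poly_proj d f \<noteq> 0}" for f :: "'a poly"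
  proof (rule finite_subset)
    show "{d. poly_proj d f \<noteq> 0} \<subseteq> int ` {..degree f}"
    proof
      fix d assume "d \<in> {d. poly_proj d f \<noteq> 0}"
      then obtain n where "coeff (poly_proj d f) n \<noteq> 0" by (auto simp: poly_eq_iff)
      then have "int n = d" "coeff f n \<noteq> 0" by (auto simp: coeff_poly_proj split: if_splits)
      then show "d \<in> int ` {..degree f}" using le_degree by auto
    qed
  qed simp
  show ?thesis
  proof unfold_locales
    show "poly_proj d (R_act e (Poly_Mapping.single m c) v) =
        R_act e (Poly_Mapping.single m c) (poly_proj (d - int (weighted_degree ((+) e) m)) v)" for d m c v
      by (rule poly_eqI) (auto simp: R_act_monomial coeff_poly_proj coeff_monom_mult)
    show "(\<Sum>d | poly_proj d v \<noteq> 0. poly_proj d v) = v" for v :: "'a poly"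
    proof (rule poly_eqI)
      fix n
      have "coeff (\<Sum>d | poly_proj d v \<noteq> 0. poly_proj d v) n =
          (\<Sum>d | poly_proj d v \<noteq> 0. if int n = d then coeff v n else 0)"
        by (simp add: coeff_sum coeff_poly_proj)
      also have "\<dots> = (if poly_proj (int n) v \<noteq> 0 then coeff v n else 0)"
        using fin by (subst sum.delta') auto
      also have "\<dots> = coeff v n"
        using coeff_poly_proj[of "int n" v n] by auto
      finally show "coeff (\<Sum>d | poly_proj d v \<noteq> 0. poly_proj d v) n = coeff v n" .
    qed
  qed (auto simp: fin coeff_poly_proj intro!: poly_eqI)
qed

lemma semigroup_ring_piece_eq:
  "semigroup_ring_piece S d = {p \<in> semigroup_ring S. poly_proj d p = p}"
  unfolding semigroup_ring_piece_def by (auto simp: poly_eq_iff coeff_poly_proj; metis)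

lemma graded_submodule_semigroup_ring:
  assumes S: "0 \<in> S" "\<And>s t. s \<in> S \<Longrightarrow> t \<in> S \<Longrightarrow> s + t \<in> S" and I: "\<And>i. i \<in> I \<Longrightarrow> e + i \<in> S"
  shows "graded_submodule (R_act e) poly_proj I (semigroup_ring S :: 'a::field poly set)"
proof -
  have mult: "n * s \<in> S" if "s \<in> S" for n s
    using that by (induction n) (auto simp: S)
  have sum: "(\<Sum>i\<in>A. f i) \<in> S" if "\<And>i. i \<in> A \<Longrightarrow> f i \<in> S" for A :: "nat set" and f :: "nat \<Rightarrow> nat"
    using that by (induction A rule: infinite_finite_induct) (auto simp: S)
  have wd: "weighted_degree (\<lambda>i. e + i) m \<in> S" if "Poly_Mapping.keys m \<subseteq> I" for m
    unfolding weighted_degree_def using that I by (intro sum mult) auto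
  have monom: "monom c s \<in> (semigroup_ring S :: 'a poly set)" if "s \<in> S" for c s
    using that by (auto simp: semigroup_ring_eq[OF S] coeff_monom split: if_splits)
  have sum': "(\<Sum>i\<in>A. f i) \<in> semigroup_ring S" if "\<And>i. i \<in> A \<Longrightarrow> f i \<in> semigroup_ring S"
    for A and f :: "'i \<Rightarrow> 'a poly"
    using that semigroup_ring.const[of 0 S]
    by (induction A rule: infinite_finite_induct) (auto intro: semigroup_ring.add)
  have "R_act e r f \<in> semigroup_ring S" if "r \<in> polynomial_ring I" "f \<in> semigroup_ring S"
    for r and f :: "'a poly"
  proof -
    have "eval_monoms e r \<in> semigroup_ring S"
      unfolding eval_monoms_eq[of "Poly_Mapping.keys r" r, OF finite_keys subset_refl]
      using that(1) by (intro sum' monom wd) (auto simp: polynomial_ring_def)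
    then show ?thesis unfolding R_act_def using that(2) by (rule semigroup_ring.mult)
  qed
  moreover have "poly_proj d f \<in> semigroup_ring S" if "f \<in> semigroup_ring S" for d and f :: "'a poly"
    using that by (auto simp: semigroup_ring_eq[OF S] coeff_poly_proj split: if_splits)
  moreover have "\<exists>d0. \<forall>v\<in>(semigroup_ring S :: 'a poly set). \<forall>d<d0. poly_proj d v = 0"
    by (intro exI[of _ 0]) (simp add: poly_proj_def)
  moreover have "0 \<in> (semigroup_ring S :: 'a poly set)" by (simp add: semigroup_ring_eq[OF S])
  ultimately show ?thesis
    unfolding graded_submodule_def by (auto intro: semigroup_ring.add)
qed

section \<open>The Apery algebra\<close>

text \<open>The smallest element of \<open>S\<^sub>k\<close> in the residue class of \<open>r\<close> modulo \<open>e\<close>, for \<open>r < e\<close>.\<close>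

definition apery :: "nat \<Rightarrow> nat \<Rightarrow> nat \<Rightarrow> nat" where
  "apery e k r = (if r = 0 then 0 else if r < k \<or> 2 * k \<le> r then e + r
     else if r = 2 * k - 1 then 3 * e + r else 2 * e + r)"

definition Vars :: "nat \<Rightarrow> nat \<Rightarrow> nat set" where
  "Vars e k = {1..<k} \<union> {2 * k..<e}"

text \<open>\<open>K[S\<^sub>k]/(t\<^sup>e)\<close> has the images of the \<open>t\<^sup>s\<close>, \<open>s\<close> an Apery element, as a basis; its elements are
  written as coordinate vectors indexed by residues.\<close>

definition apery_space :: "nat \<Rightarrow> (nat \<Rightarrow> 'a::field) set" where
  "apery_space e = {f. \<forall>r\<ge>e. f r = 0}"

text \<open>Multiplication by \<open>x\<^sub>i = t\<^sup>e\<^sup>+\<^sup>i\<close>. The residues \<open>i \<in> Vars\<close> stand for the \<open>x\<^sub>i\<close> themselves, those in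
  \<open>[k, 2k-2]\<close> for the products \<open>x\<^sub>i x\<^sub>j\<close> with \<open>i, j < k\<close>, and \<open>2k-1\<close> for the socle. The socle receives
  \<open>x\<^sub>i\<close> times the basis vector \<open>dual i\<close>.\<close>

definition dual :: "nat \<Rightarrow> nat \<Rightarrow> nat \<Rightarrow> nat" where
  "dual e k i = (if i < k then 2 * k - 1 - i else e + 2 * k - 1 - i)"

definition apery_act :: "nat \<Rightarrow> nat \<Rightarrow> nat \<Rightarrow> (nat \<Rightarrow> 'a::field) \<Rightarrow> nat \<Rightarrow> 'a" where
  "apery_act e k i f r =
     (if r = i then f 0
      else if k \<le> r \<and> r \<le> 2 * k - 2 \<and> r < i + k \<and> i < k then f (r - i)
      else if r = 2 * k - 1 then f (dual e k i) else 0)"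

definition apery_coords :: "nat \<Rightarrow> nat \<Rightarrow> 'a::field poly \<Rightarrow> nat \<Rightarrow> 'a" where
  "apery_coords e k f r = (if r < e then coeff f (apery e k r) else 0)"

lemma R_vars_eq: "1 \<le> k \<Longrightarrow> 2 * k < e \<Longrightarrow> R_vars e k = insert 0 (Vars e k)"
  by (auto simp: R_vars_def Vars_def)

locale apery_semigroup =
  fixes e k :: nat
  assumes k: "1 \<le> k" and e: "2 * k < e"
begin

lemma residue_cases [case_names zero var product socle]:
  obtains "r = 0" | "0 < r" "r < k \<or> 2 * k \<le> r" | "k \<le> r" "r \<le> 2 * k - 2" | "Suc r = 2 * k"
  using k by linarith

lemma Vars_cases:
  assumes "i \<in> Vars e k"
  obtains "1 \<le> i" "i < k" | "2 * k \<le> i" "i < e"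
  using assms by (auto simp: Vars_def)

lemma apery_simps:
  "apery e k 0 = 0"
  "0 < r \<Longrightarrow> r < k \<or> 2 * k \<le> r \<Longrightarrow> apery e k r = e + r"
  "k \<le> r \<Longrightarrow> r \<le> 2 * k - 2 \<Longrightarrow> apery e k r = 2 * e + r"
  "Suc r = 2 * k \<Longrightarrow> apery e k r = 3 * e + r"
  using k by (auto simp: apery_def)

lemma apery_act_simps:
  "r < k \<or> 2 * k \<le> r \<Longrightarrow> apery_act e k i f r = (if r = i then f 0 else 0)"
  "k \<le> r \<Longrightarrow> r \<le> 2 * k - 2 \<Longrightarrow> i \<in> Vars e k \<Longrightarrow>
     apery_act e k i f r = (if i < k \<and> r < i + k then f (r - i) else 0)"
  "Suc r = 2 * k \<Longrightarrow> i \<in> Vars e k \<Longrightarrow> apery_act e k i f r = f (dual e k i)"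
  using k by (auto simp: apery_act_def Vars_def)

text \<open>In each of the three kinds of residues the coordinates of \<open>x\<^sub>i (x\<^sub>j f)\<close> are given by a formula that
  is symmetric in \<open>i\<close> and \<open>j\<close>.\<close>

lemma apery_act_commute:
  assumes i: "i \<in> Vars e k" and j: "j \<in> Vars e k"
  shows "apery_act e k i (apery_act e k j f) = apery_act e k j (apery_act e k i f)"
proof (rule ext)
  fix r
  have V: "apery_act e k l g r = (if r = l then g 0 else 0)" if "r < k \<or> 2 * k \<le> r"
    for r l and g :: "nat \<Rightarrow> 'a" by (rule apery_act_simps(1)[OF that])
  have zero: "apery_act e k l g 0 = 0" if "l \<in> Vars e k" for l and g :: "nat \<Rightarrow> 'a"
    using that k V[of 0 l g] by (auto simp: Vars_def)
  show "apery_act e k i (apery_act e k j f) r = apery_act e k j (apery_act e k i f) r"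
  proof (cases r rule: residue_cases)
    case zero
    then show ?thesis by (simp add: \<open>\<And>l g. l \<in> Vars e k \<Longrightarrow> apery_act e k l g 0 = 0\<close> i j)
  next
    case var
    then show ?thesis by (simp add: V zero i j)
  next
    case product
    have *: "apery_act e k i (apery_act e k j f) r = (if i < k \<and> j < k \<and> r = i + j then f 0 else 0)"
      if "i \<in> Vars e k" "j \<in> Vars e k" for i j
    proof (cases "i < k \<and> r < i + k")
      case True
      then have "r - i < k \<or> 2 * k \<le> r - i" using product by linarith
      then show ?thesis using True product that V[of "r - i" j f] by (auto simp: apery_act_simps(2))
    next
      case False
      then show ?thesis using product that by (auto simp: apery_act_simps(2))
    qed
    show ?thesis using i j by (simp add: * add.commute)
  next
    case socle
    have small: "apery_act e k i (apery_act e k j f) r =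
        (if j < k \<and> k \<le> i + j then f (2 * k - 1 - (i + j)) else 0)"
      if "i \<in> Vars e k" "j \<in> Vars e k" "i < k" for i j
    proof -
      have *: "k \<le> 2 * k - 1 - i" "2 * k - 1 - i \<le> 2 * k - 2" using that by (auto simp: Vars_def)
      show ?thesis
        unfolding apery_act_simps(3)[OF socle that(1)]
        using apery_act_simps(2)[OF * that(2), of f] that(3) by (auto simp: dual_def)
    qed
    have large: "apery_act e k i (apery_act e k j f) r = (if e + 2 * k - 1 = i + j then f 0 else 0)"
      if "i \<in> Vars e k" "j \<in> Vars e k" "2 * k \<le> i" for i j
    proof -
      have *: "2 * k \<le> e + 2 * k - 1 - i" "i < e" using that by (auto simp: Vars_def)
      then show ?thesis
        unfolding apery_act_simps(3)[OF socle that(1)]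
        using that(3) k V[of "e + 2 * k - 1 - i" j f] by (auto simp: dual_def)
    qed
    show ?thesis
      using i j by (elim Vars_cases) (auto simp: small large i j add.commute)
  qed
qed

lemma apery_variable_action:
  "variable_action (\<lambda>c (f :: nat \<Rightarrow> 'a::field) r. c * f r) (apery_act e k) (Vars e k)"
proof unfold_locales
  show "finite (Vars e k)" by (simp add: Vars_def)
  show "apery_act e k i (apery_act e k j f) = apery_act e k j (apery_act e k i f)"
    if "i \<in> Vars e k" "j \<in> Vars e k" for i j and f :: "nat \<Rightarrow> 'a"
    by (rule apery_act_commute[OF that])
  show "apery_act e k i (u + v) = apery_act e k i u + apery_act e k i v" for i and u v :: "nat \<Rightarrow> 'a"
  proof (rule ext)
    fix r
    let ?P = "k \<le> r \<and> r \<le> 2 * k - 2 \<and> r < i + k \<and> i < k"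
    show "apery_act e k i (u + v) r = (apery_act e k i u + apery_act e k i v) r"
      unfolding apery_act_def plus_fun_apply
      by (cases "r = i"; cases ?P; cases "r = 2 * k - 1") (simp_all only: simp_thms if_True if_False add_0)
  qed
  show "apery_act e k i (\<lambda>r. a * v r) = (\<lambda>r. a * apery_act e k i v r)" for i a and v :: "nat \<Rightarrow> 'a"
    by (auto simp: apery_act_def fun_eq_iff)
qed (simp_all add: fun_eq_iff algebra_simps)

lemma S_0: "0 \<in> S_sg e k"
  by (simp add: S_sg_eq[OF k e])

lemma S_add: "s \<in> S_sg e k \<Longrightarrow> t \<in> S_sg e k \<Longrightarrow> s + t \<in> S_sg e k"
  unfolding S_sg_def by (rule semigroup_gen.add)

lemma semigroup_ring_iff: "f \<in> semigroup_ring (S_sg e k) \<longleftrightarrow> (\<forall>n. coeff f n \<noteq> 0 \<longrightarrow> n \<in> S_sg e k)"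
  by (simp add: semigroup_ring_eq[OF S_0 S_add])

lemma S_sg_vars: "i \<in> insert 0 (Vars e k) \<Longrightarrow> e + i \<in> S_sg e k"
  using k e by (auto simp: S_sg_eq[OF k e] Vars_def)

lemma apery_in_S:
  assumes "r < e"
  shows "apery e k r \<in> S_sg e k"
  using assms k e by (cases r rule: residue_cases) (auto simp: apery_simps S_sg_eq[OF k e])

lemma apery_minus_e:
  assumes "r < e" "e \<le> apery e k r"
  shows "apery e k r - e \<notin> S_sg e k"
  using assms k e by (cases r rule: residue_cases) (auto simp: apery_simps S_sg_eq[OF k e])

lemma apery_minimal:
  assumes s: "s \<in> S_sg e k" and ap: "\<And>r. r < e \<Longrightarrow> s \<noteq> apery e k r"
  shows "e \<le> s \<and> s - e \<in> S_sg e k"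
proof (rule ccontr)
  assume no: "\<not> (e \<le> s \<and> s - e \<in> S_sg e k)"
  have "s \<noteq> 0" using ap[of 0] e by (simp add: apery_simps)
  then have s: "e \<le> s" "\<not> (e + k \<le> s \<and> s < e + 2 * k)" "s \<noteq> 2 * e + 2 * k - 1"
    using s by (auto simp: S_sg_eq[OF k e])
  then consider "0 < s - e" "s - e < e" | "e + k \<le> s - e" "s - e < e + 2 * k" | "s - e = 2 * e + 2 * k - 1"
    using no by (auto simp: S_sg_eq[OF k e])
  then show False
  proof cases
    case 1
    then have "apery e k (s - e) = e + (s - e)" using s by (intro apery_simps(2)) auto
    then show ?thesis using ap[of "s - e"] 1 s by simp
  next
    case 2
    then have "apery e k (s - 2 * e) = 2 * e + (s - 2 * e)" using s by (intro apery_simps(3)) auto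
    moreover have "s - 2 * e < e" using 2 e by linarith
    ultimately show ?thesis using ap[of "s - 2 * e"] 2 by simp
  next
    case 3
    then have "s = 3 * e + (2 * k - 1)" using s(1) k by linarith
    moreover have "apery e k (2 * k - 1) = 3 * e + (2 * k - 1)" using k by (intro apery_simps(4)) simp
    moreover have "2 * k - 1 < e" using e by linarith
    ultimately show ?thesis using ap by metis
  qed
qed

lemma apery_inj:
  assumes "r < e" "r' < e" "apery e k r = apery e k r'"
  shows "r = r'"
  using assms k e by (cases r rule: residue_cases; cases r' rule: residue_cases) (auto simp: apery_simps)

text \<open>A coordinate of \<open>t\<^sup>e\<^sup>+\<^sup>i f\<close> is the coefficient of \<open>f\<close> at \<open>apery e k r - (e + i)\<close>. This number
  is an Apery element, and then it appears in \<open>apery_act\<close>, or it lies outside \<open>S\<^sub>k\<close>.\<close>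

lemma apery_coords_act:
  assumes i: "i \<in> Vars e k" and f: "f \<in> semigroup_ring (S_sg e k)"
  shows "apery_coords e k (monom 1 (e + i) * f) = apery_act e k i (apery_coords e k f)"
proof (rule ext)
  fix r
  have i': "0 < i" "i < k \<or> 2 * k \<le> i" "i < e" using i k e by (auto simp: Vars_def)
  have f0: "coeff f n = 0" if "n \<notin> S_sg e k" for n using f that semigroup_ring_iff by blast
  have c: "coeff (monom 1 (e + i) * f) n = (if e + i \<le> n then coeff f (n - (e + i)) else 0)" for n
    by (simp add: coeff_monom_mult)
  show "apery_coords e k (monom 1 (e + i) * f) r = apery_act e k i (apery_coords e k f) r"
  proof (cases "r < e")
    case False
    then show ?thesis using i' e by (simp add: apery_coords_def apery_act_simps(1))
  next
    case r: True
    show ?thesis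
    proof (cases r rule: residue_cases)
      case zero
      then show ?thesis using i' k e by (simp add: apery_coords_def apery_act_simps(1) apery_simps c)
    next
      case var
      have "coeff f (r - i) = 0" if "i < r"
        using that r var by (intro f0) (auto simp: S_sg_eq[OF k e])
      then show ?thesis using var r e
        by (auto simp: apery_coords_def apery_act_simps(1) apery_simps c)
    next
      case product
      have l: "apery_coords e k (monom 1 (e + i) * f) r = coeff f (e + r - i)"
        using product r i' by (auto simp: apery_coords_def apery_simps c)
      show ?thesis
      proof (cases "i < k \<and> r < i + k")
        case True
        then have "apery e k (r - i) = e + (r - i)" using product by (intro apery_simps(2)) auto
        then show ?thesis
          using True product r l by (simp add: apery_act_simps(2) i apery_coords_def)
      next
        case False
        then have "coeff f (e + r - i) = 0"
          using product r i' k e by (intro f0) (auto simp: S_sg_eq[OF k e])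
        then show ?thesis using False product l by (auto simp: apery_act_simps(2) i)
      qed
    next
      case socle
      have l: "apery_coords e k (monom 1 (e + i) * f) r = coeff f (2 * e + r - i)"
        using socle r i' e by (auto simp: apery_coords_def apery_simps(4) c)
      have d: "dual e k i = (if i < k then r - i else e + r - i)"
        unfolding dual_def using socle by (auto intro: arg_cong2[of _ _ _ _ "(-)"])
      have "apery e k (dual e k i) = 2 * e + r - i"
      proof (cases "i < k")
        case True
        then have "apery e k (r - i) = 2 * e + (r - i)"
          using i' socle by (intro apery_simps(3)) auto
        then show ?thesis using True socle by (simp add: d)
      next
        case False
        then have "apery e k (e + r - i) = e + (e + r - i)"
          using i' socle k by (intro apery_simps(2)) auto
        then show ?thesis using False i' by (simp add: d)
      qed
      moreover have "dual e k i < e" using i' k e by (auto simp: dual_def)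
      ultimately show ?thesis unfolding l apery_act_simps(3)[OF socle i] by (simp add: apery_coords_def)
    qed
  qed
qed

text \<open>The kernel of \<open>apery_coords\<close> is \<open>t\<^sup>e K[S\<^sub>k]\<close>, since \<open>s - e\<close> lies in \<open>S\<^sub>k\<close> for exactly those \<open>s\<close> in
  \<open>S\<^sub>k\<close> that are not Apery elements.\<close>

lemma apery_reduction:
  "nonzerodivisor_reduction (\<lambda>c. R_act e (const c)) (\<lambda>i. R_act e (var i))
     (\<lambda>c f r. c * f r) (apery_act e k) (Vars e k) (semigroup_ring (S_sg e k) :: 'a::field poly set)
     (apery_space e) (apery_coords e k) 0"
proof -
  have fin: "finite (Vars e k)" by (simp add: Vars_def)
  interpret M: variable_action "\<lambda>c. R_act e (const c)" "\<lambda>i. R_act e (var i) :: 'a poly \<Rightarrow> _" "Vars e k"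
    by (rule variable_action_module[OF module_R_act fin])
  interpret A: variable_action "\<lambda>c (f :: nat \<Rightarrow> 'a) r. c * f r" "apery_act e k" "Vars e k"
    by (rule apery_variable_action)
  let ?M = "semigroup_ring (S_sg e k) :: 'a poly set"
  have act_M: "R_act e (var i) v \<in> ?M" if "i \<in> insert 0 (Vars e k)" "v \<in> ?M" for i v
    unfolding R_act_var
    by (intro semigroup_ring.mult semigroup_ring.gen S_sg_vars that)
  show ?thesis
  proof unfold_locales
    show "0 < i" if "i \<in> Vars e k" for i using that k by (auto simp: Vars_def)
    show "R_act e (var 0) (R_act e (var i) v) = R_act e (var i) (R_act e (var 0) v)" for i and v :: "'a poly"
      by (simp add: R_act_var algebra_simps)
    show "M.submodule ?M"
      unfolding M.submodule_def
    proof (intro conjI M.subspaceI ballI)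
      show "0 \<in> ?M" by (simp add: semigroup_ring_iff)
      show "u + v \<in> ?M" if "u \<in> ?M" "v \<in> ?M" for u v using that by (rule semigroup_ring.add)
      show "R_act e (const c) v \<in> ?M" if "v \<in> ?M" for c v
        using semigroup_ring.mult[OF semigroup_ring.const[of c] that] by (simp add: R_act_const)
    qed (auto intro: act_M)
    show "R_act e (var 0) v \<in> ?M" if "v \<in> ?M" for v using that by (auto intro: act_M)
    show "apery_coords e k (R_act e (var i) v) = apery_act e k i (apery_coords e k v)"
      if "i \<in> Vars e k" "v \<in> ?M" for i v
      unfolding R_act_var by (rule apery_coords_act[OF that])
    show "apery_coords e k ` ?M = apery_space e"
    proof (intro equalityI subsetI)
      fix a :: "nat \<Rightarrow> 'a" assume a: "a \<in> apery_space e"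
      define f where "f = (\<Sum>r<e. monom (a r) (apery e k r))"
      have f: "coeff f n = (\<Sum>r<e. if apery e k r = n then a r else 0)" for n
        by (simp add: f_def coeff_sum coeff_monom)
      have "f \<in> ?M" unfolding semigroup_ring_iff
      proof (intro allI impI)
        fix n assume "coeff f n \<noteq> 0"
        have "\<exists>r<e. apery e k r = n"
        proof (rule ccontr)
          assume "\<not> (\<exists>r<e. apery e k r = n)"
          then have "coeff f n = 0" unfolding f by (intro sum.neutral) auto
          with \<open>coeff f n \<noteq> 0\<close> show False by contradiction
        qed
        then show "n \<in> S_sg e k" using apery_in_S by blast
      qed
      moreover have "apery_coords e k f = a"
      proof (rule ext)
        fix r
        show "apery_coords e k f r = a r"
        proof (cases "r < e")
          case True
          have "coeff f (apery e k r) = (\<Sum>r'<e. if r' = r then a r else 0)"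
            unfolding f using True apery_inj by (intro sum.cong) auto
          then show ?thesis using True by (simp add: apery_coords_def)
        qed (use a in \<open>simp add: apery_coords_def apery_space_def\<close>)
      qed
      ultimately show "a \<in> apery_coords e k ` ?M" by blast
    qed (auto simp: apery_space_def apery_coords_def)
    show "apery_coords e k v = 0 \<longleftrightarrow> (\<exists>u\<in>?M. v = R_act e (var 0) u)" if v: "v \<in> ?M" for v
    proof
      assume 0: "apery_coords e k v = 0"
      have v0: "coeff v (apery e k r) = 0" if "r < e" for r
        using fun_cong[OF 0, of r] that by (simp add: apery_coords_def)
      have S: "e \<le> n \<and> n - e \<in> S_sg e k" if "coeff v n \<noteq> 0" for n
        using v that v0 by (intro apery_minimal) (auto simp: semigroup_ring_iff)
      define u where "u = poly_shift e v"
      have low: "coeff v n = 0" if "n < e" for n using S[of n] that by force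
      have "u \<in> ?M" unfolding semigroup_ring_iff u_def coeff_poly_shift using S by fastforce
      moreover have "v = R_act e (var 0) u"
        by (intro poly_eqI) (auto simp: low R_act_var coeff_monom_mult u_def coeff_poly_shift)
      ultimately show "\<exists>u\<in>?M. v = R_act e (var 0) u" by blast
    next
      assume "\<exists>u\<in>?M. v = R_act e (var 0) u"
      then obtain u where u: "u \<in> ?M" "v = monom 1 e * u" by (auto simp: R_act_var)
      have "apery_coords e k v r = 0" for r
        using u apery_minus_e[of r]
        by (auto simp: apery_coords_def coeff_monom_mult semigroup_ring_iff)
      then show "apery_coords e k v = 0" by (simp add: fun_eq_iff)
    qed
    show "v = 0" if "R_act e (var 0) v = 0" for v :: "'a poly"
      using that by (simp add: R_act_var)
  qed (auto simp: apery_coords_def R_act_const fun_eq_iff)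
qed

end

section \<open>The Koszul homology of the Apery algebra\<close>

context apery_semigroup
begin

abbreviation "V \<equiv> Vars e k"

text \<open>The number of variables, and the largest variable of the first block if \<open>k > 1\<close>; for \<open>k = 1\<close>
  there are no product coordinates, and the pivot is not a variable.\<close>

definition nv :: nat where "nv = e - k - 1"
definition pivot :: nat where "pivot = k - 1"

lemma vars_e: "e = nv + k + 1"
  using k e by (simp add: nv_def)

lemma Suc_pivot: "Suc pivot = k"
  using k by (simp add: pivot_def)

abbreviation chains :: "nat \<Rightarrow> (nat set \<Rightarrow> nat \<Rightarrow> 'a::field) set" where
  "chains t \<equiv> koszul_chains V (apery_space e) t"

abbreviation bdiff :: "(nat set \<Rightarrow> nat \<Rightarrow> 'a::field) \<Rightarrow> nat set \<Rightarrow> nat \<Rightarrow> 'a" where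
  "bdiff \<equiv> koszul_diff (apery_act e k) V"

abbreviation cscale :: "'a::field \<Rightarrow> (nat set \<Rightarrow> nat \<Rightarrow> 'a) \<Rightarrow> nat set \<Rightarrow> nat \<Rightarrow> 'a" where
  "cscale a c \<equiv> \<lambda>J r. a * c J r"

lemma finite_V: "finite V"
  by (simp add: Vars_def)

lemma card_V: "card V = nv"
proof -
  have "card V = (k - 1) + (e - 2 * k)"
    unfolding Vars_def by (subst card_Un_disjoint) auto
  then show ?thesis using k e by (simp add: nv_def)
qed

lemma V_pos: "i \<in> V \<Longrightarrow> 0 < i"
  and V_less: "i \<in> V \<Longrightarrow> i < e"
  using k e by (auto simp: Vars_def)

lemma finite_subset_V: "J \<subseteq> V \<Longrightarrow> finite J"
  using finite_V finite_subset by blast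

lemma koszul_sign_fun: "koszul_sign j J f r = koszul_sign j J (f r :: 'b::ab_group_add)"
  by (simp add: koszul_sign_def)

lemma bdiff_eq:
  "J \<subseteq> V \<Longrightarrow> bdiff c J r = (\<Sum>j\<in>V - J. koszul_sign j J (apery_act e k j (c (insert j J)) r))"
  by (simp add: koszul_diff_def sum_fun_apply koszul_sign_fun)

lemma bdiff_zero: "J \<subseteq> V \<Longrightarrow> bdiff c J 0 = 0"
  unfolding bdiff_eq using k V_pos
  by (intro sum.neutral) (auto simp: apery_act_simps(1))

lemma bdiff_var:
  assumes "J \<subseteq> V" "r \<in> V - J"
  shows "bdiff c J r = koszul_sign r J (c (insert r J) 0)"
proof -
  have r: "r < k \<or> 2 * k \<le> r" using assms by (auto simp: Vars_def)
  have "bdiff c J r = (\<Sum>j\<in>V - J. if j = r then koszul_sign r J (c (insert r J) 0) else 0)"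
    unfolding bdiff_eq[OF assms(1)] by (intro sum.cong) (auto simp: apery_act_simps(1)[OF r])
  then show ?thesis using assms finite_V by simp
qed

lemma bdiff_product:
  assumes "J \<subseteq> V" "k \<le> r" "r \<le> 2 * k - 2"
  shows "bdiff c J r =
    (\<Sum>j\<in>V - J. koszul_sign j J (if j < k \<and> r < j + k then c (insert j J) (r - j) else 0))"
  unfolding bdiff_eq[OF assms(1)] by (intro sum.cong) (auto simp: apery_act_simps(2)[OF assms(2,3)])

lemma bdiff_socle:
  assumes "J \<subseteq> V" "Suc r = 2 * k"
  shows "bdiff c J r = (\<Sum>j\<in>V - J. koszul_sign j J (c (insert j J) (dual e k j)))"
  unfolding bdiff_eq[OF assms(1)] by (intro sum.cong) (auto simp: apery_act_simps(3)[OF assms(2)])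

text \<open>For indices below \<open>k\<close> the products satisfy \<open>x\<^sub>i x\<^sub>j = x\<^sub>m x\<^sub>l\<close> if \<open>i + j = m + l\<close>, so the
  equations of a cycle in the product coordinates are dependent: those at the sets that contain
  the pivot are signed combinations of the others. The combination is a double sum that is
  antisymmetric in its two indices, as in the proof that a Koszul differential squares to \<open>0\<close>.\<close>

lemma pivot_equations_redundant:
  fixes c :: "nat set \<Rightarrow> nat \<Rightarrow> 'a::field"
  assumes L: "L \<subseteq> V" "pivot \<in> V" "pivot \<notin> L" and m: "k \<le> m" "m \<le> 2 * k - 2"
    and eqs: "\<And>j r. j \<in> V - insert pivot L \<Longrightarrow> k \<le> r \<Longrightarrow> r \<le> 2 * k - 2 \<Longrightarrow> bdiff c (insert j L) r = 0"
  shows "bdiff c (insert pivot L) m = 0"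
proof -
  let ?p = pivot and ?P = "V - insert pivot L"
  have finL: "finite L" by (rule finite_subset_V[OF L(1)])
  define h where "h j l = (if j < k \<and> l < k \<and> m \<le> j + l then c (insert l (insert j L)) (m + ?p - j - l) else 0)"
    for j l
  have summand: "koszul_sign j (insert ?p L) (if j < k \<and> m < j + k then c (insert j (insert ?p L)) (m - j) else 0) =
      koszul_sign ?p L (\<Sum>l\<in>?P - {j}. koszul_sign j L (koszul_sign l (insert j L) (h j l)))"
    if j: "j \<in> ?P" for j
  proof (cases "j < k \<and> m < j + k")
    case True
    \<comment> \<open>The equation at \<open>insert j L\<close> in which the pivot contributes the coordinate \<open>m - j\<close>.\<close>
    define m' where "m' = m + ?p - j"
    have m': "k \<le> m'" "m' \<le> 2 * k - 2" using True m Suc_pivot by (auto simp: m'_def)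
    have jL: "insert j L \<subseteq> V" using j L by auto
    let ?t = "\<lambda>l. koszul_sign l (insert j L) (if l < k \<and> m' < l + k then c (insert l (insert j L)) (m' - l) else 0)"
    have "0 = (\<Sum>l\<in>V - insert j L. ?t l)"
      using eqs[OF j m'] bdiff_product[OF jL m', of c] by simp
    also have "V - insert j L = insert ?p (?P - {j})" using j L by auto
    also have "(\<Sum>l\<in>insert ?p (?P - {j}). ?t l) = ?t ?p + (\<Sum>l\<in>?P - {j}. ?t l)"
      using finite_V by (subst sum.insert) auto
    also have "(\<Sum>l\<in>?P - {j}. ?t l) = (\<Sum>l\<in>?P - {j}. koszul_sign l (insert j L) (h j l))"
    proof (rule sum.cong)
      fix l
      have "l < k \<and> m' < l + k \<longleftrightarrow> j < k \<and> l < k \<and> m \<le> j + l"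
        using True Suc_pivot by (auto simp: m'_def)
      then show "?t l = koszul_sign l (insert j L) (h j l)" by (simp add: h_def m'_def)
    qed simp
    also have "?t ?p = koszul_sign ?p (insert j L) (c (insert j (insert ?p L)) (m - j))"
    proof -
      have "?p < k" "m' < ?p + k" "m' - ?p = m - j" using m' Suc_pivot True m by (auto simp: m'_def)
      then show ?thesis by (simp add: insert_commute)
    qed
    finally have e1: "koszul_sign ?p (insert j L) (c (insert j (insert ?p L)) (m - j)) =
        - (\<Sum>l\<in>?P - {j}. koszul_sign l (insert j L) (h j l))"
      by (simp add: eq_neg_iff_add_eq_0)
    have "koszul_sign ?p L (koszul_sign j (insert ?p L) (c (insert j (insert ?p L)) (m - j))) =
        - koszul_sign j L (koszul_sign ?p (insert j L) (c (insert j (insert ?p L)) (m - j)))"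
      using j L by (intro koszul_sign_swap finL) auto
    also have "\<dots> = (\<Sum>l\<in>?P - {j}. koszul_sign j L (koszul_sign l (insert j L) (h j l)))"
      unfolding e1 by (simp add: koszul_sign_minus koszul_sign_sum)
    finally have "koszul_sign ?p L (koszul_sign ?p L (koszul_sign j (insert ?p L) (c (insert j (insert ?p L)) (m - j)))) =
        koszul_sign ?p L (\<Sum>l\<in>?P - {j}. koszul_sign j L (koszul_sign l (insert j L) (h j l)))"
      by simp
    then show ?thesis using True by simp
  next
    case False
    have "h j l = 0" for l using False by (auto simp: h_def)
    then show ?thesis using False by auto
  qed
  have pL: "insert ?p L \<subseteq> V" using L by auto
  have "bdiff c (insert ?p L) m = (\<Sum>j\<in>?P. koszul_sign j (insert ?p L)
      (if j < k \<and> m < j + k then c (insert j (insert ?p L)) (m - j) else 0))"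
    by (rule bdiff_product[OF pL m])
  also have "\<dots> = (\<Sum>j\<in>?P. koszul_sign ?p L (\<Sum>l\<in>?P - {j}. koszul_sign j L (koszul_sign l (insert j L) (h j l))))"
    by (rule sum.cong[OF refl summand])
  also have "\<dots> = koszul_sign ?p L (\<Sum>j\<in>?P. \<Sum>l\<in>?P - {j}. koszul_sign j L (koszul_sign l (insert j L) (h j l)))"
    by (simp add: koszul_sign_sum)
  also have "(\<Sum>j\<in>?P. \<Sum>l\<in>?P - {j}. koszul_sign j L (koszul_sign l (insert j L) (h j l))) = 0"
  proof (rule sum_antisymmetric_eq_0)
    fix j l assume jl: "j \<in> ?P" "l \<in> ?P" "j \<noteq> l"
    have "h j l = h l j" by (auto simp: h_def insert_commute add.commute diff_commute)
    then show "koszul_sign j L (koszul_sign l (insert j L) (h j l)) =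
        - koszul_sign l L (koszul_sign j (insert l L) (h l j))"
      using koszul_sign_swap[OF finL, of j l "h j l"] jl by auto
  qed (use finite_V in auto)
  finally show ?thesis by simp
qed

text \<open>An independent system of equations for the cycles of degree \<open>t\<close>: the index \<open>(J, 0)\<close> stands for
  \<open>c J 0 = 0\<close>, and any other \<open>(J, r)\<close> for the vanishing of the coordinate \<open>r\<close> of the boundary at
  \<open>J\<close>.\<close>

definition cycle_equations :: "nat \<Rightarrow> (nat set \<times> nat) set" where
  "cycle_equations t =
     {J. J \<subseteq> V \<and> card J = t} \<times> {0} \<union> {J. J \<subseteq> V \<and> card J = t - 1} \<times> {2 * k - 1} \<union>
     {J. J \<subseteq> V - {pivot} \<and> card J = t - 1} \<times> {k..2 * k - 2}"

definition cycle_equation :: "nat set \<times> nat \<Rightarrow> (nat set \<Rightarrow> nat \<Rightarrow> 'a::field) \<Rightarrow> 'a" where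
  "cycle_equation jr c = (if snd jr = 0 then c (fst jr) 0 else bdiff c (fst jr) (snd jr))"

text \<open>The number of these equations, which is the rank of the differential in degree \<open>t\<close>.\<close>

definition drank :: "nat \<Rightarrow> nat" where
  "drank t = (if 1 \<le> t \<and> t \<le> nv
     then (nv choose t) + (nv choose (t - 1)) + (k - 1) * ((nv - 1) choose (t - 1)) else 0)"

lemma finite_subsets: "finite {J. J \<subseteq> V - X \<and> card J = t}"
  by (rule finite_subset[of _ "Pow V"]) (auto simp: finite_V)

lemma card_cycle_equations:
  assumes "1 \<le> t" "t \<le> nv"
  shows "card (cycle_equations t) = drank t"
proof -
  let ?A = "{J. J \<subseteq> V \<and> card J = t} \<times> {0 :: nat}"
    and ?B = "{J. J \<subseteq> V \<and> card J = t - 1} \<times> {2 * k - 1}"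
    and ?C = "{J. J \<subseteq> V - {pivot} \<and> card J = t - 1} \<times> {k..2 * k - 2}"
  have fin: "finite ?A" "finite ?B" "finite ?C"
    using finite_subsets[of "{}"] finite_subsets[of "{pivot}"] by auto
  have disj: "?A \<inter> ?B = {}" "(?A \<union> ?B) \<inter> ?C = {}" using k by auto
  have A: "card ?A = nv choose t" "card ?B = nv choose (t - 1)"
    using n_subsets[OF finite_V] by (simp_all add: card_cartesian_product card_V)
  have C: "card ?C = (k - 1) * ((nv - 1) choose (t - 1))"
  proof (cases "k = 1")
    case False
    then have "pivot \<in> V" using k by (auto simp: Vars_def pivot_def)
    then have "card (V - {pivot}) = nv - 1" using card_V by simp
    moreover have "card {k..2 * k - 2} = k - 1" using False k by simp
    ultimately show ?thesis
      using n_subsets[of "V - {pivot}" "t - 1"] finite_V by (simp add: card_cartesian_product mult.commute)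
  qed simp
  have "card (cycle_equations t) = card ?A + card ?B + card ?C"
    unfolding cycle_equations_def using fin disj by (simp add: card_Un_disjoint)
  then show ?thesis using assms A C by (simp add: drank_def)
qed

text \<open>The coordinates of the boundary at residues \<open>r\<close> in \<open>V\<close> only see the multiples of \<open>1\<close> in \<open>c\<close>, and
  determine them. The product coordinates at sets that contain the pivot are redundant.\<close>

lemma cycles_eq:
  fixes t :: nat
  assumes t: "1 \<le> t"
  shows "koszul_cycles (apery_act e k) V (apery_space e :: (nat \<Rightarrow> 'a::field) set) t =
    {c \<in> chains t. \<forall>jr\<in>cycle_equations t. cycle_equation jr c = 0}"
proof (intro equalityI subsetI)
  fix c :: "nat set \<Rightarrow> nat \<Rightarrow> 'a"
  assume c: "c \<in> koszul_cycles (apery_act e k) V (apery_space e) t"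
  then have ch: "c \<in> chains t" and d: "bdiff c J r = 0" for J r by (auto simp: koszul_cycles_def)
  have "c J 0 = 0" if J: "J \<subseteq> V" "card J = t" for J
  proof -
    have "J \<noteq> {}" using J t by auto
    then obtain j where j: "j \<in> J" by blast
    have "bdiff c (J - {j}) j = koszul_sign j (J - {j}) (c (insert j (J - {j})) 0)"
      using J j by (intro bdiff_var) auto
    then show ?thesis using j d by (auto simp: koszul_sign_def insert_absorb split: if_splits)
  qed
  then show "c \<in> {c \<in> chains t. \<forall>jr\<in>cycle_equations t. cycle_equation jr c = 0}"
    using ch d k by (auto simp: cycle_equations_def cycle_equation_def)
next
  fix c :: "nat set \<Rightarrow> nat \<Rightarrow> 'a"
  assume "c \<in> {c \<in> chains t. \<forall>jr\<in>cycle_equations t. cycle_equation jr c = 0}"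
  then have ch: "c \<in> chains t" and eq: "\<And>jr. jr \<in> cycle_equations t \<Longrightarrow> cycle_equation jr c = 0" by auto
  interpret A: variable_action "\<lambda>c (f :: nat \<Rightarrow> 'a) r. c * f r" "apery_act e k" V
    by (rule apery_variable_action)
  have c0: "c J 0 = 0" for J
  proof (cases "J \<subseteq> V \<and> card J = t")
    case True
    then show ?thesis using eq[of "(J, 0)"] by (simp add: cycle_equations_def cycle_equation_def)
  next
    case False
    then show ?thesis using koszul_chainsD(2)[OF ch] by simp
  qed
  have low_card: "bdiff c J r = 0" if "J \<subseteq> V" "card J \<noteq> t - 1" for J r
  proof -
    have "c (insert j J) = 0" if "j \<in> V - J" for j
    proof -
      have "card (insert j J) \<noteq> t"
        using that \<open>card J \<noteq> t - 1\<close> finite_subset_V[OF \<open>J \<subseteq> V\<close>] by auto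
      then show ?thesis using koszul_chainsD(2)[OF ch] by blast
    qed
    then show ?thesis using that(1) by (simp add: koszul_diff_def)
  qed
  have noproduct: "bdiff c J r = 0" if "J \<subseteq> V - {pivot}" "k \<le> r" "r \<le> 2 * k - 2" for J r
  proof (cases "card J = t - 1")
    case True
    then show ?thesis
      using eq[of "(J, r)"] that k by (auto simp: cycle_equations_def cycle_equation_def)
  next
    case False
    then show ?thesis using low_card that by blast
  qed
  have "bdiff c J r = 0" for J r
  proof (cases "J \<subseteq> V")
    case J: True
    show ?thesis
    proof (cases r rule: residue_cases)
      case zero
      then show ?thesis by (simp add: bdiff_zero[OF J])
    next
      case var
      have "koszul_sign j J (apery_act e k j (c (insert j J)) r) = 0" for j
        by (simp add: apery_act_simps(1)[OF var(2)] c0)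
      then show ?thesis by (simp add: bdiff_eq[OF J])
    next
      case product
      show ?thesis
      proof (cases "pivot \<in> J")
        case True
        have "J = insert pivot (J - {pivot})" using True by auto
        moreover have "bdiff c (insert pivot (J - {pivot})) r = 0"
        proof (rule pivot_equations_redundant)
          show "bdiff c (insert j (J - {pivot})) r = 0"
            if "j \<in> V - insert pivot (J - {pivot})" "k \<le> r" "r \<le> 2 * k - 2" for j r
            using that J by (intro noproduct) auto
        qed (use J True product in auto)
        ultimately show ?thesis by simp
      next
        case False
        then show ?thesis using J product by (intro noproduct) auto
      qed
    next
      case socle
      show ?thesis
      proof (cases "card J = t - 1")
        case True
        have "r = 2 * k - 1" "r \<noteq> 0" using socle by presburger+
        then show ?thesis using eq[of "(J, r)"] J True
          by (simp add: cycle_equations_def cycle_equation_def)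
      qed (use low_card J in blast)
    qed
  qed (simp add: koszul_diff_outside)
  then have "bdiff c = 0" by (simp add: fun_eq_iff)
  then show "c \<in> koszul_cycles (apery_act e k) V (apery_space e) t"
    using ch by (simp add: koszul_cycles_def)
qed

lemma dual_props:
  assumes "i \<in> V"
  shows "k \<le> dual e k i" "dual e k i < e"
  using assms k e by (auto simp: dual_def Vars_def)

text \<open>The variable whose dual basis vector is \<open>r\<close>.\<close>

definition dual_var :: "nat \<Rightarrow> nat" where
  "dual_var r = (if r < 2 * k then 2 * k - 1 - r else e + 2 * k - 1 - r)"

lemma dual_var_dual: "i \<in> V \<Longrightarrow> dual_var (dual e k i) = i"
  using k e by (auto simp: dual_def dual_var_def Vars_def)

text \<open>The equations are independent: the coordinates of \<open>c\<close> that meet a single equation each can be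
  prescribed. For the product equation at \<open>(J, m)\<close> this is the coordinate \<open>m - pivot\<close> of
  \<open>c (insert pivot J)\<close>, and for the socle equation at \<open>J\<close> it is the coordinate dual to \<open>i\<close> of
  \<open>c (insert i J)\<close>, where \<open>i\<close> is the smallest variable outside \<open>J\<close>.\<close>

lemma cycle_equations_independent:
  fixes y :: "nat set \<times> nat \<Rightarrow> 'a::field"
  assumes t: "1 \<le> t" "t \<le> nv"
  shows "\<exists>c\<in>chains t. \<forall>jr\<in>cycle_equations t. cycle_equation jr c = y jr"
proof -
  define c where "c J r = (if J \<subseteq> V \<and> card J = t \<and> r < e then
      if r = 0 then y (J, 0)
      else if r < k then (if pivot \<in> J then koszul_sign pivot (J - {pivot}) (y (J - {pivot}, r + pivot)) else 0)
      else if dual_var r \<in> J \<and> dual_var r = Min (V - (J - {dual_var r}))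
        then koszul_sign (dual_var r) (J - {dual_var r}) (y (J - {dual_var r}, 2 * k - 1))
      else 0 else 0)" for J r
  have "c \<in> chains t"
    by (intro koszul_chainsI) (auto simp: c_def apery_space_def fun_eq_iff)
  moreover have "cycle_equation jr c = y jr" if jr: "jr \<in> cycle_equations t" for jr
  proof -
    obtain J r where jr_eq: "jr = (J, r)" by fastforce
    consider "J \<subseteq> V" "card J = t" "r = 0" | "J \<subseteq> V" "card J = t - 1" "r = 2 * k - 1"
      | "J \<subseteq> V" "pivot \<notin> J" "card J = t - 1" "k \<le> r" "r \<le> 2 * k - 2"
      using jr unfolding jr_eq cycle_equations_def by auto
    then show ?thesis
    proof cases
      case 1
      then show ?thesis using e by (simp add: jr_eq cycle_equation_def c_def)
    next
      case 2
      have finJ: "finite J" by (rule finite_subset_V[OF 2(1)])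
      have r: "Suc r = 2 * k" "r \<noteq> 0" using 2 k by auto
      have "J \<noteq> V" using 2(2) t card_V by auto
      then have ne: "V - J \<noteq> {}" using 2(1) by blast
      define i where "i = Min (V - J)"
      have i: "i \<in> V - J" unfolding i_def using finite_V ne by (intro Min_in) auto
      have "koszul_sign j J (c (insert j J) (dual e k j)) = (if j = i then y (J, r) else 0)"
        if j: "j \<in> V - J" for j
      proof -
        have jV: "j \<in> V" using j by simp
        have *: "insert j J \<subseteq> V \<and> card (insert j J) = t \<and> dual e k j < e"
          "dual e k j \<noteq> 0" "\<not> dual e k j < k"
          using j finJ 2(1,2) t dual_props[OF jV] k by auto
        have J: "insert j J - {j} = J" using j by auto
        have "c (insert j J) (dual e k j) = (if j = i then koszul_sign j J (y (J, 2 * k - 1)) else 0)"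
          unfolding c_def dual_var_dual[OF jV] J i_def using * by simp
        then show ?thesis by (simp add: 2(3))
      qed
      then have "bdiff c J r = (\<Sum>j\<in>V - J. if j = i then y (J, r) else 0)"
        unfolding bdiff_socle[OF 2(1) r(1)] by (rule sum.cong[OF refl])
      also have "\<dots> = y (J, r)" using i finite_V by simp
      finally show ?thesis using r by (simp add: jr_eq cycle_equation_def)
    next
      case 3
      have finJ: "finite J" by (rule finite_subset_V[OF 3(1)])
      have "1 \<le> pivot" using 3(4,5) Suc_pivot by linarith
      moreover have "pivot < k" using Suc_pivot by linarith
      ultimately have "pivot \<in> V" by (simp add: Vars_def)
      then have p: "pivot \<in> V - J" using 3(2) by blast
      have "koszul_sign j J (if j < k \<and> r < j + k then c (insert j J) (r - j) else 0) =
          (if j = pivot then y (J, r) else 0)" if j: "j \<in> V - J" for j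
      proof (cases "j < k \<and> r < j + k")
        case True
        have *: "r - j \<noteq> 0" "r - j < k" "r - j < e" using True 3 e by auto
        have "card (insert j J) = t" using j finJ 3(3) t by simp
        then have "c (insert j J) (r - j) =
            (if pivot \<in> insert j J then koszul_sign pivot (insert j J - {pivot}) (y (insert j J - {pivot}, r - j + pivot)) else 0)"
          using * j 3(1) by (simp add: c_def)
        then show ?thesis using True j 3 by auto
      next
        case False
        then have "j \<noteq> pivot" using 3(4,5) Suc_pivot by auto
        then show ?thesis using False by auto
      qed
      then have "bdiff c J r = (\<Sum>j\<in>V - J. if j = pivot then y (J, r) else 0)"
        unfolding bdiff_product[OF 3(1,4,5)] by (rule sum.cong[OF refl])
      also have "\<dots> = y (J, r)" using p finite_V by simp
      finally show ?thesis using 3 k by (simp add: jr_eq cycle_equation_def)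
    qed
  qed
  ultimately show ?thesis by blast
qed

lemma chains_dim: "quotient_dim cscale (chains t :: (nat set \<Rightarrow> nat \<Rightarrow> 'a::field) set) {0} (e * (nv choose t))"
proof -
  let ?I = "{J. J \<subseteq> V \<and> card J = t} \<times> {..<e}"
  have "quotient_dim cscale (chains t :: (nat set \<Rightarrow> nat \<Rightarrow> 'a) set) {0} (card ?I)"
  proof (rule quotient_dimI[where f = "\<lambda>(J, r) c. c J r"])
    show "finite ?I" using finite_subsets[of "{}" t] by simp
    show "linear_functional_on cscale (chains t) ((\<lambda>(J, r) c. c J r) i)" for i
      by (cases i) (simp add: linear_functional_on_def)
    show "\<exists>c\<in>chains t. \<forall>i\<in>?I. (\<lambda>(J, r) c. c J r) i c = a i" for a :: "nat set \<times> nat \<Rightarrow> 'a"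
      by (intro bexI[of _ "\<lambda>J r. if J \<subseteq> V \<and> card J = t \<and> r < e then a (J, r) else 0"] koszul_chainsI)
        (auto simp: apery_space_def fun_eq_iff)
    show "{0} = {c \<in> chains t. \<forall>i\<in>?I. (\<lambda>(J, r) c. c J r) i c = (0 :: 'a)}"
    proof (intro equalityI subsetI)
      fix c assume "c \<in> {c \<in> chains t. \<forall>i\<in>?I. (\<lambda>(J, r) c. c J r) i c = (0 :: 'a)}"
      then have ch: "c \<in> chains t" and c: "\<And>J r. J \<subseteq> V \<Longrightarrow> card J = t \<Longrightarrow> r < e \<Longrightarrow> c J r = 0" by auto
      have "c J r = 0" for J r
      proof (cases "J \<subseteq> V \<and> card J = t")
        case True
        then show ?thesis using c[of J r] koszul_chainsD(1)[OF ch, of J] by (cases "r < e") (auto simp: apery_space_def)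
      next
        case False
        then show ?thesis using koszul_chainsD(2)[OF ch] by simp
      qed
      then show "c \<in> {0}" by (simp add: fun_eq_iff)
    qed (auto simp: koszul_chains_def apery_space_def)
  qed
  then show ?thesis using n_subsets[OF finite_V, of t] by (simp add: card_cartesian_product card_V mult.commute)
qed

text \<open>For \<open>t = 0\<close> every chain is a cycle, and above \<open>nv\<close> the only chain is \<open>0\<close>; there the rank is
  \<open>0\<close>.\<close>

lemma chains_mod_cycles_dim:
  "quotient_dim cscale (chains t :: (nat set \<Rightarrow> nat \<Rightarrow> 'a::field) set)
     (koszul_cycles (apery_act e k) V (apery_space e) t) (drank t)"
proof -
  interpret A: variable_action "\<lambda>c (f :: nat \<Rightarrow> 'a) r. c * f r" "apery_act e k" V
    by (rule apery_variable_action)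
  interpret C: vector_space "cscale :: 'a \<Rightarrow> _" by (rule A.vector_space_chains)
  have 0: "0 \<in> chains s" for s by (simp add: koszul_chains_def apery_space_def)
  show ?thesis
  proof (cases "1 \<le> t \<and> t \<le> nv")
    case True
    have "quotient_dim cscale (chains t :: (nat set \<Rightarrow> nat \<Rightarrow> 'a) set)
        (koszul_cycles (apery_act e k) V (apery_space e) t) (card (cycle_equations t))"
    proof (rule quotient_dimI[where f = cycle_equation])
      show "finite (cycle_equations t)"
        unfolding cycle_equations_def using finite_subsets[of "{}"] finite_subsets[of "{pivot}"] by auto
      show "linear_functional_on cscale (chains t) (cycle_equation jr :: _ \<Rightarrow> 'a)" for jr
        by (auto simp: linear_functional_on_def cycle_equation_def A.diff_add A.diff_scale)
      show "\<exists>c\<in>chains t. \<forall>jr\<in>cycle_equations t. cycle_equation jr c = y jr" for y :: "_ \<Rightarrow> 'a"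
        using cycle_equations_independent True by blast
    qed (use cycles_eq True in blast)
    then show ?thesis using card_cycle_equations True by simp
  next
    case False
    have "koszul_cycles (apery_act e k) V (apery_space e :: (nat \<Rightarrow> 'a) set) t = chains t"
    proof (cases "t = 0")
      case True
      then show ?thesis by (simp add: A.cycles_0)
    next
      case nz: False
      have "c = 0" if c: "c \<in> (chains t :: (nat set \<Rightarrow> nat \<Rightarrow> 'a) set)" for c
      proof (rule ext)
        fix J
        have "\<not> (J \<subseteq> V \<and> card J = t)" using card_mono[OF finite_V, of J] False nz card_V by auto
        then show "c J = 0 J" using koszul_chainsD(2)[OF c] by simp
      qed
      then have *: "(chains t :: (nat set \<Rightarrow> nat \<Rightarrow> 'a) set) = {0}" using 0 by blast
      show ?thesis unfolding koszul_cycles_def * using A.diff_0 by blast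
    qed
    then show ?thesis using C.qdim_self[of "chains t"] 0 False by (auto simp: drank_def)
  qed
qed

theorem apery_homology:
  "koszul_homology_dim (\<lambda>c f r. c * f r) (apery_act e k) V (apery_space e :: (nat \<Rightarrow> 'a::field) set) t
     (e * (nv choose t) - drank t - drank (Suc t))"
proof -
  interpret A: variable_action "\<lambda>c (f :: nat \<Rightarrow> 'a) r. c * f r" "apery_act e k" V
    by (rule apery_variable_action)
  interpret C: vector_space "cscale :: 'a \<Rightarrow> _" by (rule A.vector_space_chains)
  let ?A = "apery_space e :: (nat \<Rightarrow> 'a) set"
  let ?Z = "koszul_cycles (apery_act e k) V ?A" and ?B = "koszul_boundaries (apery_act e k) V ?A"
  have A_sub: "A.subspace ?A" by (rule A.subspaceI) (auto simp: apery_space_def)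
  have A_mod: "A.submodule ?A"
    using A_sub e by (auto simp: A.submodule_def apery_space_def apery_act_simps(1) dest: V_less)
  have B: "quotient_dim cscale (?B t) {0} (drank (Suc t))"
  proof (rule quotient_dim_transfer[where L = "\<lambda>c b. c \<in> chains (Suc t) \<and> b = bdiff c",
        OF A.vector_space_chains A.subspace_chains[OF A_sub] chains_mod_cycles_dim _ _ _ A.vector_space_chains])
    show "\<And>u v :: nat set \<Rightarrow> nat \<Rightarrow> 'a. u \<in> chains (Suc t) \<and> v = bdiff u \<Longrightarrow> u \<in> chains (Suc t) \<and> v \<in> ?B t"
      by (auto simp: koszul_boundaries_def)
    show "\<And>u v u' v' :: nat set \<Rightarrow> nat \<Rightarrow> 'a. u \<in> chains (Suc t) \<and> v = bdiff u \<Longrightarrow> u' \<in> chains (Suc t) \<and> v' = bdiff u' \<Longrightarrow>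
        u + u' \<in> chains (Suc t) \<and> v + v' = bdiff (u + u')"
      using C.subspace_add[OF A.subspace_chains[OF A_sub]] by (auto simp: A.diff_add)
    show "\<And>(c :: 'a) u v. u \<in> chains (Suc t) \<and> v = bdiff u \<Longrightarrow> cscale c u \<in> chains (Suc t) \<and> cscale c v = bdiff (cscale c u)"
      using C.subspace_scale[OF A.subspace_chains[OF A_sub]] A.diff_scale by auto
    show "\<And>u v :: nat set \<Rightarrow> nat \<Rightarrow> 'a. u \<in> chains (Suc t) \<and> v = bdiff u \<Longrightarrow> (u \<in> ?Z (Suc t)) = (v \<in> {0})"
      by (auto simp: koszul_cycles_def)
    show "{0} \<subseteq> ?B t" using C.subspace_0[OF A.subspace_boundaries[OF A_sub]] by simp
  qed (auto simp: koszul_boundaries_def)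
  have "drank t + drank (Suc t) \<le> e * (nv choose t) \<and> quotient_dim cscale (?Z t) (?B t) (e * (nv choose t) - drank t - drank (Suc t))"
  proof (rule C.qdim_subquotient[OF A.subspace_chains[OF A_sub] A.subspace_cycles[OF A_sub]
        A.subspace_boundaries[OF A_sub] _ _ _ chains_dim chains_mod_cycles_dim B])
    show "{0} \<subseteq> ?B t" using C.subspace_0[OF A.subspace_boundaries[OF A_sub]] by simp
    show "?B t \<subseteq> ?Z t" by (rule A.boundaries_subset_cycles[OF A_mod])
  qed (auto simp: koszul_cycles_def)
  then show ?thesis by (simp add: koszul_homology_dim_def)
qed

end

section \<open>Betti numbers of the semigroup ring\<close>

text \<open>The two sums in the first two lines are consecutive ranks of the differential. By Pascal's rule
  their parts with \<open>k\<close> add up to \<open>(k-1) (n choose t)\<close>; absorption, applied at \<open>t\<close> and at \<open>t-1\<close>, collects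
  the rest.\<close>

lemma betti_binomial_identity:
  fixes n k t :: nat
  assumes "1 \<le> t" "t < n" "1 \<le> k"
  shows "(n choose t) + (n choose (t - 1)) + (k - 1) * ((n - 1) choose (t - 1)) +
      ((n choose Suc t) + (n choose t) + (k - 1) * ((n - 1) choose t)) +
      (t * (n choose (t + 1)) + (n - t) * (n choose (t - 1))) = (n + k + 1) * (n choose t)"
proof -
  obtain s where s: "t = Suc s" using assms(1) by (cases t) auto
  obtain q where q: "k = Suc q" using assms(3) by (cases k) auto
  obtain d where d: "n = t + Suc d" using assms(2) less_imp_Suc_add by fastforce
  have absorb: "Suc i * (n choose Suc i) = (n - i) * (n choose i)" for i
    using binomial_absorption[of i n] binomial_absorb_comp[of n i] by simp
  have up: "(n choose Suc t) + t * (n choose Suc t) = Suc d * (n choose t)"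
    using absorb[of t] d by simp
  have down: "(n choose s) + Suc d * (n choose s) = t * (n choose t)"
    using absorb[of s] d s by simp
  have pascal: "((n - 1) choose s) + ((n - 1) choose t) = n choose t"
    using d s by simp
  have "(n choose t) + (n choose s) + q * ((n - 1) choose s) +
      ((n choose Suc t) + (n choose t) + q * ((n - 1) choose t)) +
      (t * (n choose Suc t) + Suc d * (n choose s)) =
      2 * (n choose t) + q * (((n - 1) choose s) + ((n - 1) choose t)) +
      ((n choose Suc t) + t * (n choose Suc t)) + ((n choose s) + Suc d * (n choose s))"
    by (simp only: distrib_left)
  also have "\<dots> = (n + k + 1) * (n choose t)"
    unfolding up down pascal using d q by (simp add: algebra_simps)
  finally show ?thesis using s q d by simp
qed

context apery_semigroup
begin

theorem betti_numbers:
  "has_betti_number_S TYPE('a::field) e k t (e * (nv choose t) - drank t - drank (Suc t))"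
  unfolding has_betti_number_S_def R_vars_eq[OF k e]
proof (rule has_betti_numberI[where \<beta> = "\<lambda>t. e * (nv choose t) - drank t - drank (Suc t)"])
  show "graded_module (R_act e :: 'a mpoly \<Rightarrow> _) (\<lambda>i. e + i) poly_proj" by (rule graded_module_R_act)
  show "graded_submodule (R_act e) poly_proj (insert 0 V) (semigroup_ring (S_sg e k) :: 'a poly set)"
    by (rule graded_submodule_semigroup_ring[OF S_0 S_add S_sg_vars])
  show "homology_dim (R_act e) (insert 0 V) (semigroup_ring (S_sg e k) :: 'a poly set) i
      (e * (nv choose i) - drank i - drank (Suc i))" for i
    by (rule nonzerodivisor_reduction.homology_reduction[OF apery_reduction apery_homology])
qed (use e finite_V semigroup_ring_piece_eq in auto)

lemma betti_middle:
  assumes t: "1 \<le> t" "t < nv"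
  shows "e * (nv choose t) - drank t - drank (Suc t) =
    t * (nv choose (t + 1)) + (nv - t) * (nv choose (t - 1))"
proof -
  have "drank t + drank (Suc t) + (t * (nv choose (t + 1)) + (nv - t) * (nv choose (t - 1))) =
      (nv + k + 1) * (nv choose t)"
    using betti_binomial_identity[OF t k] t unfolding drank_def by simp
  then show ?thesis unfolding vars_e[symmetric] by linarith
qed

lemma betti_top:
  assumes "1 \<le> nv"
  shows "e * (nv choose nv) - drank nv - drank (Suc nv) = 1"
proof -
  obtain m where m: "nv = Suc m" using assms by (cases nv) auto
  have "drank nv = 1 + nv + (k - 1)" "drank (Suc nv) = 0"
    unfolding drank_def m by auto
  then show ?thesis using k vars_e by simp
qed

end

theorem corollary3p7:
  fixes e k :: nat
  assumes "1 \<le> e" and "1 \<le> k" and "2 * k \<le> e - 1" and "4 \<le> e - k"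
  shows "(\<forall>t. 1 \<le> t \<and> t \<le> e - k - 2 \<longrightarrow>
            has_betti_number_S TYPE('a::field) e k t
              (t * ((e - k - 1) choose (t + 1)) + (e - k - 1 - t) * ((e - k - 1) choose (t - 1))))
       \<and> has_betti_number_S TYPE('a) e k (e - k - 1) 1"
proof -
  interpret apery_semigroup e k by unfold_locales (use assms in auto)
  show ?thesis
  proof (intro conjI allI impI)
    fix t assume t: "1 \<le> t \<and> t \<le> e - k - 2"
    then have "t < nv" using assms(4) unfolding nv_def by linarith
    then show "has_betti_number_S TYPE('a) e k t
        (t * ((e - k - 1) choose (t + 1)) + (e - k - 1 - t) * ((e - k - 1) choose (t - 1)))"
      using betti_numbers[where ?'a = 'a, of t] betti_middle[of t] t unfolding nv_def by simp
  next
    have "1 \<le> nv" using assms(4) unfolding nv_def by linarith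
    then show "has_betti_number_S TYPE('a) e k (e - k - 1) 1"
      using betti_numbers[where ?'a = 'a, of nv] betti_top unfolding nv_def by simp
  qed
qed

end
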